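(* Let $\mathfrak g$ be a complex simple Lie algebra of type $D_l$ and let $I\subset\Pi$ be of cardinality $r$. Set $t=\sharp(\{\alpha_{l-1},\alpha_l\}\cap I)$. If $\alpha_1\in I$, then the cardinality of $\mathcal F_I^{ab}$ is: (i) $\displaystyle 2^{l-r}-2^{l-r-2}+\sum_{j=1}^{s}\left[2\binom{l-r-1}{l_j-1}-\binom{l-r-2}{l_j-1}\right]$, if $t=0$; (ii) $\displaystyle 2^{l-r-1}+\sum_{j=1}^{s}\binom{l-r-1}{l_j-1}$, if $t=1$; (iii) $\displaystyle 2^{l-r-1}+\sum_{j=1}^{s-1}\binom{l-r-1}{l_j-1}$, if $t=2$. If $\alpha_1\notin I$, then the cardinality of $\mathcal F_I^{ab}$ is: (iv) $\displaystyle 2^{l-r}+\sum_{j=1}^{s}2\binom{l-r-1}{l_j-1}$, if $t=0$; (v) $\displaystyle 2^{l-r-1}+2^{l-r-2}+\sum_{j=1}^{s}\binom{l-r-1}{l_j-1}+\sum_{j=1}^{s-1}\binom{l-r-2}{l_j-1}$, if $t=1$; (vi) $\displaystyle 2^{l-r}+2\sum_{j=1}^{s-1}\binom{l-r-1}{l_j-1}$, if $t=2$.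
   Context: $\Delta$ is the root system of $\mathfrak g$ with respect to a Cartan subalgebra $\mathfrak h$, $\Delta^+$ the positive roots, $\Pi=\{\alpha_1,\dots,\alpha_l\}$ the simple roots ($l\ge4$), numbered so that $\alpha_1,\dots,\alpha_{l-2}$ form a chain in the Dynkin diagram and $\alpha_{l-1},\alpha_l$ are both joined to $\alpha_{l-2}$; $\mathfrak g_\alpha$ are the root spaces. For $I\subset\Pi$, $\Delta_I=\mathbb ZI\cap\Delta$, $\mathfrak p_I=\mathfrak h\oplus\bigoplus_{\alpha\in\Delta_I\cup\Delta^+}\mathfrak g_\alpha$, $\mathcal F_I=\{\Phi\subset\Delta^+\setminus\Delta_I:\ \alpha\in\Phi,\ \beta\in\Delta^+\cup\Delta_I,\ \alpha+\beta\in\Delta^+\Rightarrow\alpha+\beta\in\Phi\}$ and, for $\Phi\in\mathcal F_I$, $\mathfrak i_\Phi=\bigoplus_{\alpha\in\Phi}\mathfrak g_\alpha$ (an ad-nilpotent ideal of $\mathfrak p_I$). $\mathcal F_I^{ab}=\{\Phi\in\mathcal F_I:\mathfrak i_\Phi\text{ is abelian}\}$. $I_1,\dots,I_s$ are the connected components of $I$ in the Dynkin diagram, $r_j=\sharp I_j$, $m_j=\min\{i:\alpha_i\in I_j\}$, ordered so that $m_1<\dots<m_s$ ($s=0$ if $I=\emptyset$). Set $l_j=m_j-\sum_{k=1}^{j-1}r_k$, except that if $I_s=\{\alpha_l\}$ then $l_s=m_s-\sum_{k=1}^{s-1}r_k-1$. As usual $\binom ab=0$ if $b>a\ge0$.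
   Formalization: For I = Π (case (iii) with r = l) the printed formula gives 2^{-1}, although the cardinality is 1 (only Φ = ∅); there the exponent l−r−1 is read as 0, which gives the correct value 1. For every proper subset I the formulas are exactly as printed. *)

theory Defs
  imports Complex_Main "HOL-Library.Function_Algebras"
begin

section \<open>Complex Lie algebras\<close>

class complex_lie_algebra = ab_group_add +
  fixes cscale :: "complex \<Rightarrow> 'a \<Rightarrow> 'a"
    and bracket :: "'a \<Rightarrow> 'a \<Rightarrow> 'a"
  assumes cscale_add_right: "cscale c (x + y) = cscale c x + cscale c y"
    and cscale_add_left: "cscale (c + d) x = cscale c x + cscale d x"
    and cscale_cscale: "cscale c (cscale d x) = cscale (c * d) x"
    and cscale_one: "cscale 1 x = x"
    and bracket_add_left: "bracket (x + y) z = bracket x z + bracket y z"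
    and bracket_add_right: "bracket x (y + z) = bracket x y + bracket x z"
    and bracket_cscale_left: "bracket (cscale c x) y = cscale c (bracket x y)"
    and bracket_cscale_right: "bracket x (cscale c y) = cscale c (bracket x y)"
    and bracket_self: "bracket x x = 0"
    and jacobi: "bracket x (bracket y z) + bracket y (bracket z x) + bracket z (bracket x y) = 0"

lemma vector_space_cscale:
  "vector_space (cscale :: complex \<Rightarrow> 'g \<Rightarrow> 'g::complex_lie_algebra)"
  by unfold_locales
    (simp_all add: cscale_add_right cscale_add_left cscale_cscale cscale_one)

abbreviation cspan :: "'g::complex_lie_algebra set \<Rightarrow> 'g set" where
  "cspan \<equiv> module.span cscale"

abbreviation csubspace :: "'g::complex_lie_algebra set \<Rightarrow> bool" where
  "csubspace \<equiv> module.subspace cscale"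

definition abelian :: "'g::complex_lie_algebra set \<Rightarrow> bool" where
  "abelian A \<longleftrightarrow> (\<forall>x\<in>A. \<forall>y\<in>A. bracket x y = 0)"

definition lie_subalgebra :: "'g::complex_lie_algebra set \<Rightarrow> bool" where
  "lie_subalgebra K \<longleftrightarrow> csubspace K \<and> (\<forall>x\<in>K. \<forall>y\<in>K. bracket x y \<in> K)"

definition lie_ideal :: "'g::complex_lie_algebra set \<Rightarrow> bool" where
  "lie_ideal J \<longleftrightarrow> csubspace J \<and> (\<forall>x. \<forall>y\<in>J. bracket x y \<in> J)"

text \<open>The Lie algebra is the whole type.\<close>

definition simple_lie_algebra :: "'g::complex_lie_algebra itself \<Rightarrow> bool" where
  "simple_lie_algebra _ \<longleftrightarrow>
     (\<exists>B::'g set. finite B \<and> cspan B = UNIV) \<and>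
     \<not> abelian (UNIV :: 'g set) \<and>
     (\<forall>J::'g set. lie_ideal J \<longrightarrow> J = {0} \<or> J = UNIV)"

definition ad_semisimple :: "'g::complex_lie_algebra \<Rightarrow> bool" where
  "ad_semisimple x \<longleftrightarrow> cspan {v. \<exists>c. bracket x v = cscale c v} = UNIV"

text \<open>
  For a semisimple Lie algebra over the complex numbers, a Cartan subalgebra is a maximal abelian
  subalgebra all of whose elements are ad-semisimple, i.e. ad-diagonalizable.
\<close>

definition cartan_subalgebra :: "'g::complex_lie_algebra set \<Rightarrow> bool" where
  "cartan_subalgebra H \<longleftrightarrow>
     lie_subalgebra H \<and> abelian H \<and>
     (\<forall>K. lie_subalgebra K \<and> abelian K \<and> H \<subseteq> K \<longrightarrow> K = H) \<and>
     (\<forall>x\<in>H. ad_semisimple x)"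


section \<open>Roots\<close>

text \<open>
  A linear form on \<open>H\<close> is represented by the function on the whole Lie algebra that extends it
  by \<open>0\<close> outside \<open>H\<close>; sums and negatives of forms are then the pointwise ones.
\<close>

definition dual :: "'g::complex_lie_algebra set \<Rightarrow> ('g \<Rightarrow> complex) set" where
  "dual H = {f. (\<forall>x\<in>H. \<forall>y\<in>H. f (x + y) = f x + f y) \<and>
                (\<forall>c. \<forall>x\<in>H. f (cscale c x) = c * f x) \<and>
                (\<forall>x. x \<notin> H \<longrightarrow> f x = 0)}"

definition root_space :: "'g::complex_lie_algebra set \<Rightarrow> ('g \<Rightarrow> complex) \<Rightarrow> 'g set" where
  "root_space H \<gamma> = {x. \<forall>h\<in>H. bracket h x = cscale (\<gamma> h) x}"

definition roots :: "'g::complex_lie_algebra set \<Rightarrow> ('g \<Rightarrow> complex) set" where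
  "roots H = {\<gamma> \<in> dual H. \<gamma> \<noteq> 0 \<and> root_space H \<gamma> \<noteq> {0}}"

definition coroot :: "'g::complex_lie_algebra set \<Rightarrow> ('g \<Rightarrow> complex) \<Rightarrow> 'g" where
  "coroot H \<gamma> =
     (THE h. h \<in> cspan {bracket x y |x y. x \<in> root_space H \<gamma> \<and> y \<in> root_space H (- \<gamma>)} \<and>
             \<gamma> h = 2)"

definition int_span :: "('g \<Rightarrow> complex) set \<Rightarrow> ('g \<Rightarrow> complex) set" where
  "int_span P = {\<lambda>x. \<Sum>\<gamma>\<in>P. of_int (c \<gamma>) * \<gamma> x |c. True}"

definition nat_span :: "('g \<Rightarrow> complex) set \<Rightarrow> ('g \<Rightarrow> complex) set" where
  "nat_span P = {\<lambda>x. \<Sum>\<gamma>\<in>P. of_nat (c \<gamma>) * \<gamma> x |c. True}"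

definition root_base :: "'g::complex_lie_algebra set \<Rightarrow> ('g \<Rightarrow> complex) set \<Rightarrow> bool" where
  "root_base H P \<longleftrightarrow>
     finite P \<and> P \<subseteq> roots H \<and>
     \<not> module.dependent (\<lambda>c f x. c * f x) P \<and>
     (\<forall>\<gamma>\<in>roots H. \<gamma> \<in> nat_span P \<or> - \<gamma> \<in> nat_span P)"

definition pos_roots ::
  "'g::complex_lie_algebra set \<Rightarrow> ('g \<Rightarrow> complex) set \<Rightarrow> ('g \<Rightarrow> complex) set" where
  "pos_roots H P = roots H \<inter> nat_span P"


section \<open>Dynkin diagrams\<close>

definition cartan_integer ::
  "'g::complex_lie_algebra set \<Rightarrow> ('g \<Rightarrow> complex) \<Rightarrow> ('g \<Rightarrow> complex) \<Rightarrow> complex" where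
  "cartan_integer H \<beta> \<gamma> = \<beta> (coroot H \<gamma>)"

text \<open>The number of edges between two distinct vertices of the Dynkin diagram.\<close>

definition dynkin_bonds ::
  "'g::complex_lie_algebra set \<Rightarrow> ('g \<Rightarrow> complex) \<Rightarrow> ('g \<Rightarrow> complex) \<Rightarrow> complex" where
  "dynkin_bonds H \<beta> \<gamma> = cartan_integer H \<beta> \<gamma> * cartan_integer H \<gamma> \<beta>"

definition D_edge :: "nat \<Rightarrow> nat \<Rightarrow> nat \<Rightarrow> bool" where
  "D_edge l i j \<longleftrightarrow> (j = i + 1 \<and> j \<le> l - 2) \<or> (i = l - 2 \<and> (j = l - 1 \<or> j = l))"

text \<open>
  \<open>\<alpha> 1, \<dots>, \<alpha> l\<close> are the simple roots, and the Dynkin diagram is that of type \<open>D\<^sub>l\<close>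
  (simply laced, so that there are no arrows), with the last two roots attached to \<open>\<alpha> (l - 2)\<close>.
\<close>

definition simple_roots_type_D ::
  "'g::complex_lie_algebra set \<Rightarrow> nat \<Rightarrow> (nat \<Rightarrow> 'g \<Rightarrow> complex) \<Rightarrow> bool" where
  "simple_roots_type_D H l \<alpha> \<longleftrightarrow>
     inj_on \<alpha> {1..l} \<and> root_base H (\<alpha> ` {1..l}) \<and>
     (\<forall>i\<in>{1..l}. \<forall>j\<in>{1..l}. i \<noteq> j \<longrightarrow>
        dynkin_bonds H (\<alpha> i) (\<alpha> j) = (if D_edge l i j \<or> D_edge l j i then 1 else 0))"

definition dynkin_components ::
  "'g::complex_lie_algebra set \<Rightarrow> ('g \<Rightarrow> complex) set \<Rightarrow> ('g \<Rightarrow> complex) set set" where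
  "dynkin_components H I =
     I // ({(\<beta>, \<gamma>). \<beta> \<in> I \<and> \<gamma> \<in> I \<and> \<beta> \<noteq> \<gamma> \<and> dynkin_bonds H \<beta> \<gamma> \<noteq> 0}\<^sup>* \<inter> I \<times> I)"


section \<open>Ad-nilpotent ideals of parabolic subalgebras\<close>

text \<open>
  Here \<open>P\<close> is the set of simple roots, and the sets \<open>\<Phi>\<close> in \<open>ideal_sets H P I\<close> describe the
  ad-nilpotent ideals \<open>root_ideal H \<Phi>\<close> of the standard parabolic subalgebra attached to \<open>I\<close>.
\<close>

definition sub_roots ::
  "'g::complex_lie_algebra set \<Rightarrow> ('g \<Rightarrow> complex) set \<Rightarrow> ('g \<Rightarrow> complex) set" where
  "sub_roots H I = int_span I \<inter> roots H"

definition ideal_sets ::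
  "'g::complex_lie_algebra set \<Rightarrow> ('g \<Rightarrow> complex) set \<Rightarrow> ('g \<Rightarrow> complex) set
     \<Rightarrow> ('g \<Rightarrow> complex) set set" where
  "ideal_sets H P I =
     {\<Phi>. \<Phi> \<subseteq> pos_roots H P - sub_roots H I \<and>
         (\<forall>\<beta>\<in>\<Phi>. \<forall>\<gamma>\<in>pos_roots H P \<union> sub_roots H I.
            \<beta> + \<gamma> \<in> pos_roots H P \<longrightarrow> \<beta> + \<gamma> \<in> \<Phi>)}"

definition root_ideal ::
  "'g::complex_lie_algebra set \<Rightarrow> ('g \<Rightarrow> complex) set \<Rightarrow> 'g set" where
  "root_ideal H \<Phi> = cspan (\<Union>\<gamma>\<in>\<Phi>. root_space H \<gamma>)"

definition abelian_ideal_sets ::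
  "'g::complex_lie_algebra set \<Rightarrow> ('g \<Rightarrow> complex) set \<Rightarrow> ('g \<Rightarrow> complex) set
     \<Rightarrow> ('g \<Rightarrow> complex) set set" where
  "abelian_ideal_sets H P I = {\<Phi> \<in> ideal_sets H P I. abelian (root_ideal H \<Phi>)}"


section \<open>The numbers attached to the components\<close>

definition min_index :: "nat \<Rightarrow> (nat \<Rightarrow> 'g \<Rightarrow> complex) \<Rightarrow> ('g \<Rightarrow> complex) set \<Rightarrow> nat" where
  "min_index l \<alpha> J = Min {i \<in> {1..l}. \<alpha> i \<in> J}"

text \<open>
  \<open>C 1, \<dots>, C s\<close> are the components of \<open>I\<close> ordered by \<open>min_index\<close>. The components before
  \<open>C j\<close> consist of roots with index less than \<open>min_index l \<alpha> (C j)\<close>, and if \<open>C s\<close> is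
  \<open>{\<alpha> l}\<close> they do not contain \<open>\<alpha> (l - 2)\<close>; hence the value is at least \<open>1\<close> and the
  subtractions of natural numbers are not truncated.
\<close>

definition shifted_index ::
  "nat \<Rightarrow> (nat \<Rightarrow> 'g \<Rightarrow> complex) \<Rightarrow> (nat \<Rightarrow> ('g \<Rightarrow> complex) set) \<Rightarrow> nat \<Rightarrow> nat \<Rightarrow> nat" where
  "shifted_index l \<alpha> C s j =
     min_index l \<alpha> (C j) - (\<Sum>k=1..<j. card (C k)) - (if j = s \<and> C s = {\<alpha> l} then 1 else 0)"

text \<open>
  With \<open>r\<close> roots in \<open>I\<close>, the exponents and upper binomial indices \<open>l - r - 1\<close> and
  \<open>l - r - 2\<close> of the counting formulas are nonnegative integers for every \<open>I\<close> except the set of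
  all simple roots. In that case (which has \<open>\<alpha> 1\<close>, \<open>\<alpha> (l - 1)\<close>, \<open>\<alpha> l\<close> in \<open>I\<close>) the
  subtraction of natural numbers gives \<open>2 ^ (l - r - 1) = 1\<close>, the correct count: only the empty
  \<open>\<Phi>\<close> occurs.
\<close>

end

theory Submission
  imports Defs
begin

text \<open>
  Let \<open>\<epsilon> 1, \<dots>, \<epsilon> l\<close> be the forms with \<open>\<alpha> i = \<epsilon> i - \<epsilon> (i + 1)\<close> for \<open>i < l\<close> and
  \<open>\<alpha> l = \<epsilon> (l - 1) + \<epsilon> l\<close>. Everything rests on two facts about the Lie algebra: the roots are the forms
  \<open>\<plusminus> \<epsilon> i \<plusminus> \<epsilon> j\<close> with \<open>i \<noteq> j\<close> (\<open>roots_eq\<close>), and the bracket of the root spaces of \<open>\<beta>\<close> and \<open>\<gamma>\<close> is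
  nonzero if \<open>\<beta>\<close>, \<open>\<gamma>\<close> and \<open>\<beta> + \<gamma>\<close> are roots (\<open>bracket_root_spaces_nonzero\<close>).

  Their proof does without the Killing form. As \<open>H\<close> is maximal abelian and acts diagonally, the Lie
  algebra is the sum of \<open>H\<close> and of finitely many root spaces. If \<open>\<gamma>\<close> is a root whose root space does
  not commute with that of \<open>- \<gamma>\<close>, then there is an \<open>sl\<^sub>2\<close>-triple, which yields strings and
  reflections. The root spaces of the other roots span an ideal that meets \<open>H\<close> only in \<open>0\<close>, so by
  simplicity there are no other roots (\<open>roots_anisotropic\<close>). The Dynkin diagram determines the Cartan
  matrix, and induction on the height, using simple reflections, identifies the roots.

  Write \<open>{x, y}\<close> for the root which is the sum of the forms with the signed indices \<open>x\<close> and \<open>y\<close>, and let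
  \<open>W\<close> be the coweight that vanishes on \<open>I\<close> and has the value \<open>2\<close> on the other simple roots. The roots of
  the parabolic subalgebra are those of weight at least \<open>0\<close>, and those of its nilradical have positive
  weight. Hence an abelian \<open>\<Phi>\<close> is a set of pairs of positive weight which is closed under replacing
  \<open>y\<close> in \<open>{x, y}\<close> by an index \<open>z\<close> with \<open>W y \<le> W z\<close>, and which never contains \<open>{x, y}\<close> and \<open>{- y, z}\<close>
  if \<open>{x, z}\<close> is a root (\<open>card_abelian_ideal_sets\<close>).

  After a change of the sign of \<open>l\<close>, if necessary, the weights satisfy \<open>W 1 \<ge> \<dots> \<ge> W l \<ge> 0\<close>, and the indices
  fall into \<open>M\<close> blocks of equal weight. Suppose that \<open>{x, - u}\<close> is in \<open>\<Phi>\<close> with \<open>x, u > 0\<close>. Unless \<open>u = l\<close>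
  is the only index of weight \<open>0\<close>, closure gives \<open>{x, l}\<close> and \<open>{x, - l}\<close>, and then \<open>x = 1\<close>, as \<open>{1, l}\<close> is
  in \<open>\<Phi>\<close> too. So \<open>\<Phi>\<close> consists of positive pairs, or it does so after the change of the sign of \<open>l\<close>, or it
  contains both \<open>{1, l}\<close> and \<open>{1, - l}\<close> (\<open>ideal_trichotomy\<close>).

  The sets of positive pairs are threshold graphs that do not distinguish the elements of a block. In
  such a graph the first block is joined to everything, or the last block to nothing. Removing blocks
  in this way until one is left gives \<open>2 ^ (M - 1)\<close> words in two letters; if the remaining block, say the
  \<open>p\<close>-th one, has more than one element, then it can be a complete or an empty graph, which adds
  \<open>(M - 1) choose (p - 1)\<close> for each such \<open>p\<close> (\<open>card_threshold_sets\<close>). Let \<open>Q\<close> be the same number for the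
  first \<open>M - 1\<close> blocks. If \<open>l\<close> is the only index of weight \<open>0\<close>, then it counts the sets that consist of
  positive pairs both before and after the change of sign; if there are several, then their block cannot
  be used, and \<open>Q\<close> counts all sets of positive pairs. It also counts the sets of the third kind if
  \<open>\<alpha> 1\<close> is not in \<open>I\<close> (\<open>card_special\<close>); if \<open>\<alpha> 1\<close> is in \<open>I\<close>, there are none. Combining these numbers gives the six formulas in terms of blocks, and
  \<open>l\<^sub>j\<close> is the position of the block that belongs to the component \<open>I\<^sub>j\<close> (\<open>shifted_index_eq\<close>).
\<close>

section \<open>Brackets\<close>

interpretation lie: vector_space "cscale :: complex \<Rightarrow> 'g \<Rightarrow> 'g::complex_lie_algebra"
  by (rule vector_space_cscale)

lemma bracket_zero_right [simp]: "bracket x 0 = (0::'g::complex_lie_algebra)"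
  using bracket_add_right[of x 0 0] by simp

lemma bracket_zero_left [simp]: "bracket 0 x = (0::'g::complex_lie_algebra)"
  using bracket_add_left[of 0 0 x] by simp

lemma bracket_minus_right: "bracket x (- y) = - bracket x (y::'g::complex_lie_algebra)"
  using bracket_add_right[of x y "- y"] by (simp add: eq_neg_iff_add_eq_0 add.commute)

lemma bracket_minus_left: "bracket (- x) y = - bracket x (y::'g::complex_lie_algebra)"
  using bracket_add_left[of x "- x" y] by (simp add: eq_neg_iff_add_eq_0 add.commute)

lemma bracket_diff_right: "bracket x (y - z) = bracket x y - bracket x (z::'g::complex_lie_algebra)"
  using bracket_add_right[of x y "- z"] by (simp add: bracket_minus_right)

lemma bracket_diff_left: "bracket (x - y) z = bracket x z - bracket y (z::'g::complex_lie_algebra)"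
  using bracket_add_left[of x "- y" z] by (simp add: bracket_minus_left)

lemma bracket_antisym: "bracket y x = - bracket x (y::'g::complex_lie_algebra)"
proof -
  have "0 = bracket (x + y) (x + y)" by (simp add: bracket_self)
  also have "\<dots> = bracket x y + bracket y x"
    by (simp only: bracket_add_left bracket_add_right) (simp add: bracket_self)
  finally show ?thesis by (metis add_eq_0_iff)
qed

text \<open>The Jacobi identity in the form in which \<open>bracket x\<close> is a derivation.\<close>

lemma bracket_bracket_right:
  "bracket x (bracket y z) = bracket (bracket x y) z + bracket y (bracket x (z::'g::complex_lie_algebra))"
proof -
  have "bracket (bracket x y) z = - bracket z (bracket x y)" by (rule bracket_antisym)
  moreover have "bracket y (bracket x z) = - bracket y (bracket z x)"
    by (subst bracket_antisym[of x z]) (simp add: bracket_minus_right)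
  moreover have "bracket x (bracket y z) = - (bracket y (bracket z x) + bracket z (bracket x y))"
    using jacobi[of x y z] by (simp only: add.assoc eq_neg_iff_add_eq_0)
  ultimately show ?thesis by (simp only: minus_add)
qed

lemma bracket_sum_right: "bracket x (sum f A) = (\<Sum>a\<in>A. bracket x (f a :: 'g::complex_lie_algebra))"
  by (induction A rule: infinite_finite_induct) (auto simp: bracket_add_right)

lemma bracket_mem_span:
  fixes T :: "'g::complex_lie_algebra set"
  assumes "\<And>y. y \<in> A \<Longrightarrow> bracket x y \<in> T" "csubspace T" "y \<in> cspan A"
  shows "bracket x y \<in> T"
  using assms(3)
proof (induction rule: lie.span_induct_alt)
  case base
  then show ?case using assms(2) by (simp add: lie.subspace_0)
next
  case (step c x y)
  then show ?case using assms
    by (simp add: bracket_add_right bracket_cscale_right lie.subspace_add lie.subspace_scale)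
qed

section \<open>Weight spaces\<close>

lemma csubspace_root_space: "csubspace (root_space (H::'g::complex_lie_algebra set) \<gamma>)"
  by (rule lie.subspaceI)
    (simp_all add: root_space_def bracket_add_right cscale_add_right bracket_cscale_right
      cscale_cscale mult.commute)

lemma bracket_root_space:
  assumes "x \<in> root_space (H::'g::complex_lie_algebra set) \<beta>" "y \<in> root_space H \<gamma>"
  shows "bracket x y \<in> root_space H (\<beta> + \<gamma>)"
  unfolding root_space_def
proof (intro CollectI ballI)
  fix h
  assume "h \<in> H"
  with assms have "bracket h x = cscale (\<beta> h) x" "bracket h y = cscale (\<gamma> h) y"
    by (simp_all add: root_space_def)
  then have "bracket h (bracket x y) = cscale (\<beta> h) (bracket x y) + cscale (\<gamma> h) (bracket x y)"
    by (simp only: bracket_bracket_right[of h] bracket_cscale_left bracket_cscale_right)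
  then show "bracket h (bracket x y) = cscale ((\<beta> + \<gamma>) h) (bracket x y)"
    by (simp only: plus_fun_apply cscale_add_left)
qed

text \<open>Subtracting the action of an element that separates two weights kills one summand, which is
  the induction step here.\<close>

lemma weight_vectors_independent:
  fixes H :: "'g::complex_lie_algebra set"
  assumes "finite G"
    and "\<And>\<gamma> \<delta>. \<gamma> \<in> G \<Longrightarrow> \<delta> \<in> G \<Longrightarrow> \<gamma> \<noteq> \<delta> \<Longrightarrow> \<exists>h\<in>H. \<gamma> h \<noteq> \<delta> h"
    and "\<And>\<gamma>. \<gamma> \<in> G \<Longrightarrow> v \<gamma> \<in> root_space H \<gamma>"
    and "(\<Sum>\<gamma>\<in>G. v \<gamma>) = 0"
  shows "\<forall>\<gamma>\<in>G. v \<gamma> = 0"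
  using assms
proof (induction G arbitrary: v rule: finite_induct)
  case empty
  then show ?case by simp
next
  case (insert \<delta> G)
  have sum0: "v \<delta> + (\<Sum>\<gamma>\<in>G. v \<gamma>) = 0"
    using insert.prems(3) insert.hyps by simp
  have "v \<gamma> = 0" if \<gamma>: "\<gamma> \<in> G" for \<gamma>
  proof -
    obtain h where h: "h \<in> H" "\<gamma> h \<noteq> \<delta> h"
      using insert.prems(1)[of \<gamma> \<delta>] \<gamma> insert.hyps by blast
    have act: "bracket h (v \<beta>) = cscale (\<beta> h) (v \<beta>)" if "\<beta> \<in> insert \<delta> G" for \<beta>
      using insert.prems(2)[OF that] h(1) by (simp add: root_space_def)
    have "bracket h (v \<delta> + (\<Sum>\<gamma>\<in>G. v \<gamma>)) - cscale (\<delta> h) (v \<delta> + (\<Sum>\<gamma>\<in>G. v \<gamma>)) = 0"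
      by (simp add: sum0)
    then have "(\<Sum>\<beta>\<in>G. cscale (\<beta> h - \<delta> h) (v \<beta>)) = 0"
      by (simp add: bracket_add_right bracket_sum_right act lie.scale_right_distrib
          lie.scale_sum_right lie.scale_left_diff_distrib sum_subtractf)
    then have "\<forall>\<beta>\<in>G. cscale (\<beta> h - \<delta> h) (v \<beta>) = 0"
      using insert.prems(1,2)
      by (intro insert.IH) (auto intro: lie.subspace_scale[OF csubspace_root_space])
    then show ?thesis using \<gamma> h(2) by (auto simp: lie.scale_eq_0_iff)
  qed
  then show ?case using sum0 by auto
qed

text \<open>The eigencomponents, for a new element, of a common eigenvector of commuting elements are
  again common eigenvectors.\<close>

lemma span_common_eigenvectors:
  fixes F :: "'g::complex_lie_algebra set"
  assumes "finite F" "\<forall>x\<in>F. ad_semisimple x" "\<forall>x\<in>F. \<forall>y\<in>F. bracket x y = 0"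
  shows "cspan {v. \<forall>x\<in>F. \<exists>c. bracket x v = cscale c v} = UNIV"
  using assms
proof (induction F rule: finite_induct)
  case empty
  then show ?case by (simp add: lie.span_UNIV)
next
  case (insert h F)
  define E where "E = {v. \<forall>x\<in>insert h F. \<exists>c. bracket x v = cscale c v}"
  have "v \<in> cspan E" if v: "\<forall>x\<in>F. \<exists>c. bracket x v = cscale c v" for v
  proof -
    define D where "D = {v. \<exists>c. bracket h v = cscale c v}"
    have "v \<in> cspan D"
      using insert.prems(1) by (simp add: ad_semisimple_def D_def)
    then have "\<exists>t r. finite t \<and> t \<subseteq> D \<and> v = (\<Sum>a\<in>t. cscale (r a) a)"
      by (auto simp: lie.span_explicit)
    then obtain t r where t: "finite t" "t \<subseteq> D" and vt: "v = (\<Sum>a\<in>t. cscale (r a) a)"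
      by (elim exE conjE)
    have "\<forall>a\<in>t. \<exists>c. bracket h a = cscale c a"
      using t(2) by (auto simp: D_def)
    then obtain c where c: "\<And>a. a \<in> t \<Longrightarrow> bracket h a = cscale (c a) a"
      by (auto simp: bchoice_iff)
    define w where "w k = (\<Sum>a\<in>{a\<in>t. c a = k}. cscale (r a) a)" for k
    have vw: "v = (\<Sum>k\<in>c ` t. w k)"
      unfolding vt w_def by (rule sum.image_gen[OF t(1)])
    have hw: "bracket h (w k) = cscale k (w k)" for k
      unfolding w_def bracket_sum_right lie.scale_sum_right
      by (rule sum.cong) (auto simp: bracket_cscale_right c cscale_cscale mult.commute)
    have "bracket x (w k) = cscale \<mu> (w k)"
      if x: "x \<in> F" and \<mu>: "bracket x v = cscale \<mu> v" and k: "k \<in> c ` t" for x k \<mu>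
    proof -
      let ?G = "(\<lambda>k (_::'g). k) ` c ` t"
      define u where "u \<gamma> = bracket x (w (\<gamma> 0)) - cscale \<mu> (w (\<gamma> 0))" for \<gamma> :: "'g \<Rightarrow> complex"
      have inj: "inj_on (\<lambda>k (_::'g). k::complex) (c ` t)" by (auto simp: inj_on_def fun_eq_iff)
      have "\<forall>\<gamma>\<in>?G. u \<gamma> = 0"
      proof (rule weight_vectors_independent[where H = "{h}"])
        have hx: "bracket h x = 0" using insert.prems(2) x by simp
        have "bracket h (bracket x (w k)) = cscale k (bracket x (w k))" for k
          by (simp add: bracket_bracket_right[of h] hx hw bracket_cscale_right)
        then show "u \<gamma> \<in> root_space {h} \<gamma>" if "\<gamma> \<in> ?G" for \<gamma>
          using that by (auto simp: u_def root_space_def bracket_diff_right hw bracket_cscale_right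
              cscale_cscale mult.commute lie.scale_right_diff_distrib)
        have "(\<Sum>\<gamma>\<in>?G. u \<gamma>) = (\<Sum>k\<in>c ` t. bracket x (w k) - cscale \<mu> (w k))"
          by (simp add: sum.reindex[OF inj] u_def)
        also have "\<dots> = bracket x v - cscale \<mu> v"
          by (simp add: vw bracket_sum_right sum_subtractf lie.scale_sum_right)
        finally show "(\<Sum>\<gamma>\<in>?G. u \<gamma>) = 0" using \<mu> by simp
      qed (use t(1) in auto)
      then show ?thesis using k by (auto simp: u_def)
    qed
    then have "w k \<in> E" if "k \<in> c ` t" for k
      unfolding E_def
    proof (intro CollectI ballI)
      fix x
      assume "x \<in> insert h F"
      then show "\<exists>c. bracket x (w k) = cscale c (w k)"
      proof
        assume "x = h"
        then show ?thesis using hw by auto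
      next
        assume "x \<in> F"
        then show ?thesis using v that \<open>\<And>x \<mu> k. \<lbrakk>x \<in> F; bracket x v = cscale \<mu> v; k \<in> c ` t\<rbrakk>
          \<Longrightarrow> bracket x (w k) = cscale \<mu> (w k)\<close> by fast
      qed
    qed
    then show ?thesis
      unfolding vw by (intro lie.span_sum lie.span_base)
  qed
  then have "cspan {v. \<forall>x\<in>F. \<exists>c. bracket x v = cscale c v} \<subseteq> cspan E"
    by (intro lie.span_minimal) auto
  then show ?case using insert by (auto simp: E_def)
qed

text \<open>If \<open>a = 2\<close> this is the basic computation with an \<open>sl\<^sub>2\<close>-triple, and for \<open>a = 0\<close> it concerns
  a Heisenberg algebra. The hypothesis on \<open>f\<close> is weaker than \<open>bracket f w = 0\<close>, which makes the
  lemma applicable to vectors that are not of lowest weight.\<close>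

lemma ladder:
  fixes e f h w :: "'g::complex_lie_algebra"
  assumes ef: "bracket e f = h" and he: "bracket h e = cscale a e"
    and hw: "bracket h w = cscale m w" and efw: "bracket e (bracket f w) = 0"
  shows bracket_h_ladder: "bracket h ((bracket e ^^ j) w) = cscale (m + a * of_nat j) ((bracket e ^^ j) w)"
    and bracket_f_ladder: "bracket f ((bracket e ^^ Suc j) w) =
           cscale (- of_nat (Suc j) * (m + a * of_nat j / 2)) ((bracket e ^^ j) w)"
proof -
  have fe: "bracket f e = - h" using ef bracket_antisym[of f e] by simp
  show hj: "bracket h ((bracket e ^^ j) w) = cscale (m + a * of_nat j) ((bracket e ^^ j) w)" for j
  proof (induction j)
    case 0
    then show ?case using hw by simp
  next
    case (Suc j)
    have "bracket h (bracket e ((bracket e ^^ j) w)) =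
        cscale a (bracket e ((bracket e ^^ j) w)) + cscale (m + a * of_nat j) (bracket e ((bracket e ^^ j) w))"
      by (simp only: bracket_bracket_right[of h e] he Suc bracket_cscale_left bracket_cscale_right)
    moreover have "a + (m + a * of_nat j) = m + a * of_nat (Suc j)" by (simp add: algebra_simps)
    ultimately show ?case by (simp only: cscale_add_left[symmetric] funpow.simps o_apply)
  qed
  have step: "bracket f (bracket e u) = - bracket h u + bracket e (bracket f u)" for u
    by (simp only: bracket_bracket_right[of f e] fe bracket_minus_left)
  show "bracket f ((bracket e ^^ Suc j) w) =
           cscale (- of_nat (Suc j) * (m + a * of_nat j / 2)) ((bracket e ^^ j) w)"
  proof (induction j)
    case 0
    then show ?case using hw efw by (simp add: step)
  next
    case (Suc j)
    let ?u = "(bracket e ^^ Suc j) w"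
    have "bracket f ((bracket e ^^ Suc (Suc j)) w) = - bracket h ?u + bracket e (bracket f ?u)"
      using step[of ?u] by simp
    also have "\<dots> = - cscale (m + a * of_nat (Suc j)) ?u
        + cscale (- of_nat (Suc j) * (m + a * of_nat j / 2)) ?u"
      by (simp only: hj[of "Suc j"] Suc bracket_cscale_right) simp
    also have "\<dots> = cscale (- (m + a * of_nat (Suc j)) + - of_nat (Suc j) * (m + a * of_nat j / 2)) ?u"
      by (simp only: cscale_add_left lie.scale_minus_left)
    also have "- (m + a * of_nat (Suc j)) + - of_nat (Suc j) * (m + a * of_nat j / 2) =
        - of_nat (Suc (Suc j)) * (m + a * of_nat (Suc j) / 2)"
      by (simp add: field_simps)
    finally show ?case .
  qed
qed

lemma ladder_weight:
  fixes e f h w :: "'g::complex_lie_algebra"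
  assumes "bracket e f = h" "bracket h e = cscale a e" "bracket h w = cscale m w"
    and "bracket e (bracket f w) = 0" "w \<noteq> 0" "(bracket e ^^ n) w = 0"
  obtains N where "(bracket e ^^ N) w \<noteq> 0" "(bracket e ^^ Suc N) w = 0" "m = - a * of_nat N / 2"
proof -
  define k where "k = (LEAST n. (bracket e ^^ n) w = 0)"
  have k: "(bracket e ^^ k) w = 0" unfolding k_def by (rule LeastI) (rule assms(6))
  then have "k \<noteq> 0" using assms(5) by (cases k) auto
  then obtain N where N: "k = Suc N" by (cases k) auto
  have "(bracket e ^^ N) w \<noteq> 0"
    using not_less_Least[of N "\<lambda>n. (bracket e ^^ n) w = 0"] N by (simp flip: k_def)
  moreover have "cscale (- of_nat (Suc N) * (m + a * of_nat N / 2)) ((bracket e ^^ N) w) = 0"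
    using bracket_f_ladder[OF assms(1-4), of N] k N by simp
  ultimately have "m + a * of_nat N / 2 = 0"
    by (simp only: lie.scale_eq_0_iff mult_eq_0_iff neg_equal_0_iff_equal of_nat_eq_0_iff) simp
  then have "m = - a * of_nat N / 2" by (simp add: eq_neg_iff_add_eq_0)
  then show ?thesis using that \<open>(bracket e ^^ N) w \<noteq> 0\<close> k N by blast
qed

section \<open>The root space decomposition\<close>

locale lie_cartan =
  fixes H :: "'g::complex_lie_algebra set"
  assumes simple: "simple_lie_algebra TYPE('g)" and cartan: "cartan_subalgebra H"
begin

lemma csubspace_H: "csubspace H"
  using cartan unfolding cartan_subalgebra_def lie_subalgebra_def by (elim conjE)

lemma bracket_H: "x \<in> H \<Longrightarrow> y \<in> H \<Longrightarrow> bracket x y = 0"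
proof -
  have "abelian H" using cartan unfolding cartan_subalgebra_def by (elim conjE)
  then show "x \<in> H \<Longrightarrow> y \<in> H \<Longrightarrow> bracket x y = 0" by (simp add: abelian_def)
qed

lemma ad_semisimple_H: "x \<in> H \<Longrightarrow> ad_semisimple x"
proof -
  have "\<forall>x\<in>H. ad_semisimple x" using cartan unfolding cartan_subalgebra_def by (elim conjE)
  then show "x \<in> H \<Longrightarrow> ad_semisimple x" by blast
qed

lemma H_maximal: "lie_subalgebra K \<Longrightarrow> abelian K \<Longrightarrow> H \<subseteq> K \<Longrightarrow> K = H"
proof -
  have "\<forall>K. lie_subalgebra K \<and> abelian K \<and> H \<subseteq> K \<longrightarrow> K = H"
    using cartan unfolding cartan_subalgebra_def by (elim conjE)
  then show "lie_subalgebra K \<Longrightarrow> abelian K \<Longrightarrow> H \<subseteq> K \<Longrightarrow> K = H" by blast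
qed

lemma not_abelian: "\<not> abelian (UNIV :: 'g set)"
  using simple unfolding simple_lie_algebra_def by (elim conjE)

lemma ideal_trivial: "lie_ideal J \<Longrightarrow> J = {0} \<or> J = (UNIV :: 'g set)"
proof -
  have "\<forall>J::'g set. lie_ideal J \<longrightarrow> J = {0} \<or> J = UNIV"
    using simple unfolding simple_lie_algebra_def by (elim conjE)
  then show "lie_ideal J \<Longrightarrow> J = {0} \<or> J = (UNIV :: 'g set)" by blast
qed

lemma finite_spanning_set: "\<exists>B::'g set. finite B \<and> cspan B = UNIV"
  using simple unfolding simple_lie_algebra_def by (elim conjE)

text \<open>An element that commutes with \<open>H\<close> spans, together with \<open>H\<close>, an abelian subalgebra, and \<open>H\<close> is maximal
  among these.\<close>

lemma root_space_zero: "root_space H 0 = H"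
proof -
  have "x \<in> H" if x: "\<forall>h\<in>H. bracket h x = 0" for x
  proof -
    define K where "K = {h + cscale c x |h c. h \<in> H}"
    have xh: "bracket x h = 0" if "h \<in> H" for h using x that bracket_antisym[of x h] by simp
    have "csubspace K"
    proof (rule lie.subspaceI)
      show "0 \<in> K" unfolding K_def using lie.subspace_0[OF csubspace_H]
        by (intro CollectI exI[of _ 0]) simp
    next
      fix u v assume "u \<in> K" "v \<in> K"
      then obtain h c k d where "h \<in> H" "k \<in> H" "u = h + cscale c x" "v = k + cscale d x"
        unfolding K_def by auto
      then show "u + v \<in> K" unfolding K_def using lie.subspace_add[OF csubspace_H]
        by (intro CollectI exI[of _ "h + k"] exI[of _ "c + d"]) (simp add: cscale_add_left)
    next
      fix b u assume "u \<in> K"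
      then obtain h c where "h \<in> H" "u = h + cscale c x"
        unfolding K_def by auto
      then show "cscale b u \<in> K" unfolding K_def using lie.subspace_scale[OF csubspace_H]
        by (intro CollectI exI[of _ "cscale b h"] exI[of _ "b * c"])
          (simp add: cscale_add_right cscale_cscale)
    qed
    moreover have ab: "bracket u v = 0" if "u \<in> K" "v \<in> K" for u v
      using that x xh unfolding K_def
      by (auto simp: bracket_add_left bracket_add_right bracket_cscale_left bracket_cscale_right
          bracket_H bracket_self)
    ultimately have "K = H"
      using lie.subspace_0[of K]
      by (intro H_maximal)
        (auto simp: lie_subalgebra_def abelian_def K_def intro!: exI[of _ "0::complex"])
    moreover have "x \<in> K" unfolding K_def using lie.subspace_0[OF csubspace_H]
      by (intro CollectI exI[of _ 0] exI[of _ 1]) (simp add: cscale_one)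
    ultimately show ?thesis by simp
  qed
  then show ?thesis by (auto simp: root_space_def bracket_H)
qed

lemma dual_eqI: "\<gamma> \<in> dual H \<Longrightarrow> \<delta> \<in> dual H \<Longrightarrow> (\<And>h. h \<in> H \<Longrightarrow> \<gamma> h = \<delta> h) \<Longrightarrow> \<gamma> = \<delta>"
  by (rule ext) (metis (mono_tags, lifting) dual_def mem_Collect_eq)

lemma zero_dual: "0 \<in> dual H"
  by (simp add: dual_def)

lemma line_dual: "\<gamma> \<in> dual H \<Longrightarrow> \<delta> \<in> dual H \<Longrightarrow> (\<lambda>x. \<gamma> x + c * \<delta> x) \<in> dual H"
  by (simp add: dual_def algebra_simps)

lemma add_dual: "\<gamma> \<in> dual H \<Longrightarrow> \<delta> \<in> dual H \<Longrightarrow> \<gamma> + \<delta> \<in> dual H"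
  by (simp add: dual_def algebra_simps)

lemma minus_dual: "\<gamma> \<in> dual H \<Longrightarrow> - \<gamma> \<in> dual H"
  by (simp add: dual_def)

lemma dual_linear:
  assumes "\<gamma> \<in> dual H"
  shows "h \<in> H \<Longrightarrow> k \<in> H \<Longrightarrow> \<gamma> (h + k) = \<gamma> h + \<gamma> k"
    and "h \<in> H \<Longrightarrow> \<gamma> (cscale c h) = c * \<gamma> h"
    and "h \<in> H \<Longrightarrow> \<gamma> (- h) = - \<gamma> h"
    and "h \<in> H \<Longrightarrow> k \<in> H \<Longrightarrow> \<gamma> (h - k) = \<gamma> h - \<gamma> k"
    and "\<gamma> 0 = 0"
proof -
  show a: "h \<in> H \<Longrightarrow> k \<in> H \<Longrightarrow> \<gamma> (h + k) = \<gamma> h + \<gamma> k"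
    and s: "h \<in> H \<Longrightarrow> \<gamma> (cscale c h) = c * \<gamma> h" for h k c
    using assms by (auto simp: dual_def)
  show m: "h \<in> H \<Longrightarrow> \<gamma> (- h) = - \<gamma> h" for h
    using s[of h "-1"] by (simp add: lie.scale_minus_left cscale_one)
  show "h \<in> H \<Longrightarrow> k \<in> H \<Longrightarrow> \<gamma> (h - k) = \<gamma> h - \<gamma> k"
    using a[of h "- k"] m[of k] lie.subspace_neg[OF csubspace_H] by simp
  show "\<gamma> 0 = 0" using s[of 0 0] lie.subspace_0[OF csubspace_H] by simp
qed

lemma roots_dual: "\<gamma> \<in> roots H \<Longrightarrow> \<gamma> \<in> dual H" and roots_nonzero: "\<gamma> \<in> roots H \<Longrightarrow> \<gamma> \<noteq> 0"
  by (auto simp: roots_def)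

lemma root_vector:
  assumes "\<gamma> \<in> roots H"
  obtains x where "x \<in> root_space H \<gamma>" "x \<noteq> 0"
proof -
  have "0 \<in> root_space H \<gamma>" by (rule lie.subspace_0[OF csubspace_root_space])
  then show ?thesis using assms that by (auto simp: roots_def)
qed

lemma root_or_zeroI:
  "x \<in> root_space H \<gamma> \<Longrightarrow> x \<noteq> 0 \<Longrightarrow> \<gamma> \<in> dual H \<Longrightarrow> \<gamma> \<in> insert 0 (roots H)"
  by (auto simp: roots_def)

lemma weights_separated:
  assumes "\<gamma> \<in> dual H" "\<delta> \<in> dual H" "\<gamma> \<noteq> \<delta>"
  shows "\<exists>h\<in>H. \<gamma> h \<noteq> \<delta> h"
  using assms dual_eqI by blast

lemma root_space_inj:
  assumes "x \<in> root_space H \<gamma>" "x \<in> root_space H \<delta>" "x \<noteq> 0" "\<gamma> \<in> dual H" "\<delta> \<in> dual H"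
  shows "\<gamma> = \<delta>"
proof (rule dual_eqI)
  fix h assume "h \<in> H"
  then have "cscale (\<gamma> h) x = cscale (\<delta> h) x" using assms by (simp add: root_space_def)
  then show "\<gamma> h = \<delta> h" using assms(3) by simp
qed fact+

text \<open>It suffices to diagonalize the elements of a finite basis of \<open>H\<close> simultaneously: on a common
  eigenvector the eigenvalue of \<open>h \<in> H\<close> is then a linear function of \<open>h\<close>.\<close>

lemma span_root_spaces: "cspan (\<Union>\<gamma>\<in>insert 0 (roots H). root_space H \<gamma>) = UNIV"
proof -
  obtain B0 :: "'g set" where B0: "finite B0" "cspan B0 = UNIV" using finite_spanning_set by auto
  obtain B where B: "B \<subseteq> H" "lie.independent B" "H \<subseteq> cspan B"
    using lie.maximal_independent_subset[of H] by auto
  have "finite B" using lie.independent_span_bound[OF B0(1) B(2)] B0(2) by simp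
  define E where "E = {v. \<forall>x\<in>B. \<exists>c. bracket x v = cscale c v}"
  have "cspan E = UNIV"
    unfolding E_def
    by (rule span_common_eigenvectors)
      (use \<open>finite B\<close> B(1) ad_semisimple_H in auto, meson B(1) bracket_H subsetD)
  moreover have "v \<in> (\<Union>\<gamma>\<in>insert 0 (roots H). root_space H \<gamma>)" if v: "v \<in> E" for v
  proof (cases "v = 0")
    case True
    then show ?thesis using lie.subspace_0[OF csubspace_root_space, of H 0] by auto
  next
    case False
    have "\<exists>c. bracket h v = cscale c v" if "h \<in> cspan B" for h
      using that
    proof (induction rule: lie.span_induct_alt)
      case base
      show ?case by (intro exI[of _ 0]) simp
    next
      case (step c x y)
      obtain a where "bracket x v = cscale a v" using bspec[OF CollectD[OF v[unfolded E_def]] step(1)] ..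
      moreover obtain b where "bracket y v = cscale b v" using step(2) ..
      ultimately show ?case
        by (intro exI[of _ "c * a + b"])
          (simp add: bracket_add_left bracket_cscale_left cscale_cscale cscale_add_left)
    qed
    then have "\<forall>h\<in>H. \<exists>c. bracket h v = cscale c v" using B(3) by auto
    then obtain g where g: "\<And>h. h \<in> H \<Longrightarrow> bracket h v = cscale (g h) v"
      by (auto simp: bchoice_iff)
    define \<gamma> where "\<gamma> h = (if h \<in> H then g h else 0)" for h
    have v\<gamma>: "v \<in> root_space H \<gamma>" by (simp add: root_space_def \<gamma>_def g)
    have "\<gamma> \<in> dual H"
      unfolding dual_def
    proof (intro CollectI conjI ballI allI impI)
      fix x y assume xy: "x \<in> H" "y \<in> H"
      then have "x + y \<in> H" by (rule lie.subspace_add[OF csubspace_H])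
      then have "cscale (g (x + y)) v = cscale (g x + g y) v"
        using xy by (simp add: cscale_add_left bracket_add_left flip: g)
      then show "\<gamma> (x + y) = \<gamma> x + \<gamma> y"
        using xy \<open>x + y \<in> H\<close> False by (simp add: \<gamma>_def)
    next
      fix c x assume x: "x \<in> H"
      then have "cscale c x \<in> H" by (rule lie.subspace_scale[OF csubspace_H])
      then have "cscale (g (cscale c x)) v = cscale (c * g x) v"
        using x by (simp add: bracket_cscale_left flip: g cscale_cscale)
      then show "\<gamma> (cscale c x) = c * \<gamma> x"
        using x \<open>cscale c x \<in> H\<close> False by (simp add: \<gamma>_def)
    qed (simp add: \<gamma>_def)
    then show ?thesis using root_or_zeroI[OF v\<gamma> False] v\<gamma> by blast
  qed
  ultimately show ?thesis
    using lie.span_mono[of E "\<Union>\<gamma>\<in>insert 0 (roots H). root_space H \<gamma>"] by auto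
qed

text \<open>Root vectors for distinct roots are linearly independent.\<close>

lemma finite_roots: "finite (roots H)"
proof -
  obtain B :: "'g set" where B: "finite B" "cspan B = UNIV" using finite_spanning_set by auto
  have "\<forall>\<gamma>\<in>roots H. \<exists>x. x \<in> root_space H \<gamma> \<and> x \<noteq> 0" using root_vector by metis
  then obtain x where x: "\<And>\<gamma>. \<gamma> \<in> roots H \<Longrightarrow> x \<gamma> \<in> root_space H \<gamma>" "\<And>\<gamma>. \<gamma> \<in> roots H \<Longrightarrow> x \<gamma> \<noteq> 0"
    by (auto simp: bchoice_iff)
  have inj: "inj_on x (roots H)"
    using x root_space_inj roots_dual by (metis (no_types, lifting) inj_onI)
  have "lie.independent (x ` roots H)"
  proof
    assume "lie.dependent (x ` roots H)"
    then obtain S u where S: "finite S" "S \<subseteq> x ` roots H" "\<exists>v\<in>S. u v \<noteq> 0"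
      "(\<Sum>v\<in>S. cscale (u v) v) = 0"
      unfolding lie.dependent_explicit by auto
    from S(1,2) obtain G where G: "G \<subseteq> roots H" "finite G" "S = x ` G"
      using finite_subset_image[OF S(1,2)] by auto
    have injG: "inj_on x G" using inj G(1) by (rule inj_on_subset)
    have "\<forall>\<gamma>\<in>G. cscale (u (x \<gamma>)) (x \<gamma>) = 0"
    proof (rule weight_vectors_independent)
      show "(\<Sum>\<gamma>\<in>G. cscale (u (x \<gamma>)) (x \<gamma>)) = 0"
        using S(4) by (simp add: G(3) sum.reindex[OF injG])
      show "\<exists>h\<in>H. \<gamma> h \<noteq> \<delta> h" if "\<gamma> \<in> G" "\<delta> \<in> G" "\<gamma> \<noteq> \<delta>" for \<gamma> \<delta>
        using that G(1) by (meson roots_dual subsetD weights_separated)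
    qed (use G x in \<open>auto intro!: lie.subspace_scale[OF csubspace_root_space]\<close>)
    then show False using S(3) G x(2) by auto
  qed
  then have "finite (x ` roots H)" using lie.independent_span_bound[OF B(1)] B(2) by simp
  then show ?thesis using inj by (rule finite_imageD)
qed

lemma center_trivial:
  assumes "\<And>x. bracket z x = (0::'g)"
  shows "z = 0"
proof -
  let ?Z = "{z::'g. \<forall>x. bracket z x = 0}"
  have "lie_ideal ?Z"
    unfolding lie_ideal_def
  proof (intro conjI allI ballI lie.subspaceI)
    fix x y assume "y \<in> ?Z"
    then show "bracket x y \<in> ?Z" using bracket_antisym[of x y] by simp
  qed (auto simp: bracket_add_left bracket_cscale_left)
  moreover have "?Z \<noteq> UNIV" using not_abelian by (auto simp: abelian_def)
  ultimately have "?Z = {0}" using ideal_trivial by blast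
  then show ?thesis using assms by blast
qed

text \<open>Such an element is central.\<close>

lemma roots_vanish:
  assumes h: "h \<in> H" and "\<And>\<gamma>. \<gamma> \<in> roots H \<Longrightarrow> \<gamma> h = 0"
  shows "h = 0"
proof (rule center_trivial)
  fix x
  have "bracket h x \<in> {0}"
  proof (rule bracket_mem_span[where A = "\<Union>\<gamma>\<in>insert 0 (roots H). root_space H \<gamma>"])
    fix y assume "y \<in> (\<Union>\<gamma>\<in>insert 0 (roots H). root_space H \<gamma>)"
    then show "bracket h y \<in> {0}" using assms by (auto simp: root_space_def)
  next
    show "x \<in> cspan (\<Union>\<gamma>\<in>insert 0 (roots H). root_space H \<gamma>)"
      by (simp only: span_root_spaces UNIV_I)
  qed (simp add: lie.subspace_single_0)
  then show "bracket h x = 0" by simp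
qed

lemma ladder_root_space:
  assumes "x \<in> root_space H \<gamma>" "v \<in> root_space H \<beta>"
  shows "(bracket x ^^ n) v \<in> root_space H (\<lambda>y. \<beta> y + of_nat n * \<gamma> y)"
proof (induction n)
  case 0
  then show ?case using assms(2) by simp
next
  case (Suc n)
  have "\<gamma> + (\<lambda>y. \<beta> y + of_nat n * \<gamma> y) = (\<lambda>y. \<beta> y + of_nat (Suc n) * \<gamma> y)"
    by (simp add: fun_eq_iff algebra_simps)
  then show ?case using bracket_root_space[OF assms(1) Suc] by simp
qed

text \<open>In this form the finiteness of the set of roots makes root vectors act nilpotently.\<close>

lemma infinite_line_not_roots:
  assumes "\<gamma> \<in> dual H" "\<gamma> \<noteq> 0"
  shows "\<exists>n::nat. (\<lambda>y. \<beta> y + of_nat n * \<gamma> y) \<notin> insert 0 (roots H)"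
proof (rule ccontr)
  let ?g = "\<lambda>(n::nat) y. \<beta> y + of_nat n * \<gamma> y"
  assume "\<not> ?thesis"
  then have "range ?g \<subseteq> insert 0 (roots H)" by auto
  moreover have "inj ?g"
  proof (rule injI)
    fix m n assume eq: "?g m = ?g n"
    obtain y where "\<gamma> y \<noteq> 0" using assms(2) by (auto simp: fun_eq_iff)
    then show "m = n" using fun_cong[OF eq, of y] by simp
  qed
  moreover have "finite (range ?g)"
    using \<open>range ?g \<subseteq> insert 0 (roots H)\<close> by (rule finite_subset) (simp add: finite_roots)
  ultimately show False using finite_imageD[of ?g UNIV] infinite_UNIV_nat by metis
qed

lemma ad_nilpotent:
  assumes "x \<in> root_space H \<gamma>" "\<gamma> \<in> dual H" "\<gamma> \<noteq> 0" "v \<in> root_space H \<beta>" "\<beta> \<in> dual H"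
  shows "\<exists>n. (bracket x ^^ n) v = 0"
  using infinite_line_not_roots[OF assms(2,3), of \<beta>] ladder_root_space[OF assms(1,4)]
    root_or_zeroI line_dual[OF assms(5,2)] by blast

lemma ladder_end:
  assumes "x \<in> root_space H \<gamma>" "\<gamma> \<in> dual H" "\<gamma> \<noteq> 0" "v \<in> root_space H \<beta>" "\<beta> \<in> dual H" "v \<noteq> 0"
  obtains p where "(bracket x ^^ p) v \<noteq> 0" "bracket x ((bracket x ^^ p) v) = 0"
proof -
  define k where "k = (LEAST n. (bracket x ^^ n) v = 0)"
  have k: "(bracket x ^^ k) v = 0"
    unfolding k_def using ad_nilpotent[OF assms(1-5)] by (rule LeastI_ex)
  then have "k \<noteq> 0" using assms(6) by (cases k) auto
  then obtain N where N: "k = Suc N" by (cases k) auto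
  have "(bracket x ^^ N) v \<noteq> 0"
    using not_less_Least[of N "\<lambda>n. (bracket x ^^ n) v = 0"] N by (simp flip: k_def)
  then show ?thesis using that k N by simp
qed

end

context lie_cartan
begin

section \<open>Triples attached to roots\<close>

lemma bracket_opposite_mem_H: "x \<in> root_space H \<gamma> \<Longrightarrow> y \<in> root_space H (- \<gamma>) \<Longrightarrow> bracket x y \<in> H"
  using bracket_root_space[of x H \<gamma> y "- \<gamma>"] by (simp add: root_space_zero)

text \<open>Otherwise \<open>x\<close>, \<open>y\<close> and their bracket would span a Heisenberg algebra, whose center acts as zero
  on finite-dimensional weight modules. This replaces the Killing form in the proof that
  roots do not vanish on their coroots.\<close>

lemma bracket_opposite_isotropic:
  assumes "\<gamma> \<in> dual H" "\<gamma> \<noteq> 0" "x \<in> root_space H \<gamma>" "y \<in> root_space H (- \<gamma>)"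
    and "\<gamma> (bracket x y) = 0"
  shows "bracket x y = 0"
proof (rule roots_vanish)
  let ?h = "bracket x y"
  show hH: "?h \<in> H" using assms by (intro bracket_opposite_mem_H)
  fix \<beta> assume \<beta>: "\<beta> \<in> roots H"
  obtain v where v: "v \<in> root_space H \<beta>" "v \<noteq> 0" using root_vector[OF \<beta>] .
  have m\<gamma>: "- \<gamma> \<in> dual H" "- \<gamma> \<noteq> 0" using assms(1,2) minus_dual by auto
  obtain p where p: "(bracket y ^^ p) v \<noteq> 0" "bracket y ((bracket y ^^ p) v) = 0"
    using ladder_end[OF assms(4) m\<gamma> v(1) roots_dual[OF \<beta>] v(2)] .
  define w where "w = (bracket y ^^ p) v"
  define \<delta> where "\<delta> = (\<lambda>z. \<beta> z + of_nat p * (- \<gamma>) z)"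
  have w: "w \<in> root_space H \<delta>"
    using ladder_root_space[OF assms(4) v(1), of p] by (simp add: w_def \<delta>_def)
  have \<delta>: "\<delta> \<in> dual H" unfolding \<delta>_def by (rule line_dual[OF roots_dual[OF \<beta>] m\<gamma>(1)])
  obtain n where n: "(bracket x ^^ n) w = 0"
    using ad_nilpotent[OF assms(3,1,2) w \<delta>] by auto
  have hw: "bracket ?h w = cscale (\<beta> ?h) w"
    using w hH assms(5) by (simp add: root_space_def \<delta>_def)
  have hx: "bracket ?h x = cscale 0 x"
    using assms(3,5) hH by (simp add: root_space_def)
  show "\<beta> ?h = 0"
    by (rule ladder_weight[OF refl hx hw _ _ n]) (use p in \<open>simp_all add: w_def\<close>)
qed

definition sl2_triple :: "('g \<Rightarrow> complex) \<Rightarrow> 'g \<Rightarrow> 'g \<Rightarrow> 'g \<Rightarrow> bool" where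
  "sl2_triple \<gamma> e f h \<longleftrightarrow> \<gamma> \<in> dual H \<and> \<gamma> \<noteq> 0 \<and> e \<in> root_space H \<gamma> \<and> f \<in> root_space H (- \<gamma>) \<and>
     bracket e f = h \<and> h \<in> H \<and> \<gamma> h = 2"

lemma sl2_triple_exists:
  assumes "\<gamma> \<in> dual H" "\<gamma> \<noteq> 0" "x \<in> root_space H \<gamma>" "y \<in> root_space H (- \<gamma>)" "bracket x y \<noteq> 0"
  shows "\<exists>c. c \<noteq> 0 \<and> sl2_triple \<gamma> x (cscale c y) (cscale c (bracket x y))"
proof -
  have H: "bracket x y \<in> H" using assms by (intro bracket_opposite_mem_H)
  have ne: "\<gamma> (bracket x y) \<noteq> 0" using bracket_opposite_isotropic[OF assms(1-4)] assms(5) by auto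
  then have "sl2_triple \<gamma> x (cscale (2 / \<gamma> (bracket x y)) y) (cscale (2 / \<gamma> (bracket x y)) (bracket x y))"
    using assms H
    by (simp add: sl2_triple_def bracket_cscale_right dual_linear lie.subspace_scale[OF csubspace_root_space]
        lie.subspace_scale[OF csubspace_H])
  then show ?thesis using ne by (intro exI[of _ "2 / \<gamma> (bracket x y)"]) simp
qed

lemma sl2_triple_swap:
  assumes "sl2_triple \<gamma> e f h"
  shows "sl2_triple (- \<gamma>) f e (- h)"
proof -
  have "\<gamma> \<in> dual H" "h \<in> H" "bracket f e = - h"
    using assms bracket_antisym[of f e] by (simp_all add: sl2_triple_def)
  then show ?thesis
    using assms lie.subspace_neg[OF csubspace_H] minus_dual by (simp add: sl2_triple_def dual_linear)
qed

text \<open>The ladder that starts at \<open>w\<close> has to end, and \<open>bracket f\<close> annihilates the vector after its last one.\<close>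

lemma sl2_weight_nonpos:
  assumes "sl2_triple \<gamma> e f h" "w \<in> root_space H \<beta>" "\<beta> \<in> dual H" "w \<noteq> 0" "bracket e (bracket f w) = 0"
  obtains N where "\<beta> h = - of_nat N" "(bracket e ^^ N) w \<noteq> 0"
proof -
  have e: "e \<in> root_space H \<gamma>" "\<gamma> \<in> dual H" "\<gamma> \<noteq> 0" "bracket e f = h" "bracket h e = cscale 2 e"
    and hw: "bracket h w = cscale (\<beta> h) w"
    using assms(1,2) by (auto simp: sl2_triple_def root_space_def)
  obtain n where n: "(bracket e ^^ n) w = 0"
    using ad_nilpotent[OF e(1-3) assms(2,3)] by auto
  show ?thesis
    by (rule ladder_weight[OF e(4,5) hw assms(5,4) n]) (use that in auto)
qed

text \<open>Subtracting a multiple of \<open>e\<close> from \<open>x\<close>, one may assume that \<open>bracket x f\<close> is isotropic and hence zero.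
  Then \<open>x\<close> is a lowest weight vector of weight \<open>2\<close>, which must vanish.\<close>

lemma sl2_raising_line:
  assumes t: "sl2_triple \<gamma> e f h" and x: "x \<in> root_space H \<gamma>"
  shows "\<exists>c. x = cscale c e"
proof -
  have e: "e \<in> root_space H \<gamma>" "\<gamma> \<in> dual H" "\<gamma> \<noteq> 0" "f \<in> root_space H (- \<gamma>)" "bracket e f = h" "h \<in> H" "\<gamma> h = 2"
    using t by (auto simp: sl2_triple_def)
  have xf: "bracket x f \<in> H" using x e(4) by (rule bracket_opposite_mem_H)
  define c where "c = \<gamma> (bracket x f) / 2"
  \<comment> \<open>With this \<open>c\<close>, the form \<open>\<gamma>\<close> vanishes on \<open>bracket z f\<close>.\<close>
  define z where "z = x - cscale c e"
  have z: "z \<in> root_space H \<gamma>" unfolding z_def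
    by (intro lie.subspace_diff[OF csubspace_root_space] lie.subspace_scale[OF csubspace_root_space] x e)
  have "\<gamma> (bracket z f) = 0"
    using e xf by (simp add: z_def bracket_diff_left bracket_cscale_left dual_linear c_def
        lie.subspace_scale[OF csubspace_H])
  then have "bracket z f = 0" by (rule bracket_opposite_isotropic[OF e(2,3) z e(4)])
  then have "bracket f z = 0" using bracket_antisym[of f z] by simp
  have "z = 0"
  proof (rule ccontr)
    assume "z \<noteq> 0"
    then obtain N where "\<gamma> h = - of_nat N"
      by (rule sl2_weight_nonpos[OF t z e(2)]) (use \<open>bracket f z = 0\<close> in auto)
    then have "Re (\<gamma> h) = - real N" by simp
    then show False using e(7) by simp
  qed
  then show ?thesis by (auto simp: z_def)
qed

text \<open>A vector of weight \<open>k \<gamma>\<close> is killed by \<open>bracket e \<circ> bracket f\<close>: for \<open>k = 2\<close> because the root space of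
  \<open>\<gamma>\<close> is spanned by \<open>e\<close>, for larger \<open>k\<close> by induction. Its weight would be positive.\<close>

lemma sl2_multiple_not_root:
  assumes t: "sl2_triple \<gamma> e f h" and k: "k \<ge> 2"
  shows "(\<lambda>x. of_nat k * \<gamma> x) \<notin> roots H"
  using k
proof (induction k rule: nat_induct_at_least)
  have e: "e \<in> root_space H \<gamma>" "\<gamma> \<in> dual H" "\<gamma> \<noteq> 0" "f \<in> root_space H (- \<gamma>)" "\<gamma> h = 2"
    using t by (auto simp: sl2_triple_def)
  have no: "(\<lambda>x. of_nat k * \<gamma> x) \<notin> roots H"
    if k: "k \<ge> 2" and low: "\<And>w. w \<in> root_space H (\<lambda>x. of_nat (k - 1) * \<gamma> x) \<Longrightarrow> bracket e w = 0" for k :: nat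
  proof
    assume r: "(\<lambda>x. of_nat k * \<gamma> x) \<in> roots H"
    obtain w where w: "w \<in> root_space H (\<lambda>x. of_nat k * \<gamma> x)" "w \<noteq> 0" using root_vector[OF r] .
    have "- \<gamma> + (\<lambda>x. of_nat k * \<gamma> x) = (\<lambda>x. of_nat (k - 1) * \<gamma> x)"
      using k by (auto simp: fun_eq_iff of_nat_diff algebra_simps)
    then have "bracket f w \<in> root_space H (\<lambda>x. of_nat (k - 1) * \<gamma> x)"
      using bracket_root_space[OF e(4) w(1)] by simp
    then have "bracket e (bracket f w) = 0" by (rule low)
    then obtain N where "of_nat k * \<gamma> h = - of_nat N"
      using sl2_weight_nonpos[OF t w(1) roots_dual[OF r] w(2)] by blast
    then have "Re (of_nat k * \<gamma> h) = - real N" by simp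
    then show False using e(5) k by simp
  qed
  {
    case base
    show ?case
    proof (rule no)
      fix w assume "w \<in> root_space H (\<lambda>x. of_nat (2 - 1) * \<gamma> x)"
      then obtain c where "w = cscale c e" using sl2_raising_line[OF t, of w] by auto
      then show "bracket e w = 0" by (simp add: bracket_cscale_right bracket_self)
    qed simp
  next
    case (Suc k)
    have d: "(\<lambda>x. of_nat k * \<gamma> x) \<in> dual H" using line_dual[OF zero_dual e(2), of "of_nat k"] by simp
    have "of_nat k * \<gamma> h \<noteq> 0" using Suc(1) e(5) by simp
    then have "(\<lambda>x. of_nat k * \<gamma> x) \<noteq> 0" by (metis zero_fun_apply)
    then have "w = 0" if "w \<in> root_space H (\<lambda>x. of_nat k * \<gamma> x)" for w
      using Suc(2) root_or_zeroI[OF that _ d] by blast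
    then show ?case using Suc(1) by (intro no) (force simp: bracket_zero_right)+
  }
qed

text \<open>Going down from a root vector as far as possible leads to a lowest weight vector, of weight
  \<open>- N\<close> say; the ladder that starts there has \<open>N + 1\<close> nonzero vectors.\<close>

lemma sl2_string:
  assumes t: "sl2_triple \<gamma> e f h" and \<beta>: "\<beta> \<in> roots H"
  obtains p N where "\<beta> h = 2 * of_nat p - of_nat N"
    "\<forall>j\<le>N. (\<lambda>x. \<beta> x + (of_nat j - of_nat p) * \<gamma> x) \<in> insert 0 (roots H)"
proof -
  have e: "e \<in> root_space H \<gamma>" "\<gamma> \<in> dual H" "\<gamma> \<noteq> 0" "f \<in> root_space H (- \<gamma>)" "\<gamma> h = 2"
    "- \<gamma> \<in> dual H" "- \<gamma> \<noteq> 0"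
    using t minus_dual by (auto simp: sl2_triple_def)
  obtain v where v: "v \<in> root_space H \<beta>" "v \<noteq> 0" using root_vector[OF \<beta>] .
  obtain p where p: "(bracket f ^^ p) v \<noteq> 0" "bracket f ((bracket f ^^ p) v) = 0"
    using ladder_end[OF e(4,6,7) v(1) roots_dual[OF \<beta>] v(2)] .
  define w where "w = (bracket f ^^ p) v"
  define \<delta> where "\<delta> = (\<lambda>x. \<beta> x - of_nat p * \<gamma> x)"
  have "(\<lambda>x. \<beta> x + of_nat p * (- \<gamma>) x) = \<delta>" by (simp add: \<delta>_def fun_eq_iff)
  then have w: "w \<in> root_space H \<delta>" and \<delta>: "\<delta> \<in> dual H"
    using ladder_root_space[OF e(4) v(1), of p] line_dual[OF roots_dual[OF \<beta>] e(6), of "of_nat p"]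
    by (simp_all add: w_def)
  obtain N where N: "\<delta> h = - of_nat N" "(bracket e ^^ N) w \<noteq> 0"
    by (rule sl2_weight_nonpos[OF t w \<delta>]) (use p in \<open>auto simp: w_def\<close>)
  have "(\<lambda>x. \<beta> x + (of_nat j - of_nat p) * \<gamma> x) \<in> insert 0 (roots H)" if "j \<le> N" for j
  proof -
    have "(bracket e ^^ N) w = (bracket e ^^ (N - j)) ((bracket e ^^ j) w)"
      using that by (simp flip: funpow_add[THEN fun_cong, unfolded o_apply])
    moreover have "(bracket e ^^ n) 0 = (0::'g)" for n by (induction n) auto
    ultimately have "(bracket e ^^ j) w \<noteq> 0" using N(2) by auto
    then have "(\<lambda>x. \<delta> x + of_nat j * \<gamma> x) \<in> insert 0 (roots H)"
      using ladder_root_space[OF e(1) w, of j] line_dual[OF \<delta> e(2)] by (intro root_or_zeroI)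
    also have "(\<lambda>x. \<delta> x + of_nat j * \<gamma> x) = (\<lambda>x. \<beta> x + (of_nat j - of_nat p) * \<gamma> x)"
      by (simp add: \<delta>_def fun_eq_iff algebra_simps)
    finally show ?thesis .
  qed
  moreover have "\<beta> h = 2 * of_nat p - of_nat N"
    using N(1) e(5) by (simp add: \<delta>_def algebra_simps)
  ultimately show ?thesis using that by blast
qed

lemma sl2_integer: "sl2_triple \<gamma> e f h \<Longrightarrow> \<beta> \<in> roots H \<Longrightarrow> \<exists>n::int. \<beta> h = of_int n"
proof (erule (1) sl2_string)
  fix p N :: nat assume "\<beta> h = 2 * of_nat p - of_nat N"
  then show ?thesis by (intro exI[of _ "2 * int p - int N"]) simp
qed

text \<open>The string from the lowest weight \<open>- N\<close> to \<open>N\<close> is symmetric. If the value of \<open>\<beta>\<close> on \<open>h\<close> is positive, one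
  uses the string for \<open>- \<gamma>\<close>, which ascends in the opposite direction.\<close>

lemma sl2_reflection:
  assumes t: "sl2_triple \<gamma> e f h" and \<beta>: "\<beta> \<in> roots H"
  shows "(\<lambda>x. \<beta> x - \<beta> h * \<gamma> x) \<in> roots H"
proof -
  have *: "(\<lambda>x. \<beta> x - \<beta> h * \<gamma> x) \<in> insert 0 (roots H)"
    if t: "sl2_triple \<gamma> e f h" and Nn: "\<beta> h = - of_nat n" for \<gamma> e f h and n :: nat
  proof -
    obtain p N where pN: "\<beta> h = 2 * of_nat p - of_nat N"
      "\<forall>j\<le>N. (\<lambda>x. \<beta> x + (of_nat j - of_nat p) * \<gamma> x) \<in> insert 0 (roots H)"
      using sl2_string[OF t \<beta>] .
    have "of_nat N = (of_nat (2 * p + n) :: complex)" using pN(1) Nn by (simp add: algebra_simps)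
    then have N: "N = 2 * p + n" by (simp only: of_nat_eq_iff)
    have "(\<lambda>x. \<beta> x - \<beta> h * \<gamma> x) = (\<lambda>x. \<beta> x + (of_nat (p + n) - of_nat p) * \<gamma> x)"
      by (simp add: Nn)
    then show ?thesis using spec[OF pN(2), of "p + n"] N by simp
  qed
  have h: "h \<in> H" "\<gamma> \<in> dual H" "\<gamma> h = 2" using t by (auto simp: sl2_triple_def)
  obtain n :: int where n: "\<beta> h = of_int n" using sl2_integer[OF t \<beta>] by auto
  have "(\<lambda>x. \<beta> x - \<beta> h * \<gamma> x) \<in> insert 0 (roots H)"
  proof (cases "n \<le> 0")
    case True
    then have "\<beta> h = - of_nat (nat (- n))" using n by simp
    then show ?thesis by (rule *[OF t])
  next
    case False
    have "\<beta> (- h) = - of_nat (nat n)"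
      using False n h(1) by (simp add: dual_linear[OF roots_dual[OF \<beta>]])
    from *[OF sl2_triple_swap[OF t] this] show ?thesis
      using h(1) by (simp add: dual_linear[OF roots_dual[OF \<beta>]])
  qed
  moreover have "(\<lambda>x. \<beta> x - \<beta> h * \<gamma> x) \<noteq> 0"
  proof
    assume *: "(\<lambda>x. \<beta> x - \<beta> h * \<gamma> x) = 0"
    from fun_cong[OF this, of h] have "\<beta> h = 0" using h(3) by simp
    then have "\<beta> = 0" using * by (simp add: fun_eq_iff)
    then show False using roots_nonzero[OF \<beta>] by simp
  qed
  ultimately show ?thesis by simp
qed

section \<open>Every root has a triple\<close>

definition anisotropic :: "('g \<Rightarrow> complex) set" where
  "anisotropic = {\<gamma> \<in> roots H. \<exists>x\<in>root_space H \<gamma>. \<exists>y\<in>root_space H (- \<gamma>). bracket x y \<noteq> 0}"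

text \<open>With \<open>h\<^sub>\<beta> = \<kappa> h\<^sub>\<delta>\<close>, the product of the two reflections is the unipotent map
  \<open>v \<mapsto> v + v(h\<^sub>\<delta>) (\<delta> - \<kappa> \<beta>)\<close>, which has finite orbits on the roots only if \<open>\<delta> = \<kappa> \<beta>\<close>. Then
  integrality leaves \<open>\<kappa> = \<plusminus>1\<close>, \<open>\<plusminus>2\<close> or \<open>\<plusminus>1/2\<close>, and the double of a root is not a root.\<close>

lemma proportional_coroots:
  assumes \<beta>: "\<beta> \<in> roots H" "sl2_triple \<beta> e f (cscale \<kappa> h)" and \<delta>: "\<delta> \<in> roots H" "sl2_triple \<delta> e' f' h"
  shows "\<delta> = \<beta> \<or> \<delta> = - \<beta>"
proof -
  have h: "h \<in> H" "\<delta> h = 2" "\<beta> (cscale \<kappa> h) = 2" using assms by (auto simp: sl2_triple_def)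
  have \<beta>h: "\<kappa> * \<beta> h = 2" using h dual_linear[OF roots_dual[OF \<beta>(1)]] by simp
  have step: "(\<lambda>x. \<mu> x + \<mu> h * (\<delta> x - \<kappa> * \<beta> x)) \<in> roots H" if \<mu>: "\<mu> \<in> roots H" for \<mu>
  proof -
    have 1: "(\<lambda>x. \<mu> x - \<kappa> * \<mu> h * \<beta> x) \<in> roots H"
      using sl2_reflection[OF \<beta>(2) \<mu>] h(1) dual_linear[OF roots_dual[OF \<mu>]] by simp
    have eq: "\<mu> h - \<kappa> * \<mu> h * \<beta> h = - \<mu> h" using \<beta>h by (simp add: algebra_simps)
    from sl2_reflection[OF \<delta>(2) 1, unfolded eq] show ?thesis by (simp add: algebra_simps)
  qed
  \<comment> \<open>The factor 2 is the value of \<open>\<delta>\<close> on its own coroot.\<close>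
  have iter: "(\<lambda>x. \<delta> x + of_nat n * (2 * \<delta> x - 2 * \<kappa> * \<beta> x)) \<in> roots H" for n
  proof (induction n)
    case (Suc n)
    have "\<delta> h + of_nat n * (2 * \<delta> h - 2 * \<kappa> * \<beta> h) = 2"
      using h(2) \<beta>h by simp
    from step[OF Suc, unfolded this] show ?case by (simp add: algebra_simps)
  qed (simp add: \<delta>(1))
  have "\<delta> x - \<kappa> * \<beta> x = 0" for x
  proof (rule ccontr)
    assume ne: "\<delta> x - \<kappa> * \<beta> x \<noteq> 0"
    let ?\<omega> = "\<lambda>x. 2 * \<delta> x - 2 * \<kappa> * \<beta> x"
    have "(\<lambda>x. 0 x + 2 * \<delta> x) \<in> dual H" by (rule line_dual[OF zero_dual roots_dual[OF \<delta>(1)]])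
    from line_dual[OF this roots_dual[OF \<beta>(1)], of "- 2 * \<kappa>"] have d: "?\<omega> \<in> dual H"
      by simp
    have "?\<omega> x = 2 * (\<delta> x - \<kappa> * \<beta> x)" by (simp add: algebra_simps)
    then have "?\<omega> x \<noteq> 0" using ne by simp
    then have "?\<omega> \<noteq> 0" by (metis zero_fun_apply)
    from infinite_line_not_roots[OF d this, of \<delta>] iter show False by auto
  qed
  then have \<delta>\<beta>: "\<delta> = (\<lambda>x. \<kappa> * \<beta> x)" by (auto simp: fun_eq_iff)
  \<comment> \<open>Both Cartan integers are available: their product is \<open>2 \<kappa> * (2 / \<kappa>) = 4\<close>.\<close>
  obtain a b :: int where a: "\<delta> (cscale \<kappa> h) = of_int a" and b: "\<beta> h = of_int b"
    using sl2_integer[OF \<beta>(2) \<delta>(1)] sl2_integer[OF \<delta>(2) \<beta>(1)] by auto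
  have a': "2 * \<kappa> = of_int a" using a h dual_linear[OF roots_dual[OF \<delta>(1)]] by (simp add: mult.commute)
  have "of_int (a * b) = (of_int 4 :: complex)" using a'[symmetric] b[symmetric] \<beta>h by simp
  then have ab: "a * b = 4" by (simp only: of_int_eq_iff)
  then have "a dvd 4" by (metis dvd_triv_left)
  then have "\<bar>a\<bar> \<le> 4" using dvd_imp_le_int[of 4 a] by simp
  then have "a \<in> {-4, -3, -2, -1, 0, 1, 2, 3, 4}" by auto
  then have "a = 1 \<or> a = -1 \<or> a = 2 \<or> a = -2 \<or> a = 4 \<or> a = -4" using ab by auto presburger+
  moreover have "(\<lambda>x. of_nat 2 * \<beta> x) \<noteq> \<delta>" "(\<lambda>x. of_nat 2 * \<delta> x) \<noteq> \<beta>"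
    "(\<lambda>x. of_nat 2 * (- \<beta>) x) \<noteq> \<delta>" "(\<lambda>x. of_nat 2 * (- \<delta>) x) \<noteq> \<beta>"
    using sl2_multiple_not_root[OF \<beta>(2), of 2] sl2_multiple_not_root[OF \<delta>(2), of 2]
      sl2_multiple_not_root[OF sl2_triple_swap[OF \<beta>(2)], of 2]
      sl2_multiple_not_root[OF sl2_triple_swap[OF \<delta>(2)], of 2] \<beta>(1) \<delta>(1) by auto
  moreover have "\<kappa> = of_int a / 2" using a' by (simp add: field_simps)
  ultimately show ?thesis by (auto simp: \<delta>\<beta> fun_eq_iff)
qed

text \<open>The root spaces of the other roots span an ideal: if the bracket of root vectors for \<open>\<beta>\<close> and such a
  root \<open>\<gamma>\<close> were a nonzero vector for an anisotropic root \<open>\<delta> = \<beta> + \<gamma>\<close>, then the Jacobi identity would make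
  \<open>\<beta>\<close> anisotropic with a coroot proportional to that of \<open>\<delta>\<close>, so that \<open>\<gamma>\<close> would be \<open>0\<close> or \<open>- 2 \<beta>\<close>. The ideal
  meets \<open>H\<close> only in \<open>0\<close>, so it is \<open>0\<close> by simplicity.\<close>

lemma roots_anisotropic: "roots H \<subseteq> anisotropic"
proof -
  define N where "N = cspan (\<Union>\<gamma>\<in>roots H - anisotropic. root_space H \<gamma>)"
  have sub: "csubspace N" unfolding N_def by (rule lie.subspace_span)
  have memN: "x \<in> N" if "\<gamma> \<in> roots H - anisotropic" "x \<in> root_space H \<gamma>" for x \<gamma>
    unfolding N_def using that by (intro lie.span_base) auto
  have key: "bracket z x \<in> N"
    if \<beta>: "\<beta> \<in> insert 0 (roots H)" and z: "z \<in> root_space H \<beta>"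
      and \<gamma>: "\<gamma> \<in> roots H" "\<gamma> \<notin> anisotropic" and x: "x \<in> root_space H \<gamma>" for \<beta> \<gamma> x z
  proof -
    have kill: "bracket u y = 0" if "u \<in> root_space H \<gamma>" "y \<in> root_space H (- \<gamma>)" for u y
      using that \<gamma> by (auto simp: anisotropic_def)
    have zx: "bracket z x \<in> root_space H (\<beta> + \<gamma>)" using z x by (rule bracket_root_space)
    have \<delta>d: "\<beta> + \<gamma> \<in> dual H" using \<beta> \<gamma>(1) roots_dual zero_dual add_dual by auto
    consider "bracket z x = 0" | "\<beta> + \<gamma> \<in> roots H - anisotropic" | "bracket z x \<noteq> 0" "\<beta> + \<gamma> = 0"
      | "bracket z x \<noteq> 0" "\<beta> + \<gamma> \<in> anisotropic"
      using root_or_zeroI[OF zx _ \<delta>d] by auto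
    then show ?thesis
    proof cases
      case 1
      then show ?thesis using lie.subspace_0[OF sub] by simp
    next
      case 2
      then show ?thesis using zx by (rule memN)
    next
      case 3
      then have "\<beta> = - \<gamma>" by (simp add: add_eq_0_iff2)
      then have "bracket z x = 0" using kill[OF x] z bracket_antisym[of z x] by simp
      then show ?thesis using 3 by simp
    next
      case 4
      let ?\<delta> = "\<beta> + \<gamma>"
      have \<delta>r: "?\<delta> \<in> roots H" using 4(2) by (simp add: anisotropic_def)
      have \<beta>r: "\<beta> \<in> roots H" using \<beta> 4(2) \<gamma>(2) by auto
      obtain e f0 where ef0: "e \<in> root_space H ?\<delta>" "f0 \<in> root_space H (- ?\<delta>)" "bracket e f0 \<noteq> 0"
        using 4(2) by (auto simp: anisotropic_def)
      obtain f h where t: "sl2_triple ?\<delta> e f h"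
        using sl2_triple_exists[OF \<delta>d roots_nonzero[OF \<delta>r] ef0] by auto
      obtain c where c: "bracket z x = cscale c e" using sl2_raising_line[OF t zx] by auto
      have "c \<noteq> 0" using c 4(1) by auto
      have f: "f \<in> root_space H (- ?\<delta>)" "bracket e f = h" "h \<noteq> 0"
        using t dual_linear(5)[OF \<delta>d] by (auto simp: sl2_triple_def)
      have "- ?\<delta> + \<beta> = - \<gamma>" "- ?\<delta> + \<gamma> = - \<beta>" by (simp_all add: fun_eq_iff)
      then have zf: "bracket f z \<in> root_space H (- \<gamma>)" and xf: "bracket f x \<in> root_space H (- \<beta>)"
        using bracket_root_space[OF f(1) z] bracket_root_space[OF f(1) x] by simp_all
      have "cscale c h = bracket (bracket z x) f" by (simp add: c bracket_cscale_left f(2))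
      also have "\<dots> = - bracket f (bracket z x)" by (rule bracket_antisym)
      also have "\<dots> = - (bracket (bracket f z) x + bracket z (bracket f x))"
        by (simp only: bracket_bracket_right[of f])
      also have "bracket (bracket f z) x = 0"
        using kill[OF x zf] bracket_antisym[of "bracket f z" x] by simp
      finally have zxf: "bracket z (bracket f x) = cscale (- c) h" by (simp add: lie.scale_minus_left)
      then have "bracket z (bracket f x) \<noteq> 0" using \<open>c \<noteq> 0\<close> f(3) by simp
      then obtain b where t\<beta>: "sl2_triple \<beta> z (cscale b (bracket f x)) (cscale b (bracket z (bracket f x)))"
        using sl2_triple_exists[OF roots_dual[OF \<beta>r] roots_nonzero[OF \<beta>r] z xf] by auto
      have "\<beta> + \<gamma> = \<beta> \<or> \<beta> + \<gamma> = - \<beta>"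
        using t\<beta> by (intro proportional_coroots[OF \<beta>r _ \<delta>r t]) (simp only: zxf cscale_cscale)
      moreover have "\<gamma> \<noteq> 0" using roots_nonzero[OF \<gamma>(1)] .
      ultimately have "\<beta> + \<gamma> = - \<beta>" by auto
      then have "\<gamma> = (\<lambda>x. of_nat 2 * (- \<beta>) x)" by (simp add: fun_eq_iff eq_neg_iff_add_eq_0 algebra_simps)
      then show ?thesis using sl2_multiple_not_root[OF sl2_triple_swap[OF t\<beta>], of 2] \<gamma>(1) by simp
    qed
  qed
  have "lie_ideal N"
    unfolding lie_ideal_def
  proof (intro conjI allI ballI)
    fix x y assume y: "y \<in> N"
    have left: "bracket z y \<in> N" if z: "z \<in> (\<Union>\<gamma>\<in>insert 0 (roots H). root_space H \<gamma>)" for z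
      using _ sub y[unfolded N_def]
    proof (rule bracket_mem_span)
      fix u assume "u \<in> (\<Union>\<gamma>\<in>roots H - anisotropic. root_space H \<gamma>)"
      then show "bracket z u \<in> N" using z key by blast
    qed
    then have *: "bracket (- y) z \<in> N" if "z \<in> (\<Union>\<gamma>\<in>insert 0 (roots H). root_space H \<gamma>)" for z
      using left[OF that] bracket_antisym[of z y] by (simp only: bracket_minus_left)
    have "bracket (- y) x \<in> N"
      by (rule bracket_mem_span[OF * sub]) (simp only: span_root_spaces UNIV_I)+
    then show "bracket x y \<in> N" using bracket_antisym[of x y] by (simp add: bracket_minus_left)
  qed (rule sub)
  moreover have "N \<noteq> UNIV"
  proof
    assume N: "N = UNIV"
    have "h = 0" if h: "h \<in> H" for h
    proof -
      have "h \<in> N" using N by simp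
      then obtain t r where t: "finite t" "t \<subseteq> (\<Union>\<gamma>\<in>roots H - anisotropic. root_space H \<gamma>)"
        "h = (\<Sum>a\<in>t. cscale (r a) a)"
        unfolding N_def lie.span_explicit by (auto simp del: UN_iff)
      then have "\<forall>a\<in>t. \<exists>\<gamma>. \<gamma> \<in> roots H \<and> a \<in> root_space H \<gamma>" by auto
      then obtain g where g: "\<And>a. a \<in> t \<Longrightarrow> g a \<in> roots H" "\<And>a. a \<in> t \<Longrightarrow> a \<in> root_space H (g a)"
        by (auto simp: bchoice_iff)
      define v where "v \<gamma> = (if \<gamma> = 0 then - h else \<Sum>a\<in>{a\<in>t. g a = \<gamma>}. cscale (r a) a)" for \<gamma>
      have "\<forall>\<gamma>\<in>insert 0 (g ` t). v \<gamma> = 0"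
      proof (rule weight_vectors_independent)
        show "\<exists>h\<in>H. \<gamma> h \<noteq> \<delta> h" if "\<gamma> \<in> insert 0 (g ` t)" "\<delta> \<in> insert 0 (g ` t)" "\<gamma> \<noteq> \<delta>" for \<gamma> \<delta>
          by (rule weights_separated) (use that g(1) roots_dual zero_dual in blast)+
        show "v \<gamma> \<in> root_space H \<gamma>" if "\<gamma> \<in> insert 0 (g ` t)" for \<gamma>
          using h g(2) by (auto simp: v_def root_space_zero lie.subspace_neg[OF csubspace_H]
              intro!: lie.subspace_sum[OF csubspace_root_space] lie.subspace_scale[OF csubspace_root_space])
        have 0: "0 \<notin> g ` t" using g(1) roots_nonzero by auto
        then have "(\<Sum>\<gamma>\<in>insert 0 (g ` t). v \<gamma>) = - h + (\<Sum>\<gamma>\<in>g ` t. v \<gamma>)"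
          using t(1) by (simp add: v_def)
        also have "(\<Sum>\<gamma>\<in>g ` t. v \<gamma>) = (\<Sum>\<gamma>\<in>g ` t. \<Sum>a\<in>{a\<in>t. g a = \<gamma>}. cscale (r a) a)"
          using 0 by (intro sum.cong) (auto simp: v_def)
        also have "\<dots> = h" using sum.image_gen[OF t(1), of "\<lambda>a. cscale (r a) a" g] t(3) by simp
        finally show "(\<Sum>\<gamma>\<in>insert 0 (g ` t). v \<gamma>) = 0" by (simp only: add.left_inverse)
      qed (use t(1) in simp)
      then show "h = 0" by (simp add: v_def)
    qed
    then have "bracket h x = 0" if "h \<in> H" for h x using that by (metis bracket_zero_left)
    then have "root_space H 0 = UNIV" by (auto simp: root_space_def)
    then have "H = UNIV" by (simp add: root_space_zero)
    then show False using not_abelian bracket_H by (auto simp: abelian_def)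
  qed
  ultimately have "N = {0}" using ideal_trivial by blast
  show ?thesis
  proof
    fix \<gamma> assume \<gamma>: "\<gamma> \<in> roots H"
    obtain x where "x \<in> root_space H \<gamma>" "x \<noteq> 0" using root_vector[OF \<gamma>] .
    then show "\<gamma> \<in> anisotropic" using memN[of \<gamma> x] \<gamma> \<open>N = {0}\<close> by auto
  qed
qed

lemma root_sl2_triple:
  assumes "\<gamma> \<in> roots H"
  obtains e f h where "sl2_triple \<gamma> e f h"
proof -
  obtain x y where "x \<in> root_space H \<gamma>" "y \<in> root_space H (- \<gamma>)" "bracket x y \<noteq> 0"
    using roots_anisotropic assms by (auto simp: anisotropic_def)
  from sl2_triple_exists[OF roots_dual[OF assms] roots_nonzero[OF assms] this] that
  show ?thesis by blast
qed

text \<open>Both root spaces are lines, so their brackets span the line of \<open>h\<close>; this makes the description that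
  defines the coroot unique.\<close>

lemma sl2_coroot:
  assumes t: "sl2_triple \<gamma> e f h"
  shows "coroot H \<gamma> = h"
proof -
  have e: "e \<in> root_space H \<gamma>" "\<gamma> \<in> dual H" "f \<in> root_space H (- \<gamma>)" "bracket e f = h" "h \<in> H" "\<gamma> h = 2"
    using t by (auto simp: sl2_triple_def)
  let ?B = "{bracket x y |x y. x \<in> root_space H \<gamma> \<and> y \<in> root_space H (- \<gamma>)}"
  have "?B \<subseteq> cspan {h}"
  proof clarify
    fix x y assume xy: "x \<in> root_space H \<gamma>" "y \<in> root_space H (- \<gamma>)"
    obtain c where c: "x = cscale c e" using sl2_raising_line[OF t xy(1)] by auto
    obtain d where d: "y = cscale d f" using sl2_raising_line[OF sl2_triple_swap[OF t]] xy(2) by auto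
    show "bracket x y \<in> cspan {h}"
      by (simp add: c d bracket_cscale_left bracket_cscale_right e(4) lie.span_scale lie.span_base)
  qed
  then have "cspan ?B \<subseteq> cspan {h}" by (rule lie.span_minimal) (rule lie.subspace_span)
  then have B: "\<exists>c. k = cscale c h" if "k \<in> cspan ?B" for k
    using that by (auto simp: lie.span_singleton)
  have "h \<in> cspan ?B" using e by (intro lie.span_base) blast
  then show ?thesis
    unfolding coroot_def
  proof (intro the_equality conjI)
    fix k assume k: "k \<in> cspan ?B \<and> \<gamma> k = 2"
    then obtain c where "k = cscale c h" using B by auto
    then show "k = h" using k e by (simp add: dual_linear cscale_one)
  qed (assumption | rule e(6))+
qed

lemma root_coroot_triple:
  assumes "\<gamma> \<in> roots H"
  obtains e f where "sl2_triple \<gamma> e f (coroot H \<gamma>)"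
  using root_sl2_triple[OF assms] sl2_coroot that by metis

lemma coroot_mem_H: "\<gamma> \<in> roots H \<Longrightarrow> coroot H \<gamma> \<in> H"
  and root_coroot: "\<gamma> \<in> roots H \<Longrightarrow> \<gamma> (coroot H \<gamma>) = 2"
  by (rule root_coroot_triple, assumption, simp add: sl2_triple_def)+

lemma uminus_root:
  assumes "\<gamma> \<in> roots H"
  shows "- \<gamma> \<in> roots H"
proof -
  obtain e f where t: "sl2_triple \<gamma> e f (coroot H \<gamma>)" using root_coroot_triple[OF assms] .
  have "(\<lambda>x. \<gamma> x - \<gamma> (coroot H \<gamma>) * \<gamma> x) = - \<gamma>"
    using root_coroot[OF assms] by (simp add: fun_eq_iff)
  then show ?thesis using sl2_reflection[OF t assms] by simp
qed

lemma root_reflection: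
  assumes "\<gamma> \<in> roots H" "\<beta> \<in> roots H"
  shows "(\<lambda>x. \<beta> x - \<beta> (coroot H \<gamma>) * \<gamma> x) \<in> roots H"
  using root_coroot_triple[OF assms(1)] sl2_reflection assms(2) by metis

lemma root_integer: "\<gamma> \<in> roots H \<Longrightarrow> \<beta> \<in> roots H \<Longrightarrow> \<exists>n::int. \<beta> (coroot H \<gamma>) = of_int n"
  using root_coroot_triple sl2_integer by metis

lemma multiple_not_root: "\<gamma> \<in> roots H \<Longrightarrow> k \<ge> 2 \<Longrightarrow> (\<lambda>x. of_nat k * \<gamma> x) \<notin> roots H"
  using root_coroot_triple sl2_multiple_not_root by metis

text \<open>If \<open>e\<close> killed the root space of \<open>\<gamma>\<close>, then \<open>\<gamma>\<close> would have nonnegative weight, and vectors of weight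
  \<open>\<beta> + \<gamma>\<close> would be killed by \<open>bracket e \<circ> bracket f\<close> in spite of their positive weight.\<close>

lemma bracket_root_spaces_nonzero:
  assumes \<beta>: "\<beta> \<in> roots H" and \<gamma>: "\<gamma> \<in> roots H" and \<beta>\<gamma>: "\<beta> + \<gamma> \<in> roots H"
  obtains x y where "x \<in> root_space H \<beta>" "y \<in> root_space H \<gamma>" "bracket x y \<noteq> 0"
proof -
  have "\<exists>x\<in>root_space H \<beta>. \<exists>y\<in>root_space H \<gamma>. bracket x y \<noteq> 0"
  proof (rule ccontr)
    assume "\<not> ?thesis"
    then have kill: "bracket x y = 0" if "x \<in> root_space H \<beta>" "y \<in> root_space H \<gamma>" for x y
      using that by blast
    obtain e f h where t: "sl2_triple \<beta> e f h" using root_sl2_triple[OF \<beta>] .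
    have e: "e \<in> root_space H \<beta>" "f \<in> root_space H (- \<beta>)" "\<beta> h = 2" "h \<in> H"
      using t by (auto simp: sl2_triple_def)
    obtain v where v: "v \<in> root_space H \<gamma>" "v \<noteq> 0" using root_vector[OF \<gamma>] .
    have "bracket e v = 0" using kill e(1) v(1) by simp
    then obtain N where N: "\<gamma> (- h) = - of_nat N"
      using sl2_weight_nonpos[OF sl2_triple_swap[OF t] v(1) roots_dual[OF \<gamma>] v(2)] by auto
    obtain w where w: "w \<in> root_space H (\<beta> + \<gamma>)" "w \<noteq> 0" using root_vector[OF \<beta>\<gamma>] .
    have "- \<beta> + (\<beta> + \<gamma>) = \<gamma>" by simp
    then have "bracket f w \<in> root_space H \<gamma>" using bracket_root_space[OF e(2) w(1)] by simp
    then have "bracket e (bracket f w) = 0" using kill e(1) by simp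
    then obtain M where "(\<beta> + \<gamma>) h = - of_nat M"
      using sl2_weight_nonpos[OF t w(1) roots_dual[OF \<beta>\<gamma>] w(2)] by auto
    then have "Re (2 + \<gamma> h) = - real M" using e(3) by simp
    moreover have "Re (\<gamma> h) = real N" using N e(4) by (simp add: dual_linear[OF roots_dual[OF \<gamma>]])
    ultimately show False by simp
  qed
  then show ?thesis using that by blast
qed

end

section \<open>Root systems of type D\<close>

interpretation forms: vector_space "\<lambda>c (f :: 'g::complex_lie_algebra \<Rightarrow> complex) x. c * f x"
  by unfold_locales (auto simp: fun_eq_iff algebra_simps)

lemma sum_apply: "(\<Sum>a\<in>A. f a) x = (\<Sum>a\<in>A. (f a x :: complex))"
  by (induction A rule: infinite_finite_induct) auto

locale type_D = lie_cartan H for H :: "'g::complex_lie_algebra set" +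
  fixes l :: nat and \<alpha> :: "nat \<Rightarrow> 'g \<Rightarrow> complex"
  assumes l4: "l \<ge> 4" and simple_roots: "simple_roots_type_D H l \<alpha>"
begin

declare One_nat_def [simp del]

abbreviation cor :: "nat \<Rightarrow> 'g" where "cor i \<equiv> coroot H (\<alpha> i)"

lemma inj_\<alpha>: "inj_on \<alpha> {1..l}"
  and base: "root_base H (\<alpha> ` {1..l})"
  and bonds: "i \<in> {1..l} \<Longrightarrow> j \<in> {1..l} \<Longrightarrow> i \<noteq> j \<Longrightarrow>
        dynkin_bonds H (\<alpha> i) (\<alpha> j) = (if D_edge l i j \<or> D_edge l j i then 1 else 0)"
  using simple_roots unfolding simple_roots_type_D_def by (fast, fast, simp)

lemma simple_root: "i \<in> {1..l} \<Longrightarrow> \<alpha> i \<in> roots H"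
  using base unfolding root_base_def by blast

definition comb :: "(nat \<Rightarrow> int) \<Rightarrow> 'g \<Rightarrow> complex" where
  "comb a = (\<lambda>x. \<Sum>i\<in>{1..l}. of_int (a i) * \<alpha> i x)"

lemma comb_zero:
  assumes "comb a = 0" "i \<in> {1..l}"
  shows "a i = 0"
proof (rule ccontr)
  assume ne: "a i \<noteq> 0"
  let ?u = "\<lambda>\<gamma>. of_int (a (the_inv_into {1..l} \<alpha> \<gamma>)) :: complex"
  have "(\<Sum>\<gamma>\<in>\<alpha> ` {1..l}. (\<lambda>x. ?u \<gamma> * \<gamma> x)) = comb a"
    by (simp add: comb_def sum.reindex[OF inj_\<alpha>] the_inv_into_f_f[OF inj_\<alpha>] sum_apply fun_eq_iff)
  moreover have "?u (\<alpha> i) \<noteq> 0" using ne assms(2) by (simp add: the_inv_into_f_f[OF inj_\<alpha>])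
  ultimately have "forms.dependent (\<alpha> ` {1..l})"
    using assms by (subst forms.dependent_finite) (auto intro!: exI[of _ ?u])
  then show False using base by (simp add: root_base_def)
qed

lemma comb_diff: "comb a - comb b = comb (\<lambda>i. a i - b i)"
  by (simp add: comb_def fun_eq_iff sum_subtractf algebra_simps)

lemma comb_inj: "comb a = comb b \<Longrightarrow> i \<in> {1..l} \<Longrightarrow> a i = b i"
  using comb_zero[of "\<lambda>i. a i - b i" i] comb_diff[of a b] by simp

lemma comb_unit: "i \<in> {1..l} \<Longrightarrow> comb (\<lambda>j. if j = i then k else 0) = (\<lambda>x. of_int k * \<alpha> i x)"
  by (simp add: comb_def fun_eq_iff if_distrib[of of_int] if_distrib[of "\<lambda>z. z * _"] cong: if_cong)

lemma nat_span_simple: "\<gamma> \<in> nat_span (\<alpha> ` {1..l}) \<longleftrightarrow> (\<exists>a. \<gamma> = comb a \<and> (\<forall>i\<in>{1..l}. a i \<ge> 0))"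
proof
  assume "\<gamma> \<in> nat_span (\<alpha> ` {1..l})"
  then obtain c :: "('g \<Rightarrow> complex) \<Rightarrow> nat" where c: "\<gamma> = (\<lambda>x. \<Sum>\<gamma>\<in>\<alpha> ` {1..l}. of_nat (c \<gamma>) * \<gamma> x)"
    by (auto simp: nat_span_def)
  then have "\<gamma> = comb (\<lambda>i. int (c (\<alpha> i)))" by (simp add: comb_def sum.reindex[OF inj_\<alpha>])
  then show "\<exists>a. \<gamma> = comb a \<and> (\<forall>i\<in>{1..l}. a i \<ge> 0)" by auto
next
  assume "\<exists>a. \<gamma> = comb a \<and> (\<forall>i\<in>{1..l}. a i \<ge> 0)"
  then obtain a where a: "\<gamma> = comb a" "\<forall>i\<in>{1..l}. a i \<ge> 0" by auto
  have "\<gamma> = (\<lambda>x. \<Sum>\<gamma>\<in>\<alpha> ` {1..l}. of_nat (nat (a (the_inv_into {1..l} \<alpha> \<gamma>))) * \<gamma> x)"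
    using a(2) by (simp add: a(1) comb_def sum.reindex[OF inj_\<alpha>] the_inv_into_f_f[OF inj_\<alpha>])
  then show "\<gamma> \<in> nat_span (\<alpha> ` {1..l})"
    unfolding nat_span_def by (intro CollectI exI[of _ "\<lambda>\<gamma>. nat (a (the_inv_into {1..l} \<alpha> \<gamma>))"]) simp
qed

lemma int_span_simple:
  assumes "J \<subseteq> {1..l}"
  shows "\<gamma> \<in> int_span (\<alpha> ` J) \<longleftrightarrow> (\<exists>a. \<gamma> = comb a \<and> (\<forall>i\<in>{1..l} - J. a i = 0))"
proof
  have inj: "inj_on \<alpha> J" using inj_\<alpha> assms by (rule inj_on_subset)
  assume "\<gamma> \<in> int_span (\<alpha> ` J)"
  then obtain c where c: "\<gamma> = (\<lambda>x. \<Sum>\<gamma>\<in>\<alpha> ` J. of_int (c \<gamma>) * \<gamma> x)"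
    by (auto simp: int_span_def)
  have "\<gamma> = comb (\<lambda>i. if i \<in> J then c (\<alpha> i) else 0)"
    unfolding c comb_def sum.reindex[OF inj]
    using assms by (auto simp: fun_eq_iff intro!: sum.mono_neutral_cong_left)
  then show "\<exists>a. \<gamma> = comb a \<and> (\<forall>i\<in>{1..l} - J. a i = 0)" by auto
next
  have inj: "inj_on \<alpha> J" using inj_\<alpha> assms by (rule inj_on_subset)
  assume "\<exists>a. \<gamma> = comb a \<and> (\<forall>i\<in>{1..l} - J. a i = 0)"
  then obtain a where a: "\<gamma> = comb a" "\<forall>i\<in>{1..l} - J. a i = 0" by auto
  have "\<gamma> = (\<lambda>x. \<Sum>\<gamma>\<in>\<alpha> ` J. of_int (a (the_inv_into J \<alpha> \<gamma>)) * \<gamma> x)"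
    unfolding a(1) comb_def sum.reindex[OF inj]
    using assms a(2)
    by (auto simp: fun_eq_iff the_inv_into_f_f[OF inj] intro!: sum.mono_neutral_cong_right)
  then show "\<gamma> \<in> int_span (\<alpha> ` J)"
    unfolding int_span_def by (intro CollectI exI[of _ "\<lambda>\<gamma>. a (the_inv_into J \<alpha> \<gamma>)"]) simp
qed

lemma root_comb:
  assumes "\<gamma> \<in> roots H"
  obtains a where "\<gamma> = comb a" "(\<forall>i\<in>{1..l}. a i \<ge> 0) \<or> (\<forall>i\<in>{1..l}. a i \<le> 0)"
proof -
  have "\<gamma> \<in> nat_span (\<alpha> ` {1..l}) \<or> - \<gamma> \<in> nat_span (\<alpha> ` {1..l})"
    using base assms unfolding root_base_def by blast
  then show ?thesis
  proof
    assume "- \<gamma> \<in> nat_span (\<alpha> ` {1..l})"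
    then obtain a where a: "- \<gamma> = comb a" "\<forall>i\<in>{1..l}. a i \<ge> 0" unfolding nat_span_simple by auto
    have "\<gamma> = - comb a" using a(1) by (metis minus_minus)
    also have "\<dots> = comb (\<lambda>i. - a i)" by (simp add: comb_def fun_eq_iff sum_negf)
    finally have "\<gamma> = comb (\<lambda>i. - a i)" .
    then show ?thesis using a(2) by (intro that) auto
  qed (use that in \<open>auto simp: nat_span_simple\<close>)
qed

text \<open>The coefficients of a root with respect to the simple roots have the same sign.\<close>

lemma simple_diff_not_root:
  assumes "i \<in> {1..l}" "j \<in> {1..l}" "i \<noteq> j"
  shows "- \<alpha> j + \<alpha> i \<notin> insert 0 (roots H)"
proof -
  have eq: "- \<alpha> j + \<alpha> i = comb (\<lambda>k. (if k = i then 1 else 0) - (if k = j then 1 else 0))"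
    using comb_unit[of i 1] comb_unit[of j 1] assms
    by (simp add: fun_eq_iff flip: comb_diff)
  have "- \<alpha> j + \<alpha> i \<noteq> 0"
    using comb_zero[of "\<lambda>k. (if k = i then 1 else 0) - (if k = j then 1 else 0)" i] assms eq by auto
  moreover have "- \<alpha> j + \<alpha> i \<notin> roots H"
  proof
    assume "- \<alpha> j + \<alpha> i \<in> roots H"
    then obtain a where a: "- \<alpha> j + \<alpha> i = comb a" "(\<forall>i\<in>{1..l}. a i \<ge> 0) \<or> (\<forall>i\<in>{1..l}. a i \<le> 0)"
      by (rule root_comb)
    have "a i = 1" "a j = -1"
      using comb_inj[OF a(1)[unfolded eq], of i] comb_inj[OF a(1)[unfolded eq], of j] assms by auto
    then show False using a(2) assms by force
  qed
  ultimately show ?thesis by simp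
qed

lemma simple_lowest:
  assumes "i \<in> {1..l}" "j \<in> {1..l}" "i \<noteq> j" "v \<in> root_space H (\<alpha> i)" "f \<in> root_space H (- \<alpha> j)"
  shows "bracket f v = 0"
proof (rule ccontr)
  assume "bracket f v \<noteq> 0"
  moreover have "- \<alpha> j + \<alpha> i \<in> dual H"
    using assms simple_root roots_dual add_dual minus_dual by blast
  ultimately show False
    using root_or_zeroI[OF bracket_root_space[OF assms(5,4)]] simple_diff_not_root[OF assms(1-3)] by simp
qed

lemma cartan_nonpos:
  assumes "i \<in> {1..l}" "j \<in> {1..l}" "i \<noteq> j"
  obtains n where "\<alpha> i (cor j) = - of_nat n"
proof -
  obtain e f where t: "sl2_triple (\<alpha> j) e f (cor j)" using root_coroot_triple[OF simple_root[OF assms(2)]] .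
  obtain v where v: "v \<in> root_space H (\<alpha> i)" "v \<noteq> 0" using root_vector[OF simple_root[OF assms(1)]] .
  have "bracket f v = 0" using simple_lowest[OF assms v(1)] t by (simp add: sl2_triple_def)
  then show ?thesis
    using sl2_weight_nonpos[OF t v(1) roots_dual[OF simple_root[OF assms(1)]] v(2)] that by auto
qed

text \<open>If \<open>\<alpha> i\<close> has weight \<open>0\<close> with respect to \<open>\<alpha> j\<close>, then the root vectors of both commute, since their bracket
  would be a lowest weight vector of weight \<open>2\<close>. As \<open>\<alpha> j - \<alpha> i\<close> is not a root either, \<open>cor i\<close> annihilates the root
  vectors of \<open>\<alpha> j\<close>.\<close>

lemma cartan_zero_sym:
  assumes ij: "i \<in> {1..l}" "j \<in> {1..l}" "i \<noteq> j" and 0: "\<alpha> i (cor j) = 0"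
  shows "\<alpha> j (cor i) = 0"
proof -
  have ri: "\<alpha> i \<in> roots H" and rj: "\<alpha> j \<in> roots H" using ij simple_root by auto
  obtain e f where t: "sl2_triple (\<alpha> j) e f (cor j)" using root_coroot_triple[OF rj] .
  obtain e' f' where t': "sl2_triple (\<alpha> i) e' f' (cor i)" using root_coroot_triple[OF ri] .
  have e: "e \<in> root_space H (\<alpha> j)" "f \<in> root_space H (- \<alpha> j)" "bracket e f = cor j"
      "cor j \<in> H" "\<alpha> j (cor j) = 2" "e \<noteq> 0"
    and e': "e' \<in> root_space H (\<alpha> i)" "f' \<in> root_space H (- \<alpha> i)" "bracket e' f' = cor i" "cor i \<in> H"
    using t t' dual_linear(5)[OF roots_dual[OF rj]] by (auto simp: sl2_triple_def)
  have fe: "bracket f e = - cor j" using bracket_antisym[of f e] e(3) by simp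
  have ee: "bracket e e' = 0"
  proof (rule ccontr)
    assume ne: "bracket e e' \<noteq> 0"
    have w: "bracket e e' \<in> root_space H (\<alpha> j + \<alpha> i)" using e(1) e'(1) by (rule bracket_root_space)
    have "bracket (cor j) e' = 0" using e'(1) e(4) 0 by (simp add: root_space_def)
    then have "bracket f (bracket e e') = 0"
      using simple_lowest[OF ij e'(1) e(2)]
      by (simp add: bracket_bracket_right[of f] fe bracket_minus_left)
    then obtain N where "(\<alpha> j + \<alpha> i) (cor j) = - of_nat N"
      using sl2_weight_nonpos[OF t w add_dual[OF roots_dual[OF rj] roots_dual[OF ri]] ne] by auto
    then have "Re 2 = Re (- of_nat N)" using 0 e(5) by simp
    then show False by simp
  qed
  have "bracket (cor i) e = bracket e' (bracket f' e) - bracket f' (bracket e' e)"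
    using bracket_bracket_right[of e' f' e] e'(3) by simp
  also have "\<dots> = 0"
    using simple_lowest[OF ij(2,1) ij(3)[symmetric] e(1) e'(2)] ee bracket_antisym[of e' e] by simp
  finally have "cscale (\<alpha> j (cor i)) e = 0" using e(1) e'(4) by (simp add: root_space_def)
  then show ?thesis using e(6) by simp
qed

text \<open>The number of bonds is the product of two nonpositive integers, which vanish simultaneously. So this
  product determines both if it is \<open>0\<close> or \<open>1\<close>.\<close>

lemma cartan_matrix:
  assumes "i \<in> {1..l}" "j \<in> {1..l}"
  shows "\<alpha> i (cor j) = (if i = j then 2 else if D_edge l i j \<or> D_edge l j i then -1 else 0)"
proof (cases "i = j")
  case True
  then show ?thesis using root_coroot simple_root assms by simp
next
  case False
  obtain m where m: "\<alpha> i (cor j) = - of_nat m" using cartan_nonpos[OF assms False] .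
  obtain n where n: "\<alpha> j (cor i) = - of_nat n" using cartan_nonpos[OF assms(2,1) False[symmetric]] .
  have b: "\<alpha> i (cor j) * \<alpha> j (cor i) = (if D_edge l i j \<or> D_edge l j i then 1 else 0)"
    using bonds[OF assms False] by (simp add: dynkin_bonds_def cartan_integer_def)
  show ?thesis
  proof (cases "D_edge l i j \<or> D_edge l j i")
    case True
    then have "of_nat (m * n) = (of_nat 1 :: complex)" using b m n by simp
    then have "m * n = 1" by (simp only: of_nat_eq_iff)
    then show ?thesis using True False m by simp
  next
    case e: False
    then have "\<alpha> i (cor j) = 0 \<or> \<alpha> j (cor i) = 0" using b by simp
    then show ?thesis using e False cartan_zero_sym assms by metis
  qed
qed

subsection \<open>Coordinates\<close>

text \<open>The solution of \<open>\<alpha> i = \<epsilon> i - \<epsilon> (i + 1)\<close> for \<open>i < l\<close> and \<open>\<alpha> l = \<epsilon> (l - 1) + \<epsilon> l\<close>. The elements \<open>\<eta> i\<close> are made from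
  the coroots in the same way and form the dual basis.\<close>

definition \<epsilon> :: "nat \<Rightarrow> 'g \<Rightarrow> complex" where
  "\<epsilon> i = (\<lambda>x. (\<Sum>k\<in>{i..<l}. \<alpha> k x) + (\<alpha> l x - \<alpha> (l - 1) x) / 2)"

definition \<eta> :: "nat \<Rightarrow> 'g" where
  "\<eta> i = (\<Sum>k\<in>{i..<l}. cor k) + cscale (1/2) (cor l - cor (l - 1))"

lemma \<epsilon>_step: "i < l \<Longrightarrow> \<epsilon> i = (\<lambda>x. \<alpha> i x + \<epsilon> (Suc i) x)"
  by (simp add: \<epsilon>_def fun_eq_iff sum.atLeast_Suc_lessThan)

lemma \<eta>_step: "i < l \<Longrightarrow> \<eta> i = cor i + \<eta> (Suc i)"
  by (simp add: \<eta>_def sum.atLeast_Suc_lessThan add.assoc)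

lemma cor_mem: "i \<in> {1..l} \<Longrightarrow> cor i \<in> H"
  using coroot_mem_H simple_root by blast

lemma \<eta>_mem: "i \<in> {1..l} \<Longrightarrow> \<eta> i \<in> H"
  unfolding \<eta>_def using l4
  by (intro lie.subspace_add[OF csubspace_H] lie.subspace_sum[OF csubspace_H]
      lie.subspace_scale[OF csubspace_H] lie.subspace_diff[OF csubspace_H] cor_mem) auto

lemma \<alpha>_\<eta>:
  assumes "k \<in> {1..l}" "j \<in> {1..l}"
  shows "\<alpha> k (\<eta> j) = (if k < l then (if j = k then 1 else 0) - (if j = Suc k then 1 else 0)
      else (if j = l - 1 then 1 else 0) + (if j = l then 1 else 0))"
proof -
  have lin: "\<alpha> k (x + y) = \<alpha> k x + \<alpha> k y" "\<alpha> k (x - y) = \<alpha> k x - \<alpha> k y" "\<alpha> k (cscale c x) = c * \<alpha> k x"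
    if "x \<in> H" "y \<in> H" for x y c
    using dual_linear[OF roots_dual[OF simple_root[OF assms(1)]]] that by auto
  have jl: "j \<le> l" using assms by simp
  then show ?thesis using assms(2)
  proof (induction j rule: inc_induct)
    case base
    have cm: "cor l \<in> H" "cor (l - 1) \<in> H" using l4 by (auto intro!: cor_mem)
    then have "cor l - cor (l - 1) \<in> H" by (intro lie.subspace_diff[OF csubspace_H])
    then have "\<alpha> k (\<eta> l) = (\<alpha> k (cor l) - \<alpha> k (cor (l - 1))) / 2"
      using cm by (simp add: \<eta>_def lin)
    also have "\<dots> = (if k < l then (if l = k then 1 else 0) - (if l = Suc k then 1 else 0)
      else (if l = l - 1 then 1 else 0) + (if l = l then 1 else 0))"
      using assms(1) l4 by (subst (1 2) cartan_matrix) (auto simp: D_edge_def)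
    finally show ?case .
  next
    case (step j)
    then have "\<alpha> k (\<eta> j) = \<alpha> k (cor j) + \<alpha> k (\<eta> (Suc j))"
      using \<eta>_step[of j] by (simp add: lin cor_mem \<eta>_mem)
    also have "\<alpha> k (cor j) = (if k = j then 2 else if D_edge l k j \<or> D_edge l j k then -1 else 0)"
      using step assms(1) by (intro cartan_matrix) auto
    also have "D_edge l k j \<or> D_edge l j k \<longleftrightarrow> k < l \<and> (j = Suc k \<or> k = Suc j) \<or> k = l \<and> j = l - 2"
      using step(2) assms(1) l4 unfolding D_edge_def atLeastAtMost_iff by arith
    also have "\<alpha> k (\<eta> (Suc j)) = (if k < l then (if Suc j = k then 1 else 0) - (if Suc j = Suc k then 1 else 0)
      else (if Suc j = l - 1 then 1 else 0) + (if Suc j = l then 1 else 0))"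
      using step by auto
    finally have eq: "\<alpha> k (\<eta> j) =
      (if k = j then 2 else if k < l \<and> (j = Suc k \<or> k = Suc j) \<or> k = l \<and> j = l - 2 then -1 else 0) +
      (if k < l then (if Suc j = k then 1 else 0) - (if Suc j = Suc k then 1 else 0)
       else (if Suc j = l - 1 then 1 else 0) + (if Suc j = l then 1 else 0))" .
    show ?case
    proof (cases "k < l")
      case True
      consider "k = j" | "j = Suc k" | "k = Suc j" | "k \<noteq> j" "j \<noteq> Suc k" "k \<noteq> Suc j" by blast
      then show ?thesis unfolding eq using True by cases simp_all
    next
      case False
      have k: "k = l" using False assms(1) by simp
      have j: "(j = l - 1) = (Suc j = l)" "(Suc j = l - 1) = (j = l - 2)" "Suc j = l \<Longrightarrow> j \<noteq> l - 2"
        using step(2) l4 by arith+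
      show ?thesis unfolding eq unfolding k j using step(2) j(3) by (simp split: if_split)
    qed
  qed
qed

lemma \<epsilon>_\<eta>:
  assumes "i \<in> {1..l}" "j \<in> {1..l}"
  shows "\<epsilon> i (\<eta> j) = (if i = j then 1 else 0)"
proof -
  have "i \<le> l" using assms by simp
  then show ?thesis using assms(1)
  proof (induction i rule: inc_induct)
    case base
    then show ?case using assms(2) l4 by (simp add: \<epsilon>_def \<alpha>_\<eta>)
  next
    case (step i)
    then show ?case using assms(2) l4 by (auto simp: \<epsilon>_step \<alpha>_\<eta>)
  qed
qed

lemma \<epsilon>_mem: "i \<in> {1..l} \<Longrightarrow> \<epsilon> i \<in> dual H"
proof -
  assume "i \<in> {1..l}"
  then have "i \<le> l" "1 \<le> i" by auto
  then show "\<epsilon> i \<in> dual H"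
  proof (induction i rule: inc_induct)
    case base
    have "\<alpha> l \<in> dual H" "\<alpha> (l - 1) \<in> dual H" using simple_root[THEN roots_dual] l4 by auto
    then have "(\<lambda>x. 0 x + 1/2 * (\<lambda>x. \<alpha> l x + -1 * \<alpha> (l - 1) x) x) \<in> dual H"
      by (intro line_dual zero_dual)
    also have "(\<lambda>x. 0 x + 1/2 * (\<lambda>x. \<alpha> l x + -1 * \<alpha> (l - 1) x) x) = \<epsilon> l"
      by (simp add: \<epsilon>_def fun_eq_iff)
    finally show ?case .
  next
    case (step i)
    then have "(\<lambda>x. \<alpha> i x + 1 * \<epsilon> (Suc i) x) \<in> dual H"
      using simple_root[THEN roots_dual] by (intro line_dual) auto
    then show ?case using step by (simp add: \<epsilon>_step)
  qed
qed

end

section \<open>Pairs of signed indices\<close>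

text \<open>The integer \<open>z\<close> with \<open>1 \<le> \<bar>z\<bar> \<le> l\<close> stands for the form \<open>\<epsilon> z\<close> if \<open>z > 0\<close> and for \<open>- \<epsilon> (- z)\<close>
  otherwise, and a set \<open>{x, y}\<close> for the root which is the sum of the two forms.\<close>

definition signed :: "nat \<Rightarrow> int set" where
  "signed l = {z. z \<noteq> 0 \<and> \<bar>z\<bar> \<le> int l}"

definition signed_pairs :: "nat \<Rightarrow> int set set" where
  "signed_pairs l = {{x, y} |x y. x \<in> signed l \<and> y \<in> signed l \<and> x \<noteq> y \<and> x \<noteq> - y}"

lemma signed_uminus [simp]: "- z \<in> signed l \<longleftrightarrow> z \<in> signed l"
  by (simp add: signed_def)

lemma pair_mem_signed_pairs:
  "{x, y} \<in> signed_pairs l \<longleftrightarrow> x \<in> signed l \<and> y \<in> signed l \<and> x \<noteq> y \<and> x \<noteq> - y"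
  unfolding signed_pairs_def by (auto simp: doubleton_eq_iff)

lemma signed_pairsE:
  assumes "S \<in> signed_pairs l"
  obtains x y where "S = {x, y}" "x \<in> signed l" "y \<in> signed l" "x \<noteq> y" "x \<noteq> - y"
  using assms unfolding signed_pairs_def by auto

text \<open>The coefficient of \<open>\<epsilon> a\<close> in the root belonging to \<open>S\<close>, continued to negative \<open>a\<close> as an odd function.\<close>

definition coord :: "int set \<Rightarrow> int \<Rightarrow> int" where
  "coord S a = (if a \<in> S then 1 else 0) - (if - a \<in> S then 1 else 0)"

text \<open>Without cancellation every index of the two summands keeps a positive coefficient, and so belongs to
  \<open>U\<close>, which has only two elements.\<close>

lemma signed_pairs_sum:
  assumes S: "S \<in> signed_pairs l" and T: "T \<in> signed_pairs l" and U: "U \<in> signed_pairs l"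
    and sum: "\<And>a. a \<in> signed l \<Longrightarrow> coord S a + coord T a = coord U a"
  obtains x y z where "S = {x, y}" "T = {- y, z}" "U = {x, z}"
proof -
  note conclude = that
  obtain s1 s2 where s: "S = {s1, s2}" "s1 \<in> signed l" "s2 \<in> signed l" "s1 \<noteq> s2" "s1 \<noteq> - s2"
    using S by (rule signed_pairsE)
  have *: thesis if c: "- y \<in> T" and Sy: "S = {x, y}" and xy: "x \<in> signed l" "y \<in> signed l" "x \<noteq> y" "x \<noteq> - y" for x y
  proof -
    obtain t1 t2 where t: "T = {t1, t2}" "t1 \<in> signed l" "t2 \<in> signed l" "t1 \<noteq> t2" "t1 \<noteq> - t2"
      using T by (rule signed_pairsE)
    obtain z where Tz: "T = {- y, z}" using c t(1) by (metis insertE singletonD insert_commute)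
    then have z: "T = {- y, z}" "z \<in> signed l" "z \<noteq> - y" "z \<noteq> y"
      using T pair_mem_signed_pairs[of "- y" z l] by auto
    have nz: "x \<noteq> 0" "y \<noteq> 0" "z \<noteq> 0" using xy z by (auto simp: signed_def)
    have U1: "coord U a \<le> 1" for a by (simp add: coord_def)
    have 1: "coord U x = 1 + (if z = x then 1 else 0) - (if z = - x then 1 else 0)"
    proof -
      have "coord S x = 1" using xy nz unfolding coord_def Sy by auto
      moreover have "coord T x = (if z = x then 1 else 0) - (if z = - x then 1 else 0)"
        using xy z nz unfolding coord_def z(1) by auto
      ultimately show ?thesis using sum[OF xy(1)] by linarith
    qed
    then have "z \<noteq> x" using U1[of x] nz(1) by auto
    have 2: "coord U z = 1 + (if x = z then 1 else 0) - (if x = - z then 1 else 0)"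
    proof -
      have "coord T z = 1" using z nz unfolding coord_def z(1) by auto
      moreover have "coord S z = (if x = z then 1 else 0) - (if x = - z then 1 else 0)"
        using xy z nz unfolding coord_def Sy by auto
      ultimately show ?thesis using sum[OF z(2)] by linarith
    qed
    have "z \<noteq> - x"
    proof
      assume zx: "z = - x"
      obtain u v where u: "U = {u, v}" "u \<in> signed l" "v \<in> signed l" "u \<noteq> v" "u \<noteq> - v"
        using U by (rule signed_pairsE)
      have "coord U u = 1" using u by (auto simp: coord_def signed_def)
      moreover have "coord S u + coord T u = 0"
        using xy z u by (auto simp: coord_def Sy z(1) zx)
      ultimately show False using sum[OF u(2)] by simp
    qed
    have "x \<in> U" "z \<in> U" using 1 2 \<open>z \<noteq> x\<close> \<open>z \<noteq> - x\<close> by (auto simp: coord_def split: if_splits)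
    then have "U = {x, z}" using \<open>z \<noteq> x\<close> U by (auto elim!: signed_pairsE)
    then show thesis using conclude[OF Sy z(1)] by simp
  qed
  consider "- s2 \<in> T" | "- s1 \<in> T" | "- s1 \<notin> T" "- s2 \<notin> T" by blast
  then show thesis
  proof cases
    case 1
    then show thesis using *[of s2 s1] s by simp
  next
    case 2
    have "S = {s2, s1}" using s(1) by (simp add: insert_commute)
    moreover have "s2 \<noteq> - s1" using s(5) by linarith
    ultimately show thesis using *[OF 2] s by simp
  next
    case 3
    have c: "coord U s1 = 1 + (if s1 \<in> T then 1 else 0)" "coord U s2 = 1 + (if s2 \<in> T then 1 else 0)"
      using sum[OF s(2)] sum[OF s(3)] s 3 by (auto simp: coord_def signed_def)
    have "coord U s1 \<le> 1" "coord U s2 \<le> 1" by (simp_all add: coord_def)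
    then have "s1 \<notin> T" "s2 \<notin> T" using c by auto
    then have "s1 \<in> U" "s2 \<in> U" using c by (auto simp: coord_def split: if_splits)
    then have US: "U = S" using s U by (auto elim!: signed_pairsE)
    obtain t1 t2 where t: "T = {t1, t2}" "t1 \<in> signed l" "t2 \<in> signed l" "t1 \<noteq> t2" "t1 \<noteq> - t2"
      using T by (rule signed_pairsE)
    have "coord T t1 = 1" using t by (auto simp: coord_def signed_def)
    then show thesis using sum[OF t(2)] US by simp
  qed
qed

context type_D
begin

section \<open>The roots in coordinates\<close>

text \<open>The form with the signed index \<open>z\<close>; the corresponding elements of \<open>H\<close> are \<open>Y z\<close>.\<close>

definition E :: "int \<Rightarrow> 'g \<Rightarrow> complex" where
  "E z = (\<lambda>x. of_int (sgn z) * \<epsilon> (nat \<bar>z\<bar>) x)"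

definition root_of :: "int set \<Rightarrow> 'g \<Rightarrow> complex" where
  "root_of S = (\<lambda>x. \<Sum>z\<in>S. E z x)"

lemma root_of_pair: "x \<noteq> y \<Longrightarrow> root_of {x, y} = E x + E y"
  by (simp add: root_of_def fun_eq_iff)

lemma E_uminus: "E (- z) = - E z"
  by (simp add: E_def fun_eq_iff)

lemma E_of_nat: "1 \<le> k \<Longrightarrow> E (int k) = \<epsilon> k"
  by (simp add: E_def fun_eq_iff)

lemma E_\<eta>: "z \<in> signed l \<Longrightarrow> j \<in> {1..l} \<Longrightarrow>
    E z (\<eta> j) = (if z = int j then 1 else 0) - (if z = - int j then 1 else 0)"
  unfolding E_def signed_def by (subst \<epsilon>_\<eta>) (auto simp: sgn_if)

lemma E_dual:
  assumes "z \<in> signed l"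
  shows "E z \<in> dual H"
proof -
  have "nat \<bar>z\<bar> \<in> {1..l}" using assms by (auto simp: signed_def)
  from line_dual[OF zero_dual \<epsilon>_mem[OF this], of "of_int (sgn z)"] show ?thesis by (simp add: E_def)
qed

definition Y :: "int \<Rightarrow> 'g" where
  "Y z = cscale (of_int (sgn z)) (\<eta> (nat \<bar>z\<bar>))"

lemma Y_mem: "z \<in> signed l \<Longrightarrow> Y z \<in> H"
  unfolding Y_def by (intro lie.subspace_scale[OF csubspace_H] \<eta>_mem) (auto simp: signed_def)

lemma Y_of_nat: "1 \<le> k \<Longrightarrow> Y (int k) = \<eta> k"
  by (simp add: Y_def cscale_one)

lemma E_Y: "z \<in> signed l \<Longrightarrow> p \<in> signed l \<Longrightarrow>
    E z (Y p) = (if z = p then 1 else 0) - (if z = - p then 1 else 0)"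
proof -
  assume z: "z \<in> signed l" and p: "p \<in> signed l"
  then have j: "nat \<bar>p\<bar> \<in> {1..l}" by (auto simp: signed_def)
  have "E z (Y p) = of_int (sgn p) * E z (\<eta> (nat \<bar>p\<bar>))"
    unfolding Y_def using dual_linear(2)[OF E_dual[OF z] \<eta>_mem[OF j]] .
  then show ?thesis using z p by (auto simp: E_\<eta>[OF z j] sgn_if signed_def)
qed

text \<open>The simple root \<open>\<alpha> k\<close> belongs to the pair consisting of \<open>simple_fst k\<close> and \<open>simple_snd k\<close>.\<close>

definition simple_fst :: "nat \<Rightarrow> int" where
  "simple_fst k = (if k < l then int k else int l - 1)"

definition simple_snd :: "nat \<Rightarrow> int" where
  "simple_snd k = (if k < l then - (int k + 1) else int l)"

lemma simple_pair: "k \<in> {1..l} \<Longrightarrow> simple_fst k \<in> signed l \<and> simple_snd k \<in> signed l \<and>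
    simple_fst k \<noteq> simple_snd k \<and> simple_fst k \<noteq> - simple_snd k"
  using l4 by (auto simp: simple_fst_def simple_snd_def signed_def)

lemma simple_root_E:
  assumes k: "k \<in> {1..l}"
  shows "\<alpha> k = E (simple_fst k) + E (simple_snd k)"
proof (cases "k < l")
  case True
  have "E (- (int k + 1)) = - \<epsilon> (Suc k)" using E_uminus[of "int (Suc k)"] E_of_nat[of "Suc k"] by (simp add: add.commute)
  then show ?thesis using k True
    by (simp add: simple_fst_def simple_snd_def E_of_nat \<epsilon>_step fun_eq_iff)
next
  case False
  then have "k = l" using k by simp
  have e: "int l - 1 = int (l - 1)" using l4 by (simp add: of_nat_diff)
  have "E (int l - 1) = \<epsilon> (l - 1)" unfolding e using l4 by (intro E_of_nat) simp
  moreover have "\<epsilon> (l - 1) = (\<lambda>x. \<alpha> (l - 1) x + \<epsilon> l x)"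
    using \<epsilon>_step[of "l - 1"] l4 by (simp add: Suc_diff_le)
  ultimately show ?thesis using l4
    by (simp add: simple_fst_def simple_snd_def E_of_nat \<open>k = l\<close> \<epsilon>_def fun_eq_iff field_simps)
qed

lemma cor_Y:
  assumes k: "k \<in> {1..l}"
  shows "cor k = Y (simple_fst k) + Y (simple_snd k)"
proof (cases "k < l")
  case True
  have "Y (- (int k + 1)) = - \<eta> (Suc k)"
    by (simp add: Y_def sgn_if lie.scale_minus_left cscale_one add.commute nat_add_distrib)
  then show ?thesis using k True
    by (simp add: simple_fst_def simple_snd_def Y_def sgn_if cscale_one \<eta>_step)
next
  case False
  then have "k = l" using k by simp
  have e: "int l - 1 = int (l - 1)" using l4 by (simp add: of_nat_diff)
  have "Y (int l - 1) = \<eta> (l - 1)" unfolding e using l4 by (intro Y_of_nat) simp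
  moreover have "\<eta> (l - 1) = cor (l - 1) + \<eta> l"
    using \<eta>_step[of "l - 1"] l4 by (simp add: Suc_diff_le)
  moreover have "\<eta> l + \<eta> l = cor l - cor (l - 1)"
    by (simp add: \<eta>_def cscale_one flip: cscale_add_left)
  ultimately have "Y (simple_fst l) + Y (simple_snd l) = cor (l - 1) + (cor l - cor (l - 1))"
    using l4 by (simp add: simple_fst_def simple_snd_def Y_of_nat add.assoc)
  then show ?thesis by (simp add: \<open>k = l\<close>)
qed

text \<open>The effect of the reflection in the root \<open>{p, q}\<close> on signed indices.\<close>

definition reflect_index :: "int \<Rightarrow> int \<Rightarrow> int \<Rightarrow> int" where
  "reflect_index p q z = (if z = p then - q else if z = q then - p else if z = - p then q else if z = - q then p else z)"

lemma reflect_index_signed: "p \<in> signed l \<Longrightarrow> q \<in> signed l \<Longrightarrow> z \<in> signed l \<Longrightarrow> reflect_index p q z \<in> signed l"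
  by (simp add: reflect_index_def)

lemma reflect_index_uminus: "p \<noteq> 0 \<Longrightarrow> q \<noteq> 0 \<Longrightarrow> p \<noteq> q \<Longrightarrow> p \<noteq> - q \<Longrightarrow> reflect_index p q (- z) = - reflect_index p q z"
  by (auto simp: reflect_index_def)

lemma reflect_index_involutive: "p \<noteq> 0 \<Longrightarrow> q \<noteq> 0 \<Longrightarrow> p \<noteq> q \<Longrightarrow> p \<noteq> - q \<Longrightarrow> reflect_index p q (reflect_index p q z) = z"
  by (auto simp: reflect_index_def)

lemma E_reflect:
  assumes k: "k \<in> {1..l}" and z: "z \<in> signed l"
  shows "(\<lambda>x. E z x - E z (cor k) * \<alpha> k x) = E (reflect_index (simple_fst k) (simple_snd k) z)"
proof -
  let ?p = "simple_fst k" and ?q = "simple_snd k"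
  have pq: "?p \<in> signed l" "?q \<in> signed l" "?p \<noteq> ?q" "?p \<noteq> - ?q" using simple_pair[OF k] by auto
  have "E z (cor k) = E z (Y ?p) + E z (Y ?q)"
    unfolding cor_Y[OF k] using dual_linear(1)[OF E_dual[OF z]] Y_mem pq by simp
  then show ?thesis
    using pq z unfolding simple_root_E[OF k]
    by (auto simp: E_Y reflect_index_def fun_eq_iff E_uminus signed_def)
qed

lemma pair_reflect:
  assumes k: "k \<in> {1..l}" and z: "z \<in> signed l" "w \<in> signed l"
  shows "(\<lambda>x. (E z + E w) x - (E z + E w) (cor k) * \<alpha> k x) =
    E (reflect_index (simple_fst k) (simple_snd k) z) + E (reflect_index (simple_fst k) (simple_snd k) w)"
  unfolding E_reflect[OF k z(1), symmetric] E_reflect[OF k z(2), symmetric]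
  by (rule ext) (simp only: plus_fun_apply ring_distribs add_diff_add)

lemma pair_root_reflect:
  assumes k: "k \<in> {1..l}" and z: "z \<in> signed l" "w \<in> signed l" and r: "E z + E w \<in> roots H"
  shows "E (reflect_index (simple_fst k) (simple_snd k) z) + E (reflect_index (simple_fst k) (simple_snd k) w) \<in> roots H"
  using root_reflection[OF simple_root[OF k] r] unfolding pair_reflect[OF k z] .

text \<open>One reaches \<open>\<epsilon> i - \<epsilon> j\<close> from \<open>\<alpha> i\<close> by the simple reflections that move the second index to the right.
  From \<open>\<epsilon> i - \<epsilon> (l - 1)\<close> the last simple reflection leads to \<open>\<epsilon> i + \<epsilon> l\<close>, and then one moves back to the
  left.\<close>

lemma minus_pair_root:
  assumes "1 \<le> i" "i < j" "j \<le> l"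
  shows "E (int i) + E (- int j) \<in> roots H"
proof -
  have "Suc i \<le> j" using assms by simp
  then show ?thesis using assms(3)
  proof (induction j rule: dec_induct)
    case base
    have "\<alpha> i = E (int i) + E (- int (Suc i))"
      using simple_root_E[of i] assms(1) base by (simp add: simple_fst_def simple_snd_def add.commute)
    then show ?case using simple_root[of i] assms(1) base by (metis Suc_leD atLeastAtMost_iff)
  next
    case (step j)
    then have "E (int i) + E (- int j) \<in> roots H" by (meson Suc_leD)
    then have "E (reflect_index (simple_fst j) (simple_snd j) (int i)) + E (reflect_index (simple_fst j) (simple_snd j) (- int j)) \<in> roots H"
      using step(1,2,4) assms(1) by (intro pair_root_reflect) (assumption | simp add: signed_def)+
    moreover have "reflect_index (simple_fst j) (simple_snd j) (int i) = int i"
      "reflect_index (simple_fst j) (simple_snd j) (- int j) = - int (Suc j)"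
      using step(1,2,4) assms(1) by (auto simp: reflect_index_def simple_fst_def simple_snd_def)
    ultimately show ?case by (simp only:)
  qed
qed

lemma plus_pair_root:
  assumes "1 \<le> i" "i < j" "j \<le> l"
  shows "E (int i) + E (int j) \<in> roots H"
proof -
  have l: "E (int i) + E (int l) \<in> roots H" if il: "i < l"
  proof (cases "i = l - 1")
    case True
    then have "\<alpha> l = E (int i) + E (int l)"
      using simple_root_E[of l] l4 by (simp add: simple_fst_def simple_snd_def of_nat_diff)
    then show ?thesis using simple_root[of l] l4 by (metis One_nat_def Suc_leI assms(1) atLeastAtMost_iff il le_trans less_imp_le order_refl)
  next
    case False
    then have "E (int i) + E (- int (l - 1)) \<in> roots H" using il assms(1) by (intro minus_pair_root) auto
    then have "E (reflect_index (simple_fst l) (simple_snd l) (int i)) + E (reflect_index (simple_fst l) (simple_snd l) (- int (l - 1))) \<in> roots H"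
      using l4 assms(1) il by (intro pair_root_reflect) (auto simp: signed_def)
    moreover have "reflect_index (simple_fst l) (simple_snd l) (int i) = int i"
      "reflect_index (simple_fst l) (simple_snd l) (- int (l - 1)) = int l"
      using False il l4 assms(1) by (auto simp: reflect_index_def simple_fst_def simple_snd_def)
    ultimately show ?thesis by (simp only:)
  qed
  show ?thesis using assms(3,2)
  proof (induction j rule: inc_induct)
    case base
    then show ?case by (rule l)
  next
    case (step j)
    then have "E (int i) + E (int (Suc j)) \<in> roots H" by (meson Suc_lessD le_less_trans lessI less_SucI)
    then have "E (reflect_index (simple_fst j) (simple_snd j) (int i)) + E (reflect_index (simple_fst j) (simple_snd j) (int (Suc j))) \<in> roots H"
      using step(1,2,4) assms(1) by (intro pair_root_reflect) (assumption | simp add: signed_def)+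
    moreover have "reflect_index (simple_fst j) (simple_snd j) (int i) = int i"
      "reflect_index (simple_fst j) (simple_snd j) (int (Suc j)) = int j"
      using step(1,2,4) assms(1) by (auto simp: reflect_index_def simple_fst_def simple_snd_def)
    ultimately show ?case by (simp only:)
  qed
qed

lemma pair_root:
  assumes "x \<in> signed l" "y \<in> signed l" "x \<noteq> y" "x \<noteq> - y"
  shows "E x + E y \<in> roots H"
proof -
  have *: "E x + E y \<in> roots H" if xy: "x \<in> signed l" "y \<in> signed l" "\<bar>x\<bar> < \<bar>y\<bar>" for x y
  proof -
    define i j where "i = nat \<bar>x\<bar>" and "j = nat \<bar>y\<bar>"
    have ij: "1 \<le> i" "i < j" "j \<le> l" "x = int i \<or> x = - int i" "y = int j \<or> y = - int j"
      using xy by (auto simp: i_def j_def signed_def)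
    have "- (E (int i) + E (- int j)) \<in> roots H" "- (E (int i) + E (int j)) \<in> roots H"
      using minus_pair_root[OF ij(1-3)] plus_pair_root[OF ij(1-3)] uminus_root by blast+
    then have "E (- int i) + E (int j) \<in> roots H" "E (- int i) + E (- int j) \<in> roots H"
      by (simp_all add: E_uminus)
    then show ?thesis using minus_pair_root[OF ij(1-3)] plus_pair_root[OF ij(1-3)] ij(4,5) by auto
  qed
  have "\<bar>x\<bar> \<noteq> \<bar>y\<bar>" using assms by (auto simp: abs_eq_iff)
  then show ?thesis using *[of x y] *[of y x] assms by (force simp: add.commute)
qed

lemma comb_add: "comb a + comb b = comb (\<lambda>i. a i + b i)"
  by (simp add: comb_def fun_eq_iff sum.distrib algebra_simps)

lemma comb_eval: "comb a x = (\<Sum>i\<in>{1..l}. of_int (a i) * \<alpha> i x)"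
  by (simp add: comb_def)

lemma comb_coordinates: "comb a = (\<lambda>x. \<Sum>j\<in>{1..l}. comb a (\<eta> j) * \<epsilon> j x)"
proof -
  have simple: "\<alpha> k x = (\<Sum>j\<in>{1..l}. \<alpha> k (\<eta> j) * \<epsilon> j x)" if k: "k \<in> {1..l}" for k x
  proof (cases "k < l")
    case True
    have "(\<Sum>j\<in>{1..l}. \<alpha> k (\<eta> j) * \<epsilon> j x) =
        (\<Sum>j\<in>{1..l}. (if j = k then \<epsilon> j x else 0) - (if j = Suc k then \<epsilon> j x else 0))"
      using k True by (intro sum.cong) (auto simp: \<alpha>_\<eta>)
    also have "\<dots> = \<epsilon> k x - \<epsilon> (Suc k) x"
      using k True by (simp add: sum_subtractf)
    finally show ?thesis using True by (simp add: \<epsilon>_step)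
  next
    case False
    then have kl: "k = l" using k by simp
    have l1: "1 \<le> l - 1" using l4 by arith
    have "(\<Sum>j\<in>{1..l}. \<alpha> k (\<eta> j) * \<epsilon> j x) =
        (\<Sum>j\<in>{1..l}. (if j = l - 1 then \<epsilon> j x else 0) + (if j = l then \<epsilon> j x else 0))"
      using k kl l4 by (intro sum.cong) (auto simp: \<alpha>_\<eta>)
    also have "\<dots> = \<epsilon> (l - 1) x + \<epsilon> l x"
      using l4 l1 by (simp add: sum.distrib)
    also have "\<dots> = \<alpha> l x"
      using \<epsilon>_step[of "l - 1"] l4 by (simp add: \<epsilon>_def)
    finally show ?thesis using kl by simp
  qed
  show ?thesis
  proof (rule ext)
    fix x
    have "comb a x = (\<Sum>i\<in>{1..l}. of_int (a i) * (\<Sum>j\<in>{1..l}. \<alpha> i (\<eta> j) * \<epsilon> j x))"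
      unfolding comb_eval using simple by (intro sum.cong) auto
    also have "\<dots> = (\<Sum>j\<in>{1..l}. (\<Sum>i\<in>{1..l}. of_int (a i) * \<alpha> i (\<eta> j)) * \<epsilon> j x)"
      by (simp only: sum_distrib_left sum_distrib_right mult.assoc) (rule sum.swap)
    finally show "comb a x = (\<Sum>j\<in>{1..l}. comb a (\<eta> j) * \<epsilon> j x)" by (simp only: comb_eval)
  qed
qed

text \<open>The coordinates of a vector in the closed negative chamber increase, and the last two have
  nonpositive sum; as the first one is a coefficient, they vanish.\<close>

lemma no_antidominant_root:
  assumes a: "\<forall>i\<in>{1..l}. a i \<ge> 0" and \<beta>: "comb a \<in> roots H"
    and n: "\<And>j. j \<in> {1..l} \<Longrightarrow> comb a (cor j) = of_int (n j)" "\<And>j. j \<in> {1..l} \<Longrightarrow> n j \<le> 0"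
  shows False
proof -
  let ?v = "\<lambda>j. Re (comb a (\<eta> j))"
  have lin: "comb a (x + y) = comb a x + comb a y" if "x \<in> H" "y \<in> H" for x y
    using dual_linear(1)[OF roots_dual[OF \<beta>]] that .
  have st: "?v j \<le> ?v (Suc j)" if "j \<in> {1..<l}" for j
  proof -
    have "comb a (\<eta> j) = of_int (n j) + comb a (\<eta> (Suc j))"
      using that \<eta>_step[of j] lin[of "cor j" "\<eta> (Suc j)"] cor_mem[of j] \<eta>_mem[of "Suc j"] n(1)[of j] by simp
    then show ?thesis using n(2)[of j] that by simp
  qed
  have mono: "?v i \<le> ?v j" if "i \<le> j" "1 \<le> i" "j \<le> l" for i j
    using that
  proof (induction j rule: dec_induct)
    case (step j)
    then show ?case using st[of j] by force
  qed simp
  have "cor l = \<eta> (l - 1) + \<eta> l"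
  proof -
    have "\<eta> (l - 1) = cor (l - 1) + \<eta> l" using \<eta>_step[of "l - 1"] l4 by (simp add: Suc_diff_le)
    moreover have "\<eta> l + \<eta> l = cor l - cor (l - 1)"
      by (simp add: \<eta>_def cscale_one flip: cscale_add_left)
    ultimately show ?thesis by (simp add: add.assoc)
  qed
  then have "comb a (\<eta> (l - 1)) + comb a (\<eta> l) = of_int (n l)"
    using lin[of "\<eta> (l - 1)" "\<eta> l"] \<eta>_mem l4 n(1)[of l] by simp
  then have "?v (l - 1) + ?v l = of_int (n l)" by (metis Re_complex_of_real of_real_of_int_eq plus_complex.sel(1))
  then have last: "?v (l - 1) + ?v l \<le> 0" using n(2)[of l] l4 by simp
  have "comb a (\<eta> 1) = (\<Sum>i\<in>{1..l}. if i = 1 then of_int (a i) else 0)"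
    unfolding comb_eval using l4 by (intro sum.cong) (auto simp: \<alpha>_\<eta>)
  then have "?v 1 = of_int (a 1)" using l4 by simp
  then have "?v 1 \<ge> 0" using a l4 by simp
  \<comment> \<open>Now \<open>0 \<le> ?v 1 \<le> \<dots> \<le> ?v l\<close>, while the sum of the last two is at most \<open>0\<close>.\<close>
  have z: "?v j = 0" if "j \<in> {1..l}" for j
  proof -
    have l1: "1 \<le> l - 1" using l4 by arith
    have "0 \<le> ?v j" using mono[of 1 j] \<open>?v 1 \<ge> 0\<close> that by simp
    moreover have "?v (l - 1) \<ge> 0" "?v l \<ge> 0" using mono[of 1 "l - 1"] mono[of 1 l] \<open>?v 1 \<ge> 0\<close> l4 l1 by auto
    moreover have "?v j \<le> ?v l" using mono[of j l] that by simp
    ultimately show ?thesis using last by linarith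
  qed
  have real: "comb a (\<eta> j) = of_real (?v j)" if "j \<in> {1..l}" for j
  proof -
    have "\<alpha> i (\<eta> j) \<in> \<real>" if "i \<in> {1..l}" for i using \<alpha>_\<eta>[of i j] that \<open>j \<in> {1..l}\<close> by auto
    then have "comb a (\<eta> j) \<in> \<real>" unfolding comb_eval by (intro sum_in_Reals Reals_mult) auto
    then show ?thesis by (simp add: of_real_Re)
  qed
  have \<eta>0: "comb a (\<eta> j) = 0" if "j \<in> {1..l}" for j
    using real[OF that] z[OF that] by (metis of_real_0)
  have "comb a x = 0" for x
  proof -
    have "comb a x = (\<Sum>j\<in>{1..l}. comb a (\<eta> j) * \<epsilon> j x)"
      by (rule fun_cong[OF comb_coordinates[of a]])
    also have "\<dots> = 0" by (intro sum.neutral ballI) (simp only: \<eta>0 mult_zero_left)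
    finally show ?thesis .
  qed
  then have "comb a = 0" by (simp add: fun_eq_iff)
  then show False using roots_nonzero[OF \<beta>] by simp
qed

text \<open>Reflecting in a simple root \<open>\<alpha> j\<close> on whose coroot the root is positive lowers the height. The result is
  again nonnegative unless the root is a multiple of \<open>\<alpha> j\<close>, that is, equal to \<open>\<alpha> j\<close>.\<close>

lemma nonneg_root_pair:
  assumes "comb a \<in> roots H" "\<forall>i\<in>{1..l}. a i \<ge> 0"
  shows "\<exists>x y. x \<in> signed l \<and> y \<in> signed l \<and> x \<noteq> y \<and> x \<noteq> - y \<and> comb a = E x + E y"
  using assms
proof (induction "nat (\<Sum>i\<in>{1..l}. a i)" arbitrary: a rule: less_induct)
  case less
  have "\<exists>n::int. comb a (cor j) = of_int n" if "j \<in> {1..l}" for j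
    using root_integer[OF simple_root[OF that] less.prems(1)] .
  then obtain n where n: "\<And>j. j \<in> {1..l} \<Longrightarrow> comb a (cor j) = of_int (n j)" by metis
  obtain j where j: "j \<in> {1..l}" "n j > 0"
    using no_antidominant_root[OF less.prems(2,1) n] by force
  let ?b = "\<lambda>i. a i - (if i = j then n j else 0)"
  have b: "(\<lambda>x. comb a x - comb a (cor j) * \<alpha> j x) = comb ?b"
    using comb_diff[of a "\<lambda>i. if i = j then n j else 0"] comb_unit[OF j(1), of "n j"] n[OF j(1)]
    by (simp add: fun_eq_iff)
  have br: "comb ?b \<in> roots H" using root_reflection[OF simple_root[OF j(1)] less.prems(1)] unfolding b .
  show ?case
  proof (cases "\<exists>i\<in>{1..l}. i \<noteq> j \<and> a i > 0")
    case True
    then obtain i where i: "i \<in> {1..l}" "i \<noteq> j" "a i > 0" by auto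
    obtain c where c: "comb ?b = comb c" "(\<forall>i\<in>{1..l}. c i \<ge> 0) \<or> (\<forall>i\<in>{1..l}. c i \<le> 0)"
      using root_comb[OF br] .
    have ci: "c i = ?b i" if "i \<in> {1..l}" for i using comb_inj[OF c(1) that] by simp
    have "c i > 0" using ci[OF i(1)] i by simp
    then have "\<forall>i\<in>{1..l}. c i \<ge> 0" using c(2) i(1) by force
    then have bn: "\<forall>i\<in>{1..l}. ?b i \<ge> 0" using ci by simp
    have "(\<Sum>i\<in>{1..l}. ?b i) = (\<Sum>i\<in>{1..l}. a i) - n j" using j by (simp add: sum_subtractf)
    moreover have "(\<Sum>i\<in>{1..l}. ?b i) \<ge> 0" using bn by (intro sum_nonneg) auto
    ultimately have "nat (\<Sum>i\<in>{1..l}. ?b i) < nat (\<Sum>i\<in>{1..l}. a i)" using j(2) by simp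
    from less.hyps[OF this br bn] obtain x y where xy: "x \<in> signed l" "y \<in> signed l" "x \<noteq> y" "x \<noteq> - y" "comb ?b = E x + E y"
      by auto
    let ?p = "simple_fst j" and ?q = "simple_snd j"
    have pq: "?p \<in> signed l" "?q \<in> signed l" "?p \<noteq> ?q" "?p \<noteq> - ?q" "?p \<noteq> 0" "?q \<noteq> 0"
      using simple_pair[OF j(1)] by (auto simp: signed_def)
    have "\<alpha> j (cor j) = 2" using cartan_matrix[OF j(1) j(1)] by simp
    then have bc: "comb ?b (cor j) = - comb a (cor j)"
      using fun_cong[OF b, of "cor j"] by (simp add: algebra_simps)
    have "(\<lambda>x. comb ?b x - comb ?b (cor j) * \<alpha> j x) = comb a"
    proof (rule ext)
      fix x
      show "comb ?b x - comb ?b (cor j) * \<alpha> j x = comb a x"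
        unfolding bc using fun_cong[OF b, of x, symmetric]
        by (simp only: minus_mult_left[symmetric] diff_minus_eq_add eq_diff_eq)
    qed
    then have "comb a = E (reflect_index ?p ?q x) + E (reflect_index ?p ?q y)"
      by (simp only: xy(5) pair_reflect[OF j(1) xy(1,2)])
    moreover have "reflect_index ?p ?q x \<noteq> reflect_index ?p ?q y" "reflect_index ?p ?q x \<noteq> - reflect_index ?p ?q y"
      using reflect_index_involutive[OF pq(5,6,3,4)] reflect_index_uminus[OF pq(5,6,3,4)] xy(3,4) by metis+
    ultimately show ?thesis using reflect_index_signed[OF pq(1,2)] xy(1,2) by blast
  next
    case False
    then have "a i = 0" if "i \<in> {1..l}" "i \<noteq> j" for i using less.prems(2) that by force
    then have "comb a = comb (\<lambda>i. if i = j then a j else 0)" by (auto simp: comb_def intro!: sum.cong)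
    then have aj: "comb a = (\<lambda>x. of_int (a j) * \<alpha> j x)" by (simp only: comb_unit[OF j(1)])
    have "a j \<noteq> 0" using aj roots_nonzero[OF less.prems(1)] by (auto simp: fun_eq_iff)
    moreover have "\<not> a j \<ge> 2"
    proof
      assume "a j \<ge> 2"
      then have "comb a = (\<lambda>x. of_nat (nat (a j)) * \<alpha> j x)" "nat (a j) \<ge> 2" by (simp_all add: aj)
      then show False using multiple_not_root[OF simple_root[OF j(1)]] less.prems(1) by metis
    qed
    moreover have "a j \<ge> 0" using less.prems(2) j(1) by simp
    ultimately have "a j = 1" by simp
    then have "comb a = \<alpha> j" using aj by simp
    then show ?thesis using simple_root_E[OF j(1)] simple_pair[OF j(1)] by metis
  qed
qed

theorem roots_eq: "roots H = root_of ` signed_pairs l"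
proof
  show "roots H \<subseteq> root_of ` signed_pairs l"
  proof
    fix \<gamma> assume \<gamma>: "\<gamma> \<in> roots H"
    obtain a where a: "\<gamma> = comb a" "(\<forall>i\<in>{1..l}. a i \<ge> 0) \<or> (\<forall>i\<in>{1..l}. a i \<le> 0)"
      using root_comb[OF \<gamma>] .
    have "\<exists>x y. x \<in> signed l \<and> y \<in> signed l \<and> x \<noteq> y \<and> x \<noteq> - y \<and> \<gamma> = E x + E y"
      using a(2)
    proof
      assume "\<forall>i\<in>{1..l}. a i \<ge> 0"
      then show ?thesis using nonneg_root_pair[of a] \<gamma> a(1) by auto
    next
      assume a0: "\<forall>i\<in>{1..l}. a i \<le> 0"
      have m: "- \<gamma> = comb (\<lambda>i. - a i)" by (simp add: a(1) comb_def fun_eq_iff sum_negf)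
      obtain x y where xy: "x \<in> signed l" "y \<in> signed l" "x \<noteq> y" "x \<noteq> - y" "- \<gamma> = E x + E y"
        using nonneg_root_pair[of "\<lambda>i. - a i"] uminus_root[OF \<gamma>] a0 unfolding m by auto
      have "\<gamma> = - (E x + E y)" using xy(5) by (metis minus_minus)
      then have "\<gamma> = E (- x) + E (- y)" by (simp add: E_uminus)
      then show ?thesis using xy by (intro exI[of _ "- x"] exI[of _ "- y"]) auto
    qed
    then show "\<gamma> \<in> root_of ` signed_pairs l"
      using root_of_pair pair_mem_signed_pairs by (metis image_eqI)
  qed
  show "root_of ` signed_pairs l \<subseteq> roots H"
    using pair_root root_of_pair by (auto elim!: signed_pairsE)
qed

lemma root_of_\<eta>:
  assumes "S \<in> signed_pairs l" "j \<in> {1..l}"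
  shows "root_of S (\<eta> j) = of_int (coord S (int j))"
  using assms(1)
proof (rule signed_pairsE)
  fix x y assume "S = {x, y}" "x \<in> signed l" "y \<in> signed l" "x \<noteq> y" "x \<noteq> - y"
  then show ?thesis
    using assms(2) by (auto simp: root_of_pair E_\<eta> coord_def)
qed

lemma coord_uminus: "coord S (- a) = - coord S a"
  by (simp add: coord_def)

lemma coord_eqI:
  assumes "\<And>j. j \<in> {1..l} \<Longrightarrow> f (int j) = (g (int j) :: int)"
    "\<And>a. f (- a) = - f a" "\<And>a. g (- a) = - g a" "a \<in> signed l"
  shows "f a = g a"
proof -
  obtain j where "j \<in> {1..l}" "a = int j \<or> a = - int j"
    using assms(4) by (intro that[of "nat \<bar>a\<bar>"]) (auto simp: signed_def)
  then show ?thesis using assms(1-3) by auto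
qed

lemma inj_root_of: "inj_on root_of (signed_pairs l)"
proof (rule inj_onI)
  fix S T assume S: "S \<in> signed_pairs l" and T: "T \<in> signed_pairs l" and eq: "root_of S = root_of T"
  have "coord S a = coord T a" if "a \<in> signed l" for a
    using _ _ _ that
  proof (rule coord_eqI)
    fix j assume j: "j \<in> {1..l}"
    show "coord S (int j) = coord T (int j)"
      using root_of_\<eta>[OF S j] root_of_\<eta>[OF T j] eq by simp
  qed (simp_all add: coord_uminus)
  moreover have "coord U a = 1 \<longleftrightarrow> a \<in> U" if "U \<in> signed_pairs l" "a \<in> signed l" for U a
    using that(1) that(2) by (auto elim!: signed_pairsE simp: coord_def signed_def)
  moreover have "S \<subseteq> signed l" "T \<subseteq> signed l" using S T by (auto elim!: signed_pairsE)
  ultimately show "S = T" using S T by (metis subset_antisym subset_iff)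
qed

lemma root_of_sum:
  assumes "S \<in> signed_pairs l" "T \<in> signed_pairs l" "U \<in> signed_pairs l"
    and sum: "root_of S + root_of T = root_of U"
  obtains x y z where "S = {x, y}" "T = {- y, z}" "U = {x, z}"
proof (rule signed_pairs_sum[OF assms(1-3)])
  fix a assume a: "a \<in> signed l"
  show "coord S a + coord T a = coord U a"
    using _ _ _ a
  proof (rule coord_eqI)
    fix j assume j: "j \<in> {1..l}"
    have "of_int (coord S (int j) + coord T (int j)) = (of_int (coord U (int j)) :: complex)"
      using fun_cong[OF sum, of "\<eta> j"]
      by (simp only: plus_fun_apply of_int_add root_of_\<eta>[OF assms(1) j] root_of_\<eta>[OF assms(2) j]
          root_of_\<eta>[OF assms(3) j])
    then show "coord S (int j) + coord T (int j) = coord U (int j)" by (simp only: of_int_eq_iff)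
  qed (simp_all add: coord_uminus)
qed

end

context lie_cartan
begin

section \<open>Ideals as sets of roots\<close>

text \<open>The nontrivial direction uses that root spaces whose roots add up to a root do not commute.\<close>

lemma abelian_root_ideal_iff:
  assumes "\<Phi> \<subseteq> roots H" "\<And>\<beta> \<gamma>. \<beta> \<in> \<Phi> \<Longrightarrow> \<gamma> \<in> \<Phi> \<Longrightarrow> \<beta> + \<gamma> \<noteq> 0"
  shows "abelian (root_ideal H \<Phi>) \<longleftrightarrow> (\<forall>\<beta>\<in>\<Phi>. \<forall>\<gamma>\<in>\<Phi>. \<beta> + \<gamma> \<notin> roots H)"
proof
  assume ab: "abelian (root_ideal H \<Phi>)"
  show "\<forall>\<beta>\<in>\<Phi>. \<forall>\<gamma>\<in>\<Phi>. \<beta> + \<gamma> \<notin> roots H"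
  proof (intro ballI notI)
    fix \<beta> \<gamma> assume \<Phi>: "\<beta> \<in> \<Phi>" "\<gamma> \<in> \<Phi>" "\<beta> + \<gamma> \<in> roots H"
    then obtain x y where xy: "x \<in> root_space H \<beta>" "y \<in> root_space H \<gamma>" "bracket x y \<noteq> 0"
      using bracket_root_spaces_nonzero[of \<beta> \<gamma>] assms(1) by blast
    have "x \<in> root_ideal H \<Phi>" "y \<in> root_ideal H \<Phi>"
      unfolding root_ideal_def using xy \<Phi> by (auto intro!: lie.span_base)
    then show False using ab xy(3) by (simp add: abelian_def)
  qed
next
  assume no: "\<forall>\<beta>\<in>\<Phi>. \<forall>\<gamma>\<in>\<Phi>. \<beta> + \<gamma> \<notin> roots H"
  let ?V = "\<Union>\<gamma>\<in>\<Phi>. root_space H \<gamma>"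
  have 0: "bracket x y = 0" if "x \<in> ?V" "y \<in> ?V" for x y
  proof (rule ccontr)
    assume ne: "bracket x y \<noteq> 0"
    obtain \<beta> \<gamma> where \<Phi>: "\<beta> \<in> \<Phi>" "\<gamma> \<in> \<Phi>" "x \<in> root_space H \<beta>" "y \<in> root_space H \<gamma>" using \<open>x \<in> ?V\<close> \<open>y \<in> ?V\<close> by auto
    have "\<beta> + \<gamma> \<in> insert 0 (roots H)"
      using bracket_root_space[OF \<Phi>(3,4)] ne \<Phi>(1,2) assms(1)
      by (intro root_or_zeroI[of "bracket x y"] add_dual roots_dual) auto
    then show False using no \<Phi>(1,2) assms(2) by auto
  qed
  have 1: "bracket x y \<in> {0}" if "x \<in> ?V" "y \<in> cspan ?V" for x y
    by (rule bracket_mem_span[OF _ lie.subspace_single_0 that(2)]) (simp only: 0[OF that(1)] singleton_iff)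
  have "bracket (- x) y \<in> {0}" if "x \<in> cspan ?V" "y \<in> cspan ?V" for x y
  proof (rule bracket_mem_span[OF _ lie.subspace_single_0 that(2)])
    fix z assume "z \<in> ?V"
    from 1[OF this that(1)] show "bracket (- x) z \<in> {0}"
      using bracket_antisym[of z x] by (simp add: bracket_minus_left)
  qed
  then show "abelian (root_ideal H \<Phi>)"
    by (auto simp: abelian_def root_ideal_def bracket_minus_left)
qed

end

text \<open>The weight function \<open>W\<close> stands for an element of the Cartan subalgebra on which the simple roots
  in \<open>I\<close>, whose indices form \<open>J\<close>, vanish and the others have the value \<open>2\<close>, so that the roots of
  \<open>\<pp>\<^sub>I\<close> are those of nonnegative weight.\<close>

definition is_weight :: "nat \<Rightarrow> nat set \<Rightarrow> (int \<Rightarrow> int) \<Rightarrow> bool" where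
  "is_weight l J W \<longleftrightarrow> (\<forall>z. W (- z) = - W z) \<and>
     (\<forall>k\<in>{1..<l}. W (int k) - W (int k + 1) = (if k \<in> J then 0 else 2)) \<and>
     W (int l - 1) + W (int l) = (if l \<in> J then 0 else 2)"

text \<open>In the third condition, \<open>{- y, z}\<close> is the root that is added to \<open>{x, y}\<close>.\<close>

definition abelian_pair_ideals :: "(int \<Rightarrow> int) \<Rightarrow> nat \<Rightarrow> int set set set" where
  "abelian_pair_ideals W l = {\<Psi>. \<Psi> \<subseteq> signed_pairs l \<and> (\<forall>S\<in>\<Psi>. sum W S > 0) \<and>
     (\<forall>x y z. {x, y} \<in> \<Psi> \<longrightarrow> {- y, z} \<in> signed_pairs l \<longrightarrow> {x, z} \<in> signed_pairs l \<longrightarrow>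
        W y \<le> W z \<longrightarrow> {x, z} \<in> \<Psi>) \<and>
     (\<forall>x y z. {x, y} \<in> \<Psi> \<longrightarrow> {- y, z} \<in> \<Psi> \<longrightarrow> {x, z} \<notin> signed_pairs l)}"

context type_D
begin

lemma weight_root_of:
  assumes J: "J \<subseteq> {1..l}" and W: "is_weight l J W" and S: "S \<in> signed_pairs l" and a: "root_of S = comb a"
  shows "sum W S = 2 * (\<Sum>i\<in>{1..l} - J. a i)"
proof -
  have odd: "W (- z) = - W z" for z using W by (simp add: is_weight_def)
  define L where "L f = (\<Sum>j\<in>{1..l}. of_int (W (int j)) * f (\<eta> j))" for f :: "'g \<Rightarrow> complex"
  have LE: "L (E z) = of_int (W z)" if z: "z \<in> signed l" for z
  proof -
    define k where "k = nat \<bar>z\<bar>"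
    have k: "k \<in> {1..l}" using z by (auto simp: signed_def k_def)
    have zk: "z = int k \<or> z = - int k" by (auto simp: k_def)
    have "L (E z) = (\<Sum>j\<in>{1..l}. if j = k then of_int (W z) else 0)"
      unfolding L_def using zk k z by (intro sum.cong) (auto simp: E_\<eta> odd)
    then show ?thesis using k by simp
  qed
  have Ladd: "L (\<lambda>x. f x + g x) = L f + L g" for f g
    by (simp add: L_def sum.distrib algebra_simps)
  have Lpair: "L (root_of {x, y}) = of_int (W x + W y)" if "x \<noteq> y" "x \<in> signed l" "y \<in> signed l" for x y
  proof -
    have "L (root_of {x, y}) = L (E x) + L (E y)"
      unfolding root_of_def using that(1) by (simp add: Ladd)
    then show ?thesis using LE that by simp
  qed
  obtain x y where xy: "S = {x, y}" "x \<in> signed l" "y \<in> signed l" "x \<noteq> y" "x \<noteq> - y"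
    using S by (rule signed_pairsE)
  have "L (\<alpha> i) = (if i \<in> J then 0 else 2)" if i: "i \<in> {1..l}" for i
  proof -
    have pq: "simple_fst i \<in> signed l" "simple_snd i \<in> signed l" "simple_fst i \<noteq> simple_snd i"
      using simple_pair[OF i] by auto
    have "L (\<alpha> i) = of_int (W (simple_fst i) + W (simple_snd i))"
      unfolding simple_root_E[OF i] using Lpair[OF pq(3,1,2)] root_of_pair[OF pq(3)] by simp
    also have "W (simple_fst i) + W (simple_snd i) = (if i \<in> J then 0 else 2)"
    proof (cases "i < l")
      case True
      then have "W (simple_fst i) + W (simple_snd i) = W (int i) - W (int i + 1)"
        using odd[of "int i + 1"] by (simp add: simple_fst_def simple_snd_def)
      then show ?thesis using W True i by (simp add: is_weight_def)
    next
      case False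
      then have "i = l" using i by simp
      then show ?thesis using W by (simp add: is_weight_def simple_fst_def simple_snd_def)
    qed
    finally show ?thesis by simp
  qed
  then have La: "of_int (a i) * L (\<alpha> i) = (if i \<in> J then 0 else of_int (2 * a i))" if "i \<in> {1..l}" for i
    using that by simp
  have "of_int (sum W S) = L (comb a)" using Lpair[OF xy(4,2,3)] xy(1,4) a by simp
  also have "\<dots> = (\<Sum>i\<in>{1..l}. of_int (a i) * L (\<alpha> i))"
    unfolding L_def comb_eval sum_distrib_left by (subst sum.swap) (simp add: mult.left_commute)
  also have "\<dots> = (\<Sum>i\<in>{1..l}. if i \<in> J then 0 else of_int (2 * a i))"
    by (rule sum.cong[OF refl La])
  also have "\<dots> = (\<Sum>i\<in>{1..l} - J. of_int (2 * a i))"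
    by (rule sum.mono_neutral_cong_right) auto
  also have "\<dots> = of_int (2 * (\<Sum>i\<in>{1..l} - J. a i))"
    by (simp add: sum_distrib_left)
  finally show ?thesis by (simp only: of_int_eq_iff)
qed

text \<open>The weight is twice the sum of the coefficients outside \<open>J\<close>, and all coefficients of a root have the
  same sign. So a negative root has nonnegative weight only if its coefficients outside \<open>J\<close> vanish.\<close>

lemma parabolic_roots:
  assumes J: "J \<subseteq> {1..l}" and W: "is_weight l J W" and S: "S \<in> signed_pairs l"
  shows parabolic_root_iff: "root_of S \<in> pos_roots H (\<alpha> ` {1..l}) \<union> sub_roots H (\<alpha> ` J) \<longleftrightarrow> sum W S \<ge> 0"
    and nilradical_root_iff: "root_of S \<in> pos_roots H (\<alpha> ` {1..l}) - sub_roots H (\<alpha> ` J) \<longleftrightarrow> sum W S > 0"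
proof -
  have r: "root_of S \<in> roots H" using S roots_eq by auto
  obtain a where a: "root_of S = comb a" "(\<forall>i\<in>{1..l}. a i \<ge> 0) \<or> (\<forall>i\<in>{1..l}. a i \<le> 0)"
    using root_comb[OF r] .
  have w: "sum W S = 2 * (\<Sum>i\<in>{1..l} - J. a i)" by (rule weight_root_of[OF J W S a(1)])
  have pos: "root_of S \<in> pos_roots H (\<alpha> ` {1..l}) \<longleftrightarrow> (\<forall>i\<in>{1..l}. a i \<ge> 0)"
  proof
    assume "root_of S \<in> pos_roots H (\<alpha> ` {1..l})"
    then obtain b where b: "root_of S = comb b" "\<forall>i\<in>{1..l}. b i \<ge> 0"
      unfolding pos_roots_def Int_iff nat_span_simple by blast
    have "comb a = comb b" using a(1) b(1) by simp
    then show "\<forall>i\<in>{1..l}. a i \<ge> 0" using comb_inj[of a b] b(2) by simp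
  qed (use r a(1) in \<open>auto simp: pos_roots_def nat_span_simple\<close>)
  have sub: "root_of S \<in> sub_roots H (\<alpha> ` J) \<longleftrightarrow> (\<forall>i\<in>{1..l} - J. a i = 0)"
  proof
    assume "root_of S \<in> sub_roots H (\<alpha> ` J)"
    then obtain b where b: "root_of S = comb b" "\<forall>i\<in>{1..l} - J. b i = 0"
      unfolding sub_roots_def Int_iff int_span_simple[OF J] by blast
    have "comb a = comb b" using a(1) b(1) by simp
    then show "\<forall>i\<in>{1..l} - J. a i = 0" using comb_inj[of a b] b(2) by simp
  next
    assume "\<forall>i\<in>{1..l} - J. a i = 0"
    then show "root_of S \<in> sub_roots H (\<alpha> ` J)"
      unfolding sub_roots_def Int_iff int_span_simple[OF J] using r a(1) by blast
  qed
  have "(root_of S \<in> pos_roots H (\<alpha> ` {1..l}) \<union> sub_roots H (\<alpha> ` J) \<longleftrightarrow> sum W S \<ge> 0) \<and>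
    (root_of S \<in> pos_roots H (\<alpha> ` {1..l}) - sub_roots H (\<alpha> ` J) \<longleftrightarrow> sum W S > 0)"
  proof (cases "\<forall>i\<in>{1..l}. a i \<ge> 0")
    case True
    then have "(\<Sum>i\<in>{1..l} - J. a i) \<ge> 0" by (intro sum_nonneg) auto
    moreover have "(\<Sum>i\<in>{1..l} - J. a i) = 0 \<longleftrightarrow> (\<forall>i\<in>{1..l} - J. a i = 0)"
      using True by (intro sum_nonneg_eq_0_iff) auto
    ultimately show ?thesis unfolding Un_iff Diff_iff pos sub w using True by linarith
  next
    case False
    then have a0: "\<forall>i\<in>{1..l}. a i \<le> 0" using a(2) by blast
    then have "(\<Sum>i\<in>{1..l} - J. - a i) \<ge> 0" by (intro sum_nonneg) auto
    moreover have "(\<Sum>i\<in>{1..l} - J. - a i) = 0 \<longleftrightarrow> (\<forall>i\<in>{1..l} - J. - a i = 0)"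
      using a0 by (intro sum_nonneg_eq_0_iff) auto
    moreover have "(\<Sum>i\<in>{1..l} - J. - a i) = - (\<Sum>i\<in>{1..l} - J. a i)" by (rule sum_negf)
    moreover have "(\<forall>i\<in>{1..l} - J. - a i = 0) \<longleftrightarrow> (\<forall>i\<in>{1..l} - J. a i = 0)" by simp
    ultimately show ?thesis unfolding Un_iff Diff_iff pos sub w using False by linarith
  qed
  then show "root_of S \<in> pos_roots H (\<alpha> ` {1..l}) \<union> sub_roots H (\<alpha> ` J) \<longleftrightarrow> sum W S \<ge> 0"
    "root_of S \<in> pos_roots H (\<alpha> ` {1..l}) - sub_roots H (\<alpha> ` J) \<longleftrightarrow> sum W S > 0" by blast+
qed

text \<open>Adding a root to the root \<open>{x, y}\<close> means to replace one of its indices, and the weight of the root that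
  is added is the difference of the weights of the two indices.\<close>

lemma abelian_ideal_sets_iff:
  assumes J: "J \<subseteq> {1..l}" and W: "is_weight l J W" and \<Psi>: "\<Psi> \<subseteq> signed_pairs l"
  shows "root_of ` \<Psi> \<in> abelian_ideal_sets H (\<alpha> ` {1..l}) (\<alpha> ` J) \<longleftrightarrow> \<Psi> \<in> abelian_pair_ideals W l"
proof -
  let ?P = "pos_roots H (\<alpha> ` {1..l})" and ?S = "sub_roots H (\<alpha> ` J)"
  have odd: "W (- z) = - W z" for z using W by (simp add: is_weight_def)
  have mem: "root_of S \<in> root_of ` \<Psi> \<longleftrightarrow> S \<in> \<Psi>" if "S \<in> signed_pairs l" for S
    using inj_root_of \<Psi> that by (auto simp: inj_on_def)
  have pairW: "sum W {x, y} = W x + W y" if "{x, y} \<in> signed_pairs l" for x y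
    using that by (simp add: pair_mem_signed_pairs)
  have add: "root_of {x, y} + root_of {- y, z} = root_of {x, z}"
    if "{x, y} \<in> signed_pairs l" "{- y, z} \<in> signed_pairs l" "{x, z} \<in> signed_pairs l" for x y z
    using that by (simp add: pair_mem_signed_pairs root_of_pair E_uminus)
  have Psub: "?P \<subseteq> roots H" "?S \<subseteq> roots H" by (auto simp: pos_roots_def sub_roots_def)
  have 1: "root_of ` \<Psi> \<subseteq> ?P - ?S \<longleftrightarrow> (\<forall>S\<in>\<Psi>. sum W S > 0)"
    unfolding image_subset_iff using nilradical_root_iff[OF J W] \<Psi> by blast
  show ?thesis
  proof (cases "\<forall>S\<in>\<Psi>. sum W S > 0")
    case False
    then show ?thesis
      unfolding abelian_ideal_sets_def ideal_sets_def abelian_pair_ideals_def mem_Collect_eq 1 by blast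
  next
    case pos: True
    have 2: "(\<forall>\<beta>\<in>root_of ` \<Psi>. \<forall>\<gamma>\<in>?P \<union> ?S. \<beta> + \<gamma> \<in> ?P \<longrightarrow> \<beta> + \<gamma> \<in> root_of ` \<Psi>) \<longleftrightarrow>
        (\<forall>x y z. {x, y} \<in> \<Psi> \<longrightarrow> {- y, z} \<in> signed_pairs l \<longrightarrow> {x, z} \<in> signed_pairs l \<longrightarrow>
          W y \<le> W z \<longrightarrow> {x, z} \<in> \<Psi>)" (is "?L \<longleftrightarrow> ?R")
    proof
      assume L: ?L
      show ?R
      proof (intro allI impI)
        fix x y z assume xyz: "{x, y} \<in> \<Psi>" "{- y, z} \<in> signed_pairs l" "{x, z} \<in> signed_pairs l" "W y \<le> W z"
        have xy: "{x, y} \<in> signed_pairs l" using xyz(1) \<Psi> by auto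
        have "root_of {- y, z} \<in> ?P \<union> ?S"
          unfolding parabolic_root_iff[OF J W xyz(2)] pairW[OF xyz(2)] using xyz(4) odd by simp
        moreover have "W x + W y > 0" using pos xyz(1) pairW[OF xy] by force
        then have "root_of {x, z} \<in> ?P - ?S"
          unfolding nilradical_root_iff[OF J W xyz(3)] pairW[OF xyz(3)] using xyz(4) by simp
        ultimately have "root_of {x, z} \<in> root_of ` \<Psi>"
          using L xyz(1) add[OF xy xyz(2,3)] by (metis DiffD1 imageI)
        then show "{x, z} \<in> \<Psi>" using mem[OF xyz(3)] by simp
      qed
    next
      assume R: ?R
      show ?L
      proof (intro ballI impI)
        fix \<beta> \<gamma> assume \<beta>: "\<beta> \<in> root_of ` \<Psi>" and \<gamma>: "\<gamma> \<in> ?P \<union> ?S" and sum: "\<beta> + \<gamma> \<in> ?P"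
        obtain S where S: "S \<in> \<Psi>" "\<beta> = root_of S" using \<beta> by auto
        obtain T where T: "T \<in> signed_pairs l" "\<gamma> = root_of T" using \<gamma> Psub roots_eq by blast
        obtain U where U: "U \<in> signed_pairs l" "\<beta> + \<gamma> = root_of U" using sum Psub roots_eq by blast
        have S': "S \<in> signed_pairs l" using S(1) \<Psi> by auto
        obtain x y z where xyz: "S = {x, y}" "T = {- y, z}" "U = {x, z}"
          using root_of_sum[OF S' T(1) U(1)] S(2) T(2) U(2) by metis
        have "W y \<le> W z"
          using \<gamma> parabolic_root_iff[OF J W T(1)] pairW[of "- y" z] T xyz odd[of y] by simp
        then have "U \<in> \<Psi>" using R S(1) T(1) U(1) unfolding xyz by blast
        then show "\<beta> + \<gamma> \<in> root_of ` \<Psi>" using U(2) by simp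
      qed
    qed
    have 3: "abelian (root_ideal H (root_of ` \<Psi>)) \<longleftrightarrow>
        (\<forall>\<beta>\<in>root_of ` \<Psi>. \<forall>\<gamma>\<in>root_of ` \<Psi>. \<beta> + \<gamma> \<notin> roots H)"
    proof (rule abelian_root_ideal_iff)
      show "root_of ` \<Psi> \<subseteq> roots H" using \<Psi> roots_eq by auto
      fix \<beta> \<gamma> assume "\<beta> \<in> root_of ` \<Psi>" "\<gamma> \<in> root_of ` \<Psi>"
      then have "\<beta> \<in> ?P - ?S" "\<gamma> \<in> ?P - ?S" using 1 pos by blast+
      then obtain a b where ab: "\<beta> = comb a" "\<forall>i\<in>{1..l}. a i \<ge> 0" "\<gamma> = comb b" "\<forall>i\<in>{1..l}. b i \<ge> 0"
        unfolding pos_roots_def Diff_iff Int_iff nat_span_simple by blast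
      show "\<beta> + \<gamma> \<noteq> 0"
      proof
        assume "\<beta> + \<gamma> = 0"
        then have "comb (\<lambda>i. a i + b i) = 0" using comb_add[of a b] ab by simp
        then have "a i = 0" if "i \<in> {1..l}" for i using comb_zero[of _ i] ab(2,4) that by force
        then have "comb a = comb (\<lambda>i. 0)" by (simp add: comb_def)
        then have "\<beta> = 0" using ab(1) by (simp add: comb_def fun_eq_iff)
        then show False using \<open>\<beta> \<in> ?P - ?S\<close> Psub roots_nonzero by blast
      qed
    qed
    have 4: "(\<forall>\<beta>\<in>root_of ` \<Psi>. \<forall>\<gamma>\<in>root_of ` \<Psi>. \<beta> + \<gamma> \<notin> roots H) \<longleftrightarrow>
        (\<forall>x y z. {x, y} \<in> \<Psi> \<longrightarrow> {- y, z} \<in> \<Psi> \<longrightarrow> {x, z} \<notin> signed_pairs l)" (is "?L \<longleftrightarrow> ?R")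
    proof
      assume L: ?L
      show ?R
      proof (intro allI impI notI)
        fix x y z assume xyz: "{x, y} \<in> \<Psi>" "{- y, z} \<in> \<Psi>" "{x, z} \<in> signed_pairs l"
        then have "root_of {x, y} + root_of {- y, z} = root_of {x, z}" using \<Psi> by (intro add) auto
        moreover have "root_of {x, z} \<in> roots H" using xyz(3) roots_eq by auto
        ultimately show False using L xyz(1,2) by (metis imageI)
      qed
    next
      assume R: ?R
      show ?L
      proof (intro ballI notI)
        fix \<beta> \<gamma> assume \<beta>: "\<beta> \<in> root_of ` \<Psi>" and \<gamma>: "\<gamma> \<in> root_of ` \<Psi>" and sum: "\<beta> + \<gamma> \<in> roots H"
        obtain S where S: "S \<in> \<Psi>" "\<beta> = root_of S" using \<beta> by auto
        obtain T where T: "T \<in> \<Psi>" "\<gamma> = root_of T" using \<gamma> by auto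
        obtain U where U: "U \<in> signed_pairs l" "\<beta> + \<gamma> = root_of U" using sum roots_eq by blast
        have S': "S \<in> signed_pairs l" "T \<in> signed_pairs l" using S(1) T(1) \<Psi> by auto
        obtain x y z where xyz: "S = {x, y}" "T = {- y, z}" "U = {x, z}"
          using root_of_sum[OF S' U(1)] S(2) T(2) U(2) by metis
        then show False using R S(1) T(1) U(1) by blast
      qed
    qed
    show ?thesis
      unfolding abelian_ideal_sets_def ideal_sets_def abelian_pair_ideals_def mem_Collect_eq 1 2 3 4
      using \<Psi> by blast
  qed
qed

theorem card_abelian_ideal_sets:
  assumes J: "J \<subseteq> {1..l}" and W: "is_weight l J W"
  shows "card (abelian_ideal_sets H (\<alpha> ` {1..l}) (\<alpha> ` J)) = card (abelian_pair_ideals W l)"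
proof -
  have sub: "abelian_pair_ideals W l \<subseteq> Pow (signed_pairs l)" by (auto simp: abelian_pair_ideals_def)
  have "inj_on (image root_of) (abelian_pair_ideals W l)"
    using inj_on_image_Pow[OF inj_root_of] sub by (rule inj_on_subset)
  moreover have "image root_of ` abelian_pair_ideals W l = abelian_ideal_sets H (\<alpha> ` {1..l}) (\<alpha> ` J)"
  proof
    show "image root_of ` abelian_pair_ideals W l \<subseteq> abelian_ideal_sets H (\<alpha> ` {1..l}) (\<alpha> ` J)"
      using abelian_ideal_sets_iff[OF J W] sub by blast
    show "abelian_ideal_sets H (\<alpha> ` {1..l}) (\<alpha> ` J) \<subseteq> image root_of ` abelian_pair_ideals W l"
    proof
      fix \<Phi> assume \<Phi>: "\<Phi> \<in> abelian_ideal_sets H (\<alpha> ` {1..l}) (\<alpha> ` J)"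
      then have "\<Phi> \<subseteq> root_of ` signed_pairs l"
        unfolding roots_eq[symmetric] by (auto simp: abelian_ideal_sets_def ideal_sets_def pos_roots_def)
      then obtain \<Psi> where "\<Psi> \<subseteq> signed_pairs l" "\<Phi> = root_of ` \<Psi>" by (auto simp: subset_image_iff)
      then show "\<Phi> \<in> image root_of ` abelian_pair_ideals W l"
        using \<Phi> abelian_ideal_sets_iff[OF J W] by blast
    qed
  qed
  ultimately show ?thesis by (metis card_image)
qed

end

section \<open>Threshold sets\<close>

definition pairs :: "'v set \<Rightarrow> 'v set set" where
  "pairs V = {{x, y} |x y. x \<in> V \<and> y \<in> V \<and> x \<noteq> y}"

text \<open>These are the threshold graphs in which the vertices are ranked by \<open>b\<close>, small ranks having large
  neighbourhoods.\<close>

definition threshold_sets :: "('v \<Rightarrow> nat) \<Rightarrow> 'v set \<Rightarrow> 'v set set set" where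
  "threshold_sets b V = {\<Phi>. \<Phi> \<subseteq> pairs V \<and>
     (\<forall>x y z. {x, y} \<in> \<Phi> \<longrightarrow> z \<in> V \<longrightarrow> z \<noteq> x \<longrightarrow> b z \<le> b y \<longrightarrow> {x, z} \<in> \<Phi>)}"

lemma pair_mem_pairs: "{x, y} \<in> pairs V \<longleftrightarrow> x \<in> V \<and> y \<in> V \<and> x \<noteq> y"
  unfolding pairs_def by (auto simp: doubleton_eq_iff)

lemma pairsE:
  assumes "S \<in> pairs V"
  obtains x y where "S = {x, y}" "x \<in> V" "y \<in> V" "x \<noteq> y"
  using assms unfolding pairs_def by auto

lemma pairs_mono: "V \<subseteq> V' \<Longrightarrow> pairs V \<subseteq> pairs V'"
  unfolding pairs_def by blast

lemma finite_pairs: "finite V \<Longrightarrow> finite (pairs V)"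
  by (rule finite_subset[of _ "Pow V"]) (auto simp: pairs_def)

lemma finite_threshold_sets: "finite V \<Longrightarrow> finite (threshold_sets b V)"
  by (rule finite_subset[of _ "Pow (pairs V)"]) (auto simp: threshold_sets_def finite_pairs)

lemma threshold_setsD:
  "\<Phi> \<in> threshold_sets b V \<Longrightarrow> {x, y} \<in> \<Phi> \<Longrightarrow> z \<in> V \<Longrightarrow> z \<noteq> x \<Longrightarrow> b z \<le> b y \<Longrightarrow> {x, z} \<in> \<Phi>"
  unfolding threshold_sets_def by blast

lemma threshold_setsD_left:
  "\<Phi> \<in> threshold_sets b V \<Longrightarrow> {x, y} \<in> \<Phi> \<Longrightarrow> z \<in> V \<Longrightarrow> z \<noteq> y \<Longrightarrow> b z \<le> b x \<Longrightarrow> {z, y} \<in> \<Phi>"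
  using threshold_setsD[of \<Phi> b V y x z] by (simp add: insert_commute)

lemma threshold_sets_subset: "\<Phi> \<in> threshold_sets b V \<Longrightarrow> {x, y} \<in> \<Phi> \<Longrightarrow> x \<in> V \<and> y \<in> V \<and> x \<noteq> y"
  unfolding threshold_sets_def using pair_mem_pairs[of x y V] by blast

text \<open>If one edge is present, then every edge is, because vertices of the same rank can be exchanged.\<close>

lemma threshold_sets_one_block:
  assumes b: "\<And>v. v \<in> V \<Longrightarrow> b v = a"
  shows "threshold_sets b V = {{}, pairs V}"
proof
  show "threshold_sets b V \<subseteq> {{}, pairs V}"
  proof
    fix \<Phi> assume \<Phi>: "\<Phi> \<in> threshold_sets b V"
    have sub: "\<Phi> \<subseteq> pairs V" using \<Phi> by (simp add: threshold_sets_def)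
    have "\<Phi> = pairs V" if ne: "\<Phi> \<noteq> {}"
    proof
      obtain S where S: "S \<in> \<Phi>" using ne by auto
      then have "S \<in> pairs V" using sub by auto
      then obtain x y where xy: "{x, y} \<in> \<Phi>" "x \<in> V" "y \<in> V"
        using S by (elim pairsE) simp
      show "pairs V \<subseteq> \<Phi>"
      proof
        fix S assume "S \<in> pairs V"
        then obtain u v where uv: "S = {u, v}" "u \<in> V" "v \<in> V" "u \<noteq> v" by (rule pairsE)
        show "S \<in> \<Phi>"
        proof (cases "u = x")
          case True
          then show ?thesis using threshold_setsD[OF \<Phi> xy(1) uv(3)] uv b xy by simp
        next
          case False
          have "{x, u} \<in> \<Phi>" using threshold_setsD[OF \<Phi> xy(1) uv(2) False] b uv xy by simp
          then have "{u, x} \<in> \<Phi>" by (simp add: insert_commute)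
          then show ?thesis using threshold_setsD[OF \<Phi> _ uv(3)] uv b xy by simp
        qed
      qed
    qed (rule sub)
    then show "\<Phi> \<in> {{}, pairs V}" by auto
  qed
  show "{{}, pairs V} \<subseteq> threshold_sets b V"
    by (auto simp: threshold_sets_def pair_mem_pairs)
qed

text \<open>Either some vertex of the last rank has a neighbour, and then every vertex of the first rank is
  joined to all others, or the vertices of the last rank are isolated.\<close>

lemma threshold_sets_split:
  fixes V :: "'v set"
  assumes "a < c" and b: "b ` V = {a..c}"
  defines "K \<equiv> {S \<in> pairs V. \<exists>x\<in>S. b x = a}"
  shows "threshold_sets b V = threshold_sets b {v \<in> V. b v < c} \<union> (\<lambda>\<Theta>. \<Theta> \<union> K) ` threshold_sets b {v \<in> V. a < b v}"
    and "threshold_sets b {v \<in> V. b v < c} \<inter> (\<lambda>\<Theta>. \<Theta> \<union> K) ` threshold_sets b {v \<in> V. a < b v} = {}"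
    and "inj_on (\<lambda>\<Theta>. \<Theta> \<union> K) (threshold_sets b {v \<in> V. a < b v})"
proof -
  let ?lo = "{v \<in> V. b v < c}" and ?hi = "{v \<in> V. a < b v}"
  have bV: "a \<le> b v" "b v \<le> c" if "v \<in> V" for v using b that by auto
  have K: "{x, y} \<in> K \<longleftrightarrow> x \<in> V \<and> y \<in> V \<and> x \<noteq> y \<and> (b x = a \<or> b y = a)" for x y
    by (auto simp: K_def pair_mem_pairs)
  have "\<Phi> \<in> threshold_sets b ?lo \<union> (\<lambda>\<Theta>. \<Theta> \<union> K) ` threshold_sets b ?hi"
    if \<Phi>: "\<Phi> \<in> threshold_sets b V" for \<Phi>
  proof (cases "\<exists>x y. {x, y} \<in> \<Phi> \<and> b y = c")
    case True
    then obtain x y where xy: "{x, y} \<in> \<Phi>" "b y = c" by auto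
    have xyV: "x \<in> V" "y \<in> V" "x \<noteq> y" using threshold_sets_subset[OF \<Phi> xy(1)] by auto
    have K1: "{u, v} \<in> \<Phi>" if "u \<in> V" "v \<in> V" "u \<noteq> v" "b u = a" for u v
    proof -
      have "u \<noteq> y" using that(4) xy(2) \<open>a < c\<close> by auto
      then have "{u, y} \<in> \<Phi>"
        using threshold_setsD_left[OF \<Phi> xy(1) that(1)] bV[OF xyV(1)] that(4) by simp
      then show ?thesis
        using threshold_setsD[OF \<Phi> _ that(2)] that(3) bV[OF that(2)] xy(2) by simp
    qed
    have "S \<in> \<Phi>" if "S \<in> K" for S
    proof -
      have "S \<in> pairs V" using that by (simp add: K_def)
      then obtain u v where uv: "S = {u, v}" "u \<in> V" "v \<in> V" "u \<noteq> v" by (rule pairsE)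
      moreover have "b u = a \<or> b v = a" using that K[of u v] uv(1) by simp
      ultimately show ?thesis using K1[of u v] K1[of v u] by (auto simp: insert_commute)
    qed
    then have KS: "K \<subseteq> \<Phi>" by auto
    let ?\<Theta> = "\<Phi> \<inter> pairs ?hi"
    have "?\<Theta> \<in> threshold_sets b ?hi"
      using threshold_setsD[OF \<Phi>] by (auto simp: threshold_sets_def pair_mem_pairs)
    moreover have "\<Phi> = ?\<Theta> \<union> K"
    proof
      show "\<Phi> \<subseteq> ?\<Theta> \<union> K"
      proof
        fix S assume S: "S \<in> \<Phi>"
        then have "S \<in> pairs V" using \<Phi> by (auto simp: threshold_sets_def)
        then obtain u v where "S = {u, v}" "u \<in> V" "v \<in> V" "u \<noteq> v" by (rule pairsE)
        then show "S \<in> ?\<Theta> \<union> K" using S bV[of u] bV[of v] K[of u v] pair_mem_pairs[of u v ?hi] by auto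
      qed
    qed (use KS in auto)
    ultimately show ?thesis by blast
  next
    case False
    have "S \<in> pairs ?lo" if S: "S \<in> \<Phi>" for S
    proof -
      have "S \<in> pairs V" using S \<Phi> by (auto simp: threshold_sets_def)
      then obtain u v where uv: "S = {u, v}" "u \<in> V" "v \<in> V" "u \<noteq> v" by (rule pairsE)
      then have "b v \<noteq> c" "b u \<noteq> c" using False S by (auto simp: insert_commute)
      then show ?thesis using uv bV[of u] bV[of v] pair_mem_pairs[of u v ?lo] by auto
    qed
    then have "\<Phi> \<in> threshold_sets b ?lo"
      using threshold_setsD[OF \<Phi>] by (auto simp: threshold_sets_def)
    then show ?thesis by simp
  qed
  moreover have "\<Phi> \<in> threshold_sets b V" if \<Phi>: "\<Phi> \<in> threshold_sets b ?lo" for \<Phi>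
  proof -
    have "\<Phi> \<subseteq> pairs V" using \<Phi> pairs_mono[of ?lo V] by (auto simp: threshold_sets_def)
    moreover have "{x, z} \<in> \<Phi>" if "{x, y} \<in> \<Phi>" "z \<in> V" "z \<noteq> x" "b z \<le> b y" for x y z
      using threshold_setsD[OF \<Phi> that(1), of z] threshold_sets_subset[OF \<Phi> that(1)] that by auto
    ultimately show ?thesis by (auto simp: threshold_sets_def)
  qed
  moreover have "\<Theta> \<union> K \<in> threshold_sets b V" if \<Theta>: "\<Theta> \<in> threshold_sets b ?hi" for \<Theta>
  proof -
    have "\<Theta> \<union> K \<subseteq> pairs V" using \<Theta> pairs_mono[of ?hi V] by (auto simp: threshold_sets_def K_def)
    moreover have "{x, z} \<in> \<Theta> \<union> K" if xy: "{x, y} \<in> \<Theta> \<union> K" and z: "z \<in> V" "z \<noteq> x" "b z \<le> b y" for x y z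
    proof (cases "{x, y} \<in> \<Theta>")
      case True
      then have "x \<in> V" using threshold_sets_subset[OF \<Theta>] by blast
      then show ?thesis
        using threshold_setsD[OF \<Theta> True, of z] z K[of x z] bV[OF z(1)] by (cases "b z = a") auto
    next
      case False
      then have "x \<in> V" "b x = a \<or> b y = a" using xy K[of x y] by auto
      then show ?thesis using z K[of x z] bV[OF z(1)] by auto
    qed
    ultimately show ?thesis by (auto simp: threshold_sets_def)
  qed
  ultimately show "threshold_sets b V = threshold_sets b ?lo \<union> (\<lambda>\<Theta>. \<Theta> \<union> K) ` threshold_sets b ?hi"
    by blast
  show "threshold_sets b ?lo \<inter> (\<lambda>\<Theta>. \<Theta> \<union> K) ` threshold_sets b ?hi = {}"
  proof -
    have "a \<in> b ` V" "c \<in> b ` V" using \<open>a < c\<close> b by auto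
    then obtain u v where uv: "u \<in> V" "v \<in> V" "b u = a" "b v = c" by blast
    then have "{u, v} \<in> K" using \<open>a < c\<close> K by auto
    moreover have "{u, v} \<notin> \<Phi>" if "\<Phi> \<in> threshold_sets b ?lo" for \<Phi>
      using threshold_sets_subset[OF that, of u v] uv by auto
    ultimately show ?thesis by blast
  qed
  show "inj_on (\<lambda>\<Theta>. \<Theta> \<union> K) (threshold_sets b ?hi)"
  proof (rule inj_onI)
    have disj: "\<Theta> \<inter> K = {}" if \<Theta>: "\<Theta> \<in> threshold_sets b ?hi" for \<Theta>
    proof -
      have "\<Theta> \<subseteq> pairs ?hi" using \<Theta> by (simp add: threshold_sets_def)
      moreover have "b x \<noteq> a" if "S \<in> pairs ?hi" "x \<in> S" for S x using that by (auto elim!: pairsE)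
      ultimately show ?thesis unfolding K_def by blast
    qed
    fix \<Theta> \<Theta>' assume "\<Theta> \<in> threshold_sets b ?hi" "\<Theta>' \<in> threshold_sets b ?hi" "\<Theta> \<union> K = \<Theta>' \<union> K"
    then show "\<Theta> = \<Theta>'" using disj[of \<Theta>] disj[of \<Theta>'] by blast
  qed
qed

definition repeated :: "('v \<Rightarrow> nat) \<Rightarrow> 'v set \<Rightarrow> nat set" where
  "repeated b V = {p. \<exists>x\<in>V. \<exists>y\<in>V. x \<noteq> y \<and> b x = p \<and> b y = p}"

lemma repeated_less: "repeated b {v \<in> V. b v < m} = {p \<in> repeated b V. p < m}"
  by (auto simp: repeated_def)

text \<open>With the two kinds of graphs from the preceding lemma, the recursion is that of Pascal's triangle.\<close>

theorem card_threshold_sets: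
  assumes "finite V" "b ` V = {a..a + n}"
  shows "card (threshold_sets b V) = 2 ^ n + (\<Sum>p\<in>repeated b V. n choose (p - a))"
  using assms
proof (induction n arbitrary: a V)
  case 0
  then have bV: "b v = a" if "v \<in> V" for v using that by auto
  have ts: "threshold_sets b V = {{}, pairs V}" using bV by (rule threshold_sets_one_block)
  show ?case
  proof (cases "\<exists>x\<in>V. \<exists>y\<in>V. x \<noteq> y")
    case True
    then obtain x y where xy: "x \<in> V" "y \<in> V" "x \<noteq> y" by auto
    then have "a \<in> repeated b V"
      unfolding repeated_def using bV by auto
    moreover have "repeated b V \<subseteq> {a}" using bV by (auto simp: repeated_def)
    moreover have "{x, y} \<in> pairs V" using xy by (simp add: pair_mem_pairs)
    ultimately have "pairs V \<noteq> {}" "repeated b V = {a}" by auto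
    then show ?thesis by (simp add: ts)
  next
    case False
    then have "pairs V = {}" "repeated b V = {}" by (auto simp: pairs_def repeated_def)
    then show ?thesis by (simp add: ts)
  qed
next
  case (Suc n)
  let ?c = "a + Suc n"
  let ?lo = "{v \<in> V. b v < ?c}" and ?hi = "{v \<in> V. a < b v}"
  let ?N = "repeated b V"
  have bV: "a \<le> b v" "b v \<le> ?c" if "v \<in> V" for v using Suc.prems(2) that by auto
  have finN: "finite ?N"
    by (rule finite_subset[OF _ finite_imageI[OF Suc.prems(1), of b]]) (auto simp: repeated_def)
  have "b ` ?lo = {a..a + n}"
  proof -
    have "b ` ?lo = b ` V \<inter> {..<?c}" by auto
    then show ?thesis using Suc.prems(2) by auto
  qed
  then have lo: "card (threshold_sets b ?lo) = 2 ^ n + (\<Sum>p\<in>repeated b ?lo. n choose (p - a))"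
    using Suc.prems(1) by (intro Suc.IH) auto
  have "b ` ?hi = {Suc a..Suc a + n}"
  proof -
    have "b ` ?hi = b ` V \<inter> {a<..}" by auto
    then show ?thesis using Suc.prems(2) by auto
  qed
  then have hi: "card (threshold_sets b ?hi) = 2 ^ n + (\<Sum>p\<in>repeated b ?hi. n choose (p - Suc a))"
    using Suc.prems(1) by (intro Suc.IH) auto
  have "a < ?c" by simp
  note split = threshold_sets_split[OF this Suc.prems(2)]
  have card: "card (threshold_sets b V) = card (threshold_sets b ?lo) + card (threshold_sets b ?hi)"
    using Suc.prems(1) split(2)
    by (subst split(1)) (simp add: card_Un_disjoint finite_threshold_sets card_image[OF split(3)])
  have "repeated b ?lo = {p \<in> ?N. p < ?c}" by (auto simp: repeated_def)
  moreover have "p \<le> ?c" if "p \<in> ?N" for p using that bV(2) by (auto simp: repeated_def)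
  ultimately have rlo: "repeated b ?lo = ?N - {?c}" by force
  have "(\<Sum>p\<in>repeated b ?lo. n choose (p - a)) = (\<Sum>p\<in>?N. n choose (p - a))"
    unfolding rlo by (rule sum.mono_neutral_left) (use finN in auto)
  moreover have rhi: "repeated b ?hi = ?N - {a}"
  proof -
    have "repeated b ?hi = {p \<in> ?N. a < p}" by (auto simp: repeated_def)
    moreover have "a \<le> p" if "p \<in> ?N" for p using that bV(1) by (auto simp: repeated_def)
    ultimately show ?thesis by force
  qed
  have "(\<Sum>p\<in>repeated b ?hi. n choose (p - Suc a)) = (\<Sum>p\<in>?N. if p = a then 0 else n choose (p - Suc a))"
    unfolding rhi by (rule sum.mono_neutral_cong_left) (use finN in auto)
  moreover have "(n choose (p - a)) + (if p = a then 0 else n choose (p - Suc a)) = Suc n choose (p - a)"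
    if "p \<in> ?N" for p
  proof -
    have "a \<le> p" using that bV by (auto simp: repeated_def)
    show ?thesis
    proof (cases "p = a")
      case False
      then obtain k where "p - a = Suc k" using \<open>a \<le> p\<close> by (metis Suc_diff_Suc le_neq_implies_less)
      moreover from this have "p - Suc a = k" by simp
      ultimately show ?thesis using False by simp
    qed simp
  qed
  then have "(\<Sum>p\<in>?N. n choose (p - a)) + (\<Sum>p\<in>?N. if p = a then 0 else n choose (p - Suc a)) =
      (\<Sum>p\<in>?N. Suc n choose (p - a))"
    by (simp add: sum.distrib[symmetric])
  ultimately show ?case using card lo hi by simp
qed

section \<open>Counting the sets of pairs\<close>

lemma abelian_pair_idealsI:
  assumes "\<Psi> \<subseteq> signed_pairs l"
    and "\<And>x y. {x, y} \<in> \<Psi> \<Longrightarrow> W x + W y > 0"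
    and "\<And>x y z. {x, y} \<in> \<Psi> \<Longrightarrow> z \<in> signed l \<Longrightarrow> z \<noteq> x \<Longrightarrow> z \<noteq> - x \<Longrightarrow> z \<noteq> y \<Longrightarrow> z \<noteq> - y \<Longrightarrow>
      W y \<le> W z \<Longrightarrow> {x, z} \<in> \<Psi>"
    and "\<And>x y z. {x, y} \<in> \<Psi> \<Longrightarrow> {- y, z} \<in> \<Psi> \<Longrightarrow> z = x \<or> z = - x"
  shows "\<Psi> \<in> abelian_pair_ideals W l"
proof -
  have "sum W S > 0" if "S \<in> \<Psi>" for S
  proof -
    have "S \<in> signed_pairs l" using that assms(1) by auto
    then obtain x y where "S = {x, y}" "x \<noteq> y" by (rule signed_pairsE)
    then show ?thesis using assms(2)[of x y] that by simp
  qed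
  moreover have "{x, z} \<in> \<Psi>"
    if "{x, y} \<in> \<Psi>" "{- y, z} \<in> signed_pairs l" "{x, z} \<in> signed_pairs l" "W y \<le> W z" for x y z
    using that assms(3)[of x y z] by (cases "z = y") (auto simp: pair_mem_signed_pairs)
  moreover have "{x, z} \<notin> signed_pairs l" if "{x, y} \<in> \<Psi>" "{- y, z} \<in> \<Psi>" for x y z
    using assms(4)[OF that] by (auto simp: pair_mem_signed_pairs)
  ultimately show ?thesis using assms(1) unfolding abelian_pair_ideals_def by blast
qed

lemma abelian_pair_idealsD:
  assumes \<Psi>: "\<Psi> \<in> abelian_pair_ideals W l" and xy: "{x, y} \<in> \<Psi>"
  shows "{x, y} \<in> signed_pairs l"
    and "W x + W y > 0"
    and "z \<in> signed l \<Longrightarrow> z \<noteq> x \<Longrightarrow> z \<noteq> - x \<Longrightarrow> z \<noteq> - y \<Longrightarrow> W y \<le> W z \<Longrightarrow> {x, z} \<in> \<Psi>"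
    and "{- y, z} \<in> \<Psi> \<Longrightarrow> z = x \<or> z = - x"
proof -
  show s: "{x, y} \<in> signed_pairs l" using \<Psi> xy by (auto simp: abelian_pair_ideals_def)
  then have ne: "x \<noteq> y" by (simp add: pair_mem_signed_pairs)
  have "sum W {x, y} > 0" using \<Psi> xy unfolding abelian_pair_ideals_def by blast
  then show "W x + W y > 0" using ne by simp
  show "{x, z} \<in> \<Psi>" if z: "z \<in> signed l" "z \<noteq> x" "z \<noteq> - x" "z \<noteq> - y" "W y \<le> W z"
  proof (cases "z = y")
    case False
    then have "{- y, z} \<in> signed_pairs l" "{x, z} \<in> signed_pairs l"
      using z s by (auto simp: pair_mem_signed_pairs)
    then show ?thesis using \<Psi> xy z(5) unfolding abelian_pair_ideals_def by blast
  qed (use xy in simp)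
  show "z = x \<or> z = - x" if "{- y, z} \<in> \<Psi>"
  proof -
    have "{- y, z} \<in> signed_pairs l" using \<Psi> that by (auto simp: abelian_pair_ideals_def)
    moreover have "{x, z} \<notin> signed_pairs l" using \<Psi> xy that unfolding abelian_pair_ideals_def by blast
    ultimately show ?thesis using s by (auto simp: pair_mem_signed_pairs)
  qed
qed

lemma finite_abelian_pair_ideals: "finite (abelian_pair_ideals W l)"
proof -
  have "finite (signed l)"
    by (rule finite_subset[of _ "{- int l..int l}"]) (auto simp: signed_def)
  then have "finite (signed_pairs l)"
    by (rule_tac finite_subset[of _ "Pow (signed l)"]) (auto simp: signed_pairs_def)
  then show ?thesis
    by (rule_tac finite_subset[of _ "Pow (signed_pairs l)"]) (auto simp: abelian_pair_ideals_def)
qed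

text \<open>The diagram automorphism of type D.\<close>

definition flip_last :: "nat \<Rightarrow> int \<Rightarrow> int" where
  "flip_last l z = (if \<bar>z\<bar> = int l then - z else z)"

lemma flip_last_simps [simp]:
  "flip_last l (flip_last l z) = z" "flip_last l (- z) = - flip_last l z"
  "flip_last l z \<in> signed l \<longleftrightarrow> z \<in> signed l" "flip_last l z = flip_last l w \<longleftrightarrow> z = w"
  by (auto simp: flip_last_def signed_def split: if_splits)

lemma flip_last_invol: "flip_last l ` flip_last l ` S = S"
  by (simp add: image_image)

lemma flip_last_mem: "{x, y} \<in> image (flip_last l) ` \<Psi> \<longleftrightarrow> {flip_last l x, flip_last l y} \<in> \<Psi>"
proof
  assume "{x, y} \<in> image (flip_last l) ` \<Psi>"
  then obtain S where S: "S \<in> \<Psi>" "{x, y} = flip_last l ` S" by auto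
  then have "flip_last l ` {x, y} = S" by (simp only: flip_last_invol)
  then show "{flip_last l x, flip_last l y} \<in> \<Psi>" using S(1) by simp
next
  assume "{flip_last l x, flip_last l y} \<in> \<Psi>"
  then have "flip_last l ` {flip_last l x, flip_last l y} \<in> image (flip_last l) ` \<Psi>" by (rule imageI)
  then show "{x, y} \<in> image (flip_last l) ` \<Psi>" by simp
qed

lemma flip_abelian_pair_ideals:
  assumes "\<Psi> \<in> abelian_pair_ideals (W \<circ> flip_last l) l"
  shows "image (flip_last l) ` \<Psi> \<in> abelian_pair_ideals W l"
proof (rule abelian_pair_idealsI)
  note D = abelian_pair_idealsD[OF assms]
  show "image (flip_last l) ` \<Psi> \<subseteq> signed_pairs l"
  proof
    fix S assume "S \<in> image (flip_last l) ` \<Psi>"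
    then obtain T where T: "T \<in> \<Psi>" "S = flip_last l ` T" by auto
    have "T \<in> signed_pairs l" using T(1) assms by (auto simp: abelian_pair_ideals_def)
    then obtain x y where "T = {x, y}" "x \<in> signed l" "y \<in> signed l" "x \<noteq> y" "x \<noteq> - y" by (rule signed_pairsE)
    then show "S \<in> signed_pairs l"
      using T(2) flip_last_simps(4)[of l x "- y"] by (simp add: pair_mem_signed_pairs del: flip_last_simps(4)) auto
  qed
  show "W x + W y > 0" if "{x, y} \<in> image (flip_last l) ` \<Psi>" for x y
    using D(2)[of "flip_last l x" "flip_last l y"] that by (simp add: flip_last_mem)
  show "{x, z} \<in> image (flip_last l) ` \<Psi>"
    if "{x, y} \<in> image (flip_last l) ` \<Psi>" "z \<in> signed l" "z \<noteq> x" "z \<noteq> - x" "z \<noteq> y" "z \<noteq> - y" "W y \<le> W z" for x y z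
  proof -
    have "flip_last l z \<noteq> - flip_last l x" "flip_last l z \<noteq> - flip_last l y"
      using that(4,6) by (simp_all flip: flip_last_simps(2))
    then show ?thesis using D(3)[of "flip_last l x" "flip_last l y" "flip_last l z"] that by (simp add: flip_last_mem)
  qed
  show "z = x \<or> z = - x"
    if "{x, y} \<in> image (flip_last l) ` \<Psi>" "{- y, z} \<in> image (flip_last l) ` \<Psi>" for x y z
  proof -
    have "flip_last l z = flip_last l x \<or> flip_last l z = flip_last l (- x)"
      using D(4)[of "flip_last l x" "flip_last l y" "flip_last l z"] that by (simp add: flip_last_mem)
    then show ?thesis by (simp del: flip_last_simps(2))
  qed
qed

lemma inj_flip: "inj (image (image (flip_last l)))"
  by (rule inj_on_inverseI[of _ "image (image (flip_last l))"]) (simp add: image_image)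

lemma card_flip_abelian_pair_ideals:
  "card (abelian_pair_ideals (W \<circ> flip_last l) l) = card (abelian_pair_ideals W l)"
proof -
  have le: "card (abelian_pair_ideals (W \<circ> flip_last l) l) \<le> card (abelian_pair_ideals W l)" for W
    using flip_abelian_pair_ideals
    by (intro card_inj_on_le[of "image (image (flip_last l))"] inj_on_subset[OF inj_flip]
        finite_abelian_pair_ideals) auto
  have "W \<circ> flip_last l \<circ> flip_last l = W" by (auto simp: fun_eq_iff)
  then show ?thesis using le[of W] le[of "W \<circ> flip_last l"] by simp
qed

text \<open>Up to the flip, the weights of the positive indices are nonnegative, and they are determined by
  the blocks of indices of equal weight. The number \<open>b j\<close> is the position of the block of \<open>j\<close>; there
  are \<open>M\<close> blocks, and \<open>c\<close> is the weight of the last one.\<close>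

locale block_weight =
  fixes l :: nat and W :: "int \<Rightarrow> int" and b :: "int \<Rightarrow> nat" and M :: nat and c :: int
  assumes l4: "l \<ge> 4"
    and odd: "\<And>z. W (- z) = - W z"
    and weight: "\<And>j. j \<in> {1..int l} \<Longrightarrow> W j = 2 * (int M - int (b j)) + c"
    and c01: "c = 0 \<or> c = 1"
    and b_image: "b ` {1..int l} = {1..M}"
    and b_mono: "\<And>i j. 1 \<le> i \<Longrightarrow> i \<le> j \<Longrightarrow> j \<le> int l \<Longrightarrow> b i \<le> b j"
    and c1: "c = 1 \<Longrightarrow> b (int l - 1) = M"
begin

abbreviation "V \<equiv> {1..int l}"
abbreviation "ideals \<equiv> abelian_pair_ideals W l"
abbreviation "inner \<equiv> threshold_sets b {v \<in> V. b v < M}"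

lemma b_range: "v \<in> V \<Longrightarrow> 1 \<le> b v \<and> b v \<le> M"
  using b_image by auto

lemma b_1: "b 1 = 1"
proof -
  have "M \<ge> 1" using b_range[of 1] l4 by auto
  then have "1 \<in> b ` V" using b_image by auto
  then obtain v where v: "v \<in> V" "b v = 1" by force
  then show ?thesis using b_mono[of 1 v] b_range[of 1] l4 by auto
qed

lemma b_l: "b (int l) = M"
proof -
  have "M \<ge> 1" using b_range[of 1] l4 by auto
  then have "M \<in> b ` V" using b_image by auto
  then obtain v where v: "v \<in> V" "b v = M" by force
  then show ?thesis using b_mono[of v "int l"] b_range[of "int l"] l4 by auto
qed

lemma W_le: "i \<in> V \<Longrightarrow> j \<in> V \<Longrightarrow> W i \<le> W j \<longleftrightarrow> b j \<le> b i"
  by (simp add: weight)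

lemma W_nonneg: "j \<in> V \<Longrightarrow> 0 \<le> W j"
  using weight[of j] b_range[of j] c01 by auto

lemma W_zero:
  assumes "j \<in> V"
  shows "W j = 0 \<longleftrightarrow> c = 0 \<and> b j = M"
proof -
  have "int (b j) \<le> int M" using b_range[OF assms] by simp
  then show ?thesis using weight[OF assms] c01 by presburger
qed

lemma signed_V: "z \<in> signed l \<longleftrightarrow> z \<in> V \<or> - z \<in> V"
  by (auto simp: signed_def)

lemma V_signed: "z \<in> V \<Longrightarrow> z \<in> signed l" "z \<in> V \<Longrightarrow> - z \<in> signed l"
  by (auto simp: signed_def)

lemma neg_V: "z \<in> V \<Longrightarrow> - z \<notin> V" "z \<in> V \<Longrightarrow> w \<in> V \<Longrightarrow> z \<noteq> - w"
  by auto

lemma pairs_signed: "pairs V \<subseteq> signed_pairs l"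
proof
  fix S assume "S \<in> pairs V"
  then obtain x y where "S = {x, y}" "x \<in> V" "y \<in> V" "x \<noteq> y" by (rule pairsE)
  then show "S \<in> signed_pairs l" using V_signed neg_V(2)[of x y] by (simp add: pair_mem_signed_pairs)
qed

subsection \<open>Ideals of positive pairs\<close>

text \<open>An index of weight \<open>0\<close> occurs only if it is the last one and there is no other, so that closure does not
  lead to negative indices.\<close>

lemma threshold_set_ideal:
  assumes \<Phi>: "\<Phi> \<in> threshold_sets b U" and U: "U = {v \<in> V. b v < M} \<or> U = V \<and> (c = 1 \<or> b (int l - 1) < M)"
  shows "\<Phi> \<in> ideals"
proof (rule abelian_pair_idealsI)
  have UV: "U \<subseteq> V" using U by auto
  have \<Phi>V: "\<Phi> \<subseteq> pairs V" using \<Phi> pairs_mono[OF UV] by (auto simp: threshold_sets_def)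
  then show "\<Phi> \<subseteq> signed_pairs l" using pairs_signed by auto
  have mem: "x \<in> U \<and> y \<in> U \<and> x \<in> V \<and> y \<in> V \<and> x \<noteq> y" if "{x, y} \<in> \<Phi>" for x y
    using threshold_sets_subset[OF \<Phi> that] UV by auto
  have zero: "y = int l" if "y \<in> U" "W y = 0" for y
  proof -
    have yV: "y \<in> V" using that UV by auto
    then have cb: "c = 0" "b y = M" using W_zero that(2) by auto
    then have "b (int l - 1) < M" using U that(1) by auto
    show ?thesis
    proof (rule ccontr)
      assume "y \<noteq> int l"
      then have "b y \<le> b (int l - 1)" using yV by (intro b_mono) auto
      then show False using cb \<open>b (int l - 1) < M\<close> by simp
    qed
  qed
  show "W x + W y > 0" if "{x, y} \<in> \<Phi>" for x y
  proof -
    have "W x \<noteq> 0 \<or> W y \<noteq> 0" using mem[OF that] zero[of x] zero[of y] by auto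
    then show ?thesis using mem[OF that] W_nonneg[of x] W_nonneg[of y] by auto
  qed
  show "{x, z} \<in> \<Phi>" if xy: "{x, y} \<in> \<Phi>"
    and z: "z \<in> signed l" "z \<noteq> x" "z \<noteq> - x" "z \<noteq> y" "z \<noteq> - y" "W y \<le> W z" for x y z
  proof (cases "z \<in> V")
    case True
    then have bz: "b z \<le> b y" using W_le[of y z] mem[OF xy] z(6) by auto
    moreover have "z \<in> U" using U True bz mem[OF xy] by auto
    ultimately show ?thesis using threshold_setsD[OF \<Phi> xy] z(2) by blast
  next
    case False
    then have mz: "- z \<in> V" using z(1) signed_V by auto
    have Wz: "W (- z) \<ge> 0" using W_nonneg[OF mz] .
    then have "W y = 0" "W (- z) = 0" using z(6) odd[of z] W_nonneg[of y] mem[OF xy] by auto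
    then have y: "y = int l" using zero mem[OF xy] by auto
    moreover from this have "U = V" using U mem[OF xy] b_l by auto
    then have "- z = int l" using zero[of "- z"] mz \<open>W (- z) = 0\<close> by auto
    ultimately show ?thesis using z(5) by simp
  qed
  show "z = x \<or> z = - x" if "{x, y} \<in> \<Phi>" "{- y, z} \<in> \<Phi>" for x y z
    using mem[OF that(1)] mem[OF that(2)] neg_V(1)[of y] by auto
qed

lemma ideal_threshold_set:
  assumes \<Psi>: "\<Psi> \<in> ideals" "\<Psi> \<subseteq> pairs U" and U: "U \<subseteq> V"
  shows "\<Psi> \<in> threshold_sets b U"
  unfolding threshold_sets_def
proof (intro CollectI conjI allI impI)
  fix x y z assume xy: "{x, y} \<in> \<Psi>" and z: "z \<in> U" "z \<noteq> x" "b z \<le> b y"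
  have "x \<in> V" "y \<in> V" using xy \<Psi>(2) U pair_mem_pairs[of x y U] by auto
  then show "{x, z} \<in> \<Psi>"
    using z U by (intro abelian_pair_idealsD(3)[OF \<Psi>(1) xy]) (auto simp: W_le V_signed signed_def)
qed (rule \<Psi>(2))

lemma ideals_of_pairs:
  assumes "U = {v \<in> V. b v < M} \<or> U = V \<and> (c = 1 \<or> b (int l - 1) < M)"
  shows "{\<Psi> \<in> ideals. \<Psi> \<subseteq> pairs U} = threshold_sets b U"
proof (intro set_eqI iffI)
  fix \<Psi> assume "\<Psi> \<in> {\<Psi> \<in> ideals. \<Psi> \<subseteq> pairs U}"
  then show "\<Psi> \<in> threshold_sets b U" using assms by (intro ideal_threshold_set) auto
next
  fix \<Psi> assume "\<Psi> \<in> threshold_sets b U"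
  then show "\<Psi> \<in> {\<Psi> \<in> ideals. \<Psi> \<subseteq> pairs U}"
    using threshold_set_ideal[OF _ assms] by (simp add: threshold_sets_def)
qed

text \<open>If two indices \<open>y\<close> and \<open>w\<close> have weight \<open>0\<close>, then \<open>{x, y}\<close> forces the pair \<open>{x, - w}\<close>; so the last block
  cannot be used.\<close>

lemma positive_ideals:
  "{\<Psi> \<in> ideals. \<Psi> \<subseteq> pairs V} = threshold_sets b (if c = 1 \<or> b (int l - 1) < M then V else {v \<in> V. b v < M})"
proof (cases "c = 1 \<or> b (int l - 1) < M")
  case True
  then show ?thesis using ideals_of_pairs[of V] by simp
next
  case False
  then have c: "c = 0" and bl: "b (int l - 1) = M" using c01 b_range[of "int l - 1"] l4 by auto
  have "\<Psi> \<subseteq> pairs {v \<in> V. b v < M}" if \<Psi>: "\<Psi> \<in> ideals" "\<Psi> \<subseteq> pairs V" for \<Psi>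
  proof
    fix S assume S: "S \<in> \<Psi>"
    then have "S \<in> pairs V" using \<Psi>(2) by auto
    then obtain u v where uv: "S = {u, v}" "u \<in> V" "v \<in> V" "u \<noteq> v" by (rule pairsE)
    have no: "b y < M" if xy: "{x, y} \<in> \<Psi>" "x \<in> V" "y \<in> V" for x y
    proof (rule ccontr)
      assume "\<not> b y < M"
      then have byM: "b y = M" using b_range[OF xy(3)] by simp
      then have Wy: "W y = 0" using W_zero[OF xy(3)] c by simp
      \<comment> \<open>A second index of weight 0.\<close>
      obtain w where w: "w \<in> V" "w \<noteq> y" "b w = M"
        using that[of "if y = int l then int l - 1 else int l"] bl b_l l4 by auto
      have Ww: "W w = 0" using W_zero[OF w(1)] w(3) c by simp
      have "W x > 0" using abelian_pair_idealsD(2)[OF \<Psi>(1) xy(1)] Wy by simp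
      then have "x \<noteq> w" using Ww by auto
      then have "{x, - w} \<in> \<Psi>"
        using w xy(2,3) Ww Wy odd[of w] V_signed
        by (intro abelian_pair_idealsD(3)[OF \<Psi>(1) xy(1)]) auto
      then show False using \<Psi>(2) neg_V(1)[OF w(1)] pair_mem_pairs[of x "- w" V] by auto
    qed
    have "b v < M" "b u < M" using no[of u v] no[of v u] uv S by (auto simp: insert_commute)
    then show "S \<in> pairs {v \<in> V. b v < M}" using uv by (simp add: pair_mem_pairs)
  qed
  then have "{\<Psi> \<in> ideals. \<Psi> \<subseteq> pairs V} = {\<Psi> \<in> ideals. \<Psi> \<subseteq> pairs {v \<in> V. b v < M}}"
    using pairs_mono[of "{v \<in> V. b v < M}" V] by blast
  also have "\<dots> = inner" by (rule ideals_of_pairs) simp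
  finally show ?thesis using False by simp
qed

end

context block_weight
begin

subsection \<open>Ideals with negative indices\<close>

definition special :: "int set set set" where
  "special = {\<Psi> \<in> ideals. {1, int l} \<in> \<Psi> \<and> {1, - int l} \<in> \<Psi>}"

text \<open>The pair \<open>{x, - u}\<close> has positive weight, and the weight is a weakly decreasing function of positive
  indices.\<close>

lemma negative_pair_order:
  assumes \<Psi>: "\<Psi> \<in> ideals" "{x, - u} \<in> \<Psi>" and V: "x \<in> V" "u \<in> V"
  shows "W u < W x" "x < u"
proof -
  show *: "W u < W x" using abelian_pair_idealsD(2)[OF \<Psi>] odd[of u] by simp
  show "x < u"
  proof (rule ccontr)
    assume "\<not> x < u"
    then have "b u \<le> b x" using V by (intro b_mono) auto
    then show False using W_le[of x u] V * by simp
  qed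
qed

text \<open>As \<open>- u\<close> is below \<open>l\<close> and \<open>- l\<close>, it can be replaced by them, but only if \<open>u \<noteq> l\<close>: the difference of \<open>l\<close>
  and \<open>- l\<close> is not a root. For \<open>u = l\<close> one first passes to \<open>- (l - 1)\<close>, if it has the same weight.\<close>

lemma negative_pair_spreads:
  assumes \<Psi>: "\<Psi> \<in> ideals" "{x, - u} \<in> \<Psi>" and V: "x \<in> V" "u \<in> V" and u: "u < int l \<or> b (int l - 1) = M"
  shows "{x, int l} \<in> \<Psi> \<and> {x, - int l} \<in> \<Psi>"
proof -
  have lV: "int l \<in> V" using l4 by simp
  have *: "{x, int l} \<in> \<Psi> \<and> {x, - int l} \<in> \<Psi>" if xu: "{x, - u} \<in> \<Psi>" "u \<in> V" "u < int l" for u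
  proof -
    have o: "x < u" using negative_pair_order[OF \<Psi>(1) xu(1) V(1) xu(2)] by simp
    have "W (int l) \<le> W u" using W_le[OF lV xu(2)] b_range[OF xu(2)] b_l by simp
    moreover have "0 \<le> W (int l)" "0 \<le> W u" using W_nonneg lV xu(2) by auto
    ultimately have "W (- u) \<le> W (int l)" "W (- u) \<le> W (- int l)" using odd[of u] odd[of "int l"] by auto
    then show ?thesis
      using o V(1) xu(2,3) by (intro conjI abelian_pair_idealsD(3)[OF \<Psi>(1) xu(1)]) (auto simp: signed_def)
  qed
  show ?thesis
  proof (cases "u < int l")
    case True
    then show ?thesis using * \<Psi>(2) V(2) by blast
  next
    case False
    then have ul: "u = int l" and bM: "b (int l - 1) = M" using V(2) u by auto
    have l1: "int l - 1 \<in> V" using l4 by simp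
    have Weq: "W (int l - 1) = W (int l)" using weight[OF l1] weight[OF lV] bM b_l by simp
    have o: "W (int l) < W x" "x < int l" using negative_pair_order[OF \<Psi> V] ul by auto
    then have "x \<noteq> int l - 1" using Weq by auto
    moreover have "W (- int l) \<le> W (- (int l - 1))" unfolding odd Weq by simp
    ultimately have "{x, - (int l - 1)} \<in> \<Psi>"
      using ul o(2) V(1) l4 by (intro abelian_pair_idealsD(3)[OF \<Psi>]) (auto simp: signed_def)
    then show ?thesis using *[of "int l - 1"] l1 by simp
  qed
qed

text \<open>Otherwise \<open>{1, l}\<close> is in the ideal as well, and its sum with \<open>{x, - l}\<close> is the root \<open>{1, x}\<close>.\<close>

lemma spread_first:
  assumes \<Psi>: "\<Psi> \<in> ideals" and xl: "{x, int l} \<in> \<Psi>" "{x, - int l} \<in> \<Psi>" and x: "x \<in> V"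
  shows "x = 1"
proof (rule ccontr)
  assume ne: "x \<noteq> 1"
  have lx: "{int l, x} \<in> \<Psi>" using xl(1) by (simp add: insert_commute)
  have "W x \<le> W 1" using W_le[of x 1] x b_1 b_range[OF x] by simp
  then have "{int l, 1} \<in> \<Psi>"
    using ne x l4 by (intro abelian_pair_idealsD(3)[OF \<Psi> lx]) (auto simp: signed_def)
  then have 1: "{1, int l} \<in> \<Psi>" by (simp add: insert_commute)
  have "{- int l, x} \<in> \<Psi>" using xl(2) by (simp add: insert_commute)
  then show False using abelian_pair_idealsD(4)[OF \<Psi> 1, of x] ne x by auto
qed

lemma ideal_cases:
  assumes \<Psi>: "\<Psi> \<in> ideals" and S: "S \<in> \<Psi>"
  obtains (positive) x y where "S = {x, y}" "x \<in> V" "y \<in> V" "x \<noteq> y"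
  | (negative) x u where "S = {x, - u}" "x \<in> V" "u \<in> V" "x < u"
proof -
  have "S \<in> signed_pairs l" using \<Psi> S by (auto simp: abelian_pair_ideals_def)
  then obtain x y where xy: "S = {x, y}" "x \<in> signed l" "y \<in> signed l" "x \<noteq> y" "x \<noteq> - y"
    by (rule signed_pairsE)
  have W: "W x + W y > 0" using abelian_pair_idealsD(2)[OF \<Psi>] S xy(1) by blast
  consider "x \<in> V" "y \<in> V" | "x \<in> V" "- y \<in> V" | "- x \<in> V" "y \<in> V" | "- x \<in> V" "- y \<in> V"
    using xy(2,3) signed_V by blast
  then show thesis
  proof cases
    case 1
    then show thesis using positive xy by blast
  next
    case 2
    then show thesis using negative[of x "- y"] xy S negative_pair_order[OF \<Psi>, of x "- y"] by simp
  next
    case 3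
    then have "{y, - (- x)} \<in> \<Psi>" using xy(1) S by (simp add: insert_commute)
    then show thesis using negative[of y "- x"] xy 3 negative_pair_order[OF \<Psi>, of y "- x"]
      by (simp add: insert_commute)
  next
    case 4
    then show thesis using W W_nonneg[of "- x"] W_nonneg[of "- y"] odd[of x] odd[of y] by simp
  qed
qed

lemma special_negative_first:
  assumes \<Psi>: "\<Psi> \<in> special" and xu: "{x, - u} \<in> \<Psi>" "x \<in> V" "u \<in> V"
  shows "x = 1"
proof (cases "u < int l \<or> b (int l - 1) = M")
  case True
  then show ?thesis
    using negative_pair_spreads[OF _ xu] spread_first[OF _ _ _ xu(2)] \<Psi> by (auto simp: special_def)
next
  case False
  then have "u = int l" using xu(3) by simp
  then have "{- int l, x} \<in> \<Psi>" using xu(1) by (simp add: insert_commute)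
  then have "x = 1 \<or> x = - 1"
    using abelian_pair_idealsD(4)[of \<Psi> W l 1 "int l" x] \<Psi> by (simp add: special_def)
  then show ?thesis using xu(2) by auto
qed

lemma ideal_trichotomy:
  assumes \<Psi>: "\<Psi> \<in> ideals"
  shows "\<Psi> \<subseteq> pairs V \<or> \<Psi> \<in> special \<or> (b (int l - 1) < M \<and> image (flip_last l) ` \<Psi> \<subseteq> pairs V)"
proof (rule ccontr)
  assume no: "\<not> ?thesis"
  have nospread: False if "{x, int l} \<in> \<Psi>" "{x, - int l} \<in> \<Psi>" "x \<in> V" for x
    using spread_first[OF \<Psi> that] that no \<Psi> by (simp add: special_def)
  have neg: "u = int l \<and> b (int l - 1) < M" if "{x, - u} \<in> \<Psi>" "x \<in> V" "u \<in> V" for x u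
  proof -
    have "\<not> (u < int l \<or> b (int l - 1) = M)"
      using negative_pair_spreads[OF \<Psi> that] nospread[of x] that(2) by blast
    then show ?thesis using that(3) b_range[of "int l - 1"] l4 by auto
  qed
  obtain S where S: "S \<in> \<Psi>" "S \<notin> pairs V" using no by auto
  obtain x u where xu: "S = {x, - u}" "x \<in> V" "u \<in> V" "x < u"
    by (rule ideal_cases[OF \<Psi> S(1)]) (use S(2) in \<open>auto simp: pair_mem_pairs\<close>)
  have u: "u = int l" "b (int l - 1) < M" using neg[of x u] xu S(1) by auto
  have xl: "{- int l, x} \<in> \<Psi>" using S(1) xu(1) u(1) by (simp add: insert_commute)
  \<comment> \<open>The sign of \<open>l\<close> is the same in all pairs, so that changing it makes them positive.\<close>
  have nol: "{w, int l} \<notin> \<Psi>" if "w \<in> V" for w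
  proof
    assume w: "{w, int l} \<in> \<Psi>"
    then have "x = w \<or> x = - w" using abelian_pair_idealsD(4)[OF \<Psi> w, of x] xl by simp
    then have "x = w" using that xu(2) by auto
    then show False using nospread[OF w _ that] xl by (simp add: insert_commute)
  qed
  have "flip_last l ` T \<in> pairs V" if T: "T \<in> \<Psi>" for T
    using \<Psi> T
  proof (cases rule: ideal_cases)
    case (positive y z)
    then have "y \<noteq> int l" "z \<noteq> int l" using nol[of y] nol[of z] T by (auto simp: insert_commute)
    then have "flip_last l y = y" "flip_last l z = z" using positive by (auto simp: flip_last_def)
    then show ?thesis using positive by (simp add: pair_mem_pairs)
  next
    case (negative y v)
    then have "v = int l" using neg[of y v] T by simp
    then have "flip_last l y = y" "flip_last l (- v) = v"
      using negative by (auto simp: flip_last_def)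
    then show ?thesis using negative by (simp add: pair_mem_pairs)
  qed
  then show False using no u(2) by blast
qed

lemma special_not_positive:
  assumes "\<Psi> \<in> special"
  shows "\<not> \<Psi> \<subseteq> pairs V" "\<not> image (flip_last l) ` \<Psi> \<subseteq> pairs V"
proof -
  have 1: "{1, - int l} \<in> \<Psi>" "{1, int l} \<in> \<Psi>" using assms by (auto simp: special_def)
  have no: "{1, - int l} \<notin> pairs V" using l4 by (simp add: pair_mem_pairs)
  show "\<not> \<Psi> \<subseteq> pairs V" using 1(1) no by blast
  have "flip_last l ` {1, int l} = {1, - int l}" using l4 by (simp add: flip_last_def)
  then have "{1, - int l} \<in> image (flip_last l) ` \<Psi>" using 1(2) by (metis imageI)
  then show "\<not> image (flip_last l) ` \<Psi> \<subseteq> pairs V" using no by blast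
qed

text \<open>Exchanging \<open>1\<close> for \<open>2\<close> in \<open>{1, l}\<close> gives \<open>{2, l}\<close>, whose sum with \<open>{1, - l}\<close> is the root \<open>{1, 2}\<close>.\<close>

lemma special_empty:
  assumes "b 2 = 1"
  shows "special = {}"
proof (rule ccontr)
  assume "special \<noteq> {}"
  then obtain \<Psi> where \<Psi>: "\<Psi> \<in> special" by auto
  have i: "\<Psi> \<in> ideals" "{int l, 1} \<in> \<Psi>" "{- int l, 1} \<in> \<Psi>" using \<Psi> by (auto simp: special_def insert_commute)
  have "W 1 \<le> W 2" using W_le[of 1 2] assms b_1 l4 by simp
  then have "{int l, 2} \<in> \<Psi>"
    using l4 by (intro abelian_pair_idealsD(3)[OF i(1,2)]) (auto simp: signed_def)
  then have "{2, int l} \<in> \<Psi>" by (simp add: insert_commute)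
  from abelian_pair_idealsD(4)[OF i(1) this i(3)] show False by simp
qed

text \<open>A special ideal is the same as an ideal of positive pairs that avoids the last block: for
  \<open>y \<ge> 2\<close> the pair \<open>{1, y}\<close> always belongs to the former, and one exchanges the condition that \<open>{1, - y}\<close> is
  missing in it for the condition that \<open>{1, y}\<close> belongs to the latter.\<close>

definition inner_rel :: "int set set \<Rightarrow> int \<Rightarrow> int \<Rightarrow> bool" where
  "inner_rel \<Psi> x y \<longleftrightarrow> (x \<in> {2..int l} \<and> y \<in> {2..int l} \<and> {x, y} \<in> \<Psi>) \<or>
     (x = 1 \<and> y \<in> {2..int l} \<and> {1, - y} \<notin> \<Psi>) \<or> (y = 1 \<and> x \<in> {2..int l} \<and> {1, - x} \<notin> \<Psi>)"

definition special_rel :: "int set set \<Rightarrow> int \<Rightarrow> int \<Rightarrow> bool" where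
  "special_rel \<Theta> x y \<longleftrightarrow> (x \<in> {2..int l} \<and> y \<in> {2..int l} \<and> {x, y} \<in> \<Theta>) \<or>
     (x = 1 \<and> y \<in> {2..int l}) \<or> (y = 1 \<and> x \<in> {2..int l}) \<or>
     (x = 1 \<and> - y \<in> {2..int l} \<and> {1, - y} \<notin> \<Theta>) \<or> (y = 1 \<and> - x \<in> {2..int l} \<and> {1, - x} \<notin> \<Theta>)"

definition to_inner :: "int set set \<Rightarrow> int set set" where
  "to_inner \<Psi> = {{x, y} |x y. inner_rel \<Psi> x y}"

definition to_special :: "int set set \<Rightarrow> int set set" where
  "to_special \<Theta> = {{x, y} |x y. special_rel \<Theta> x y}"

lemma inner_rel_sym: "inner_rel \<Psi> x y \<Longrightarrow> inner_rel \<Psi> y x"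
  by (auto simp: inner_rel_def insert_commute)

lemma special_rel_sym: "special_rel \<Psi> x y \<Longrightarrow> special_rel \<Psi> y x"
  by (auto simp: special_rel_def insert_commute)

lemma mem_to_inner: "{x, y} \<in> to_inner \<Psi> \<longleftrightarrow> inner_rel \<Psi> x y"
  unfolding to_inner_def using inner_rel_sym by (auto simp: doubleton_eq_iff)

lemma mem_to_special: "{x, y} \<in> to_special \<Psi> \<longleftrightarrow> special_rel \<Psi> x y"
  unfolding to_special_def using special_rel_sym by (auto simp: doubleton_eq_iff)

context
  assumes b2: "b 2 \<noteq> 1"
begin

lemma b_ge2: "v \<in> {2..int l} \<Longrightarrow> b v \<ge> 2"
  using b_mono[of 2 v] b2 b_range[of 2] l4 by force

lemma W_first: "v \<in> {2..int l} \<Longrightarrow> W v < W 1"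
  using weight[of v] weight[of 1] b_ge2[of v] b_1 l4 by auto

lemma M_ge2: "M \<ge> 2"
  using b_ge2[of "int l"] b_l l4 by simp

lemma to_inner:
  assumes \<Psi>: "\<Psi> \<in> special"
  shows "to_inner \<Psi> \<in> inner"
proof -
  have \<Psi>i: "\<Psi> \<in> ideals" and l1: "{1, - int l} \<in> \<Psi>" using \<Psi> by (auto simp: special_def)
  note D = abelian_pair_idealsD[OF \<Psi>i]
  have last: "{1, - y} \<in> \<Psi>" if "y \<in> {2..int l}" "b y = M" for y
  proof (cases "y = int l")
    case False
    have "W y = W (int l)" using weight[of y] weight[of "int l"] that b_l l4 by simp
    then have "W (- int l) \<le> W (- y)" by (simp add: odd)
    then show ?thesis using False that l4 by (intro D(3)[OF l1]) (auto simp: signed_def)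
  qed (use l1 in simp)
  have no: "{1, - y} \<notin> \<Psi>" if "{x, y} \<in> \<Psi>" "x \<in> {2..int l}" "y \<in> {2..int l}" for x y
  proof
    assume "{1, - y} \<in> \<Psi>"
    then have "{- y, 1} \<in> \<Psi>" by (simp add: insert_commute)
    then show False using D(4)[OF that(1), of 1] that(2) by auto
  qed
  have low: "b y < M" if "y \<in> {2..int l}" "{1, - y} \<notin> \<Psi>" for y
    using last[OF that(1)] that b_range[of y] by fastforce
  show ?thesis
    unfolding threshold_sets_def
  proof (intro CollectI conjI allI impI subsetI)
    fix S assume "S \<in> to_inner \<Psi>"
    then obtain x y where xy: "S = {x, y}" "inner_rel \<Psi> x y" by (auto simp: to_inner_def)
    have *: "x \<in> V \<and> y \<in> V \<and> x \<noteq> y \<and> b x < M \<and> b y < M"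
      using xy(2) unfolding inner_rel_def
    proof (elim disjE conjE)
      assume a: "x \<in> {2..int l}" "y \<in> {2..int l}" "{x, y} \<in> \<Psi>"
      then have "{y, x} \<in> \<Psi>" by (simp add: insert_commute)
      then show ?thesis using a low[of x] low[of y] no[of x y] no[of y x] D(1)[OF a(3)]
        by (auto simp: pair_mem_signed_pairs)
    qed (use low[of x] low[of y] b_1 M_ge2 l4 in auto)
    then show "S \<in> pairs {v \<in> V. b v < M}" unfolding xy(1) pair_mem_pairs by blast
  next
    fix x y z assume xy: "{x, y} \<in> to_inner \<Psi>" and z: "z \<in> {v \<in> V. b v < M}" "z \<noteq> x" "b z \<le> b y"
    have z1: "z = 1 \<or> z \<in> {2..int l}" using z(1) by auto
    have "inner_rel \<Psi> x y" using xy mem_to_inner by simp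
    then have "inner_rel \<Psi> x z"
      unfolding inner_rel_def[of \<Psi> x y]
    proof (elim disjE conjE)
      assume a: "x \<in> {2..int l}" "y \<in> {2..int l}" "{x, y} \<in> \<Psi>"
      then have a': "{y, x} \<in> \<Psi>" by (simp add: insert_commute)
      show ?thesis
      proof (cases "z = 1")
        case True
        then show ?thesis using no[OF a'] a by (simp add: inner_rel_def)
      next
        case False
        then have z2: "z \<in> {2..int l}" using z1 by simp
        then have "{x, z} \<in> \<Psi>"
          using W_le[of y z] z a by (intro D(3)[OF a(3)]) (auto simp: signed_def)
        then show ?thesis using z2 a by (simp add: inner_rel_def)
      qed
    next
      assume a: "x = 1" "y \<in> {2..int l}" "{1, - y} \<notin> \<Psi>"
      have z2: "z \<in> {2..int l}" using z1 z(2) a(1) by auto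
      have "{1, - z} \<notin> \<Psi>"
      proof
        assume n: "{1, - z} \<in> \<Psi>"
        have "W (- z) \<le> W (- y)" using W_le[of y z] z z2 a by (auto simp: odd)
        then have "{1, - y} \<in> \<Psi>"
          using z2 a n by (cases "y = z") (auto simp: signed_def intro!: D(3)[OF n])
        then show False using a(3) by simp
      qed
      then show ?thesis using a z2 by (simp add: inner_rel_def)
    next
      assume a: "y = 1" "x \<in> {2..int l}" "{1, - x} \<notin> \<Psi>"
      then have "z = 1" using z(3) z1 b_ge2[of z] b_1 by auto
      then show ?thesis using a by (simp add: inner_rel_def)
    qed
    then show "{x, z} \<in> to_inner \<Psi>" using mem_to_inner by simp
  qed
qed

lemma to_special:
  assumes \<Theta>: "\<Theta> \<in> inner"
  shows "to_special \<Theta> \<in> special"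
proof -
  have mem: "x \<in> V \<and> y \<in> V \<and> b x < M \<and> b y < M \<and> x \<noteq> y" if "{x, y} \<in> \<Theta>" for x y
    using threshold_sets_subset[OF \<Theta> that] by auto
  have V1: "b (1::int) < M" "1 \<in> V" using b_1 M_ge2 l4 by auto
  have pos: "0 < W y" if "{x, y} \<in> \<Theta>" for x y
    using mem[OF that] W_zero[of y] W_nonneg[of y] by force
  have to1: "{1, y} \<in> \<Theta>" if "{x, y} \<in> \<Theta>" "y \<noteq> 1" for x y
    using threshold_setsD_left[OF \<Theta> that(1), of 1] that(2) V1 b_1 mem[OF that(1)] b_range[of x] by auto
  have W1: "W 1 > 0" using W_first[of 2] W_nonneg[of 2] l4 by auto
  have "to_special \<Theta> \<in> ideals"
  proof (rule abelian_pair_idealsI)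
    show "to_special \<Theta> \<subseteq> signed_pairs l"
    proof
      fix S assume "S \<in> to_special \<Theta>"
      then obtain x y where xy: "S = {x, y}" "special_rel \<Theta> x y" by (auto simp: to_special_def)
      have "x \<in> signed l \<and> y \<in> signed l \<and> x \<noteq> y \<and> x \<noteq> - y"
        using xy(2) mem[of x y] l4 unfolding special_rel_def by (elim disjE conjE) (auto simp: signed_def)
      then show "S \<in> signed_pairs l" using xy(1) pair_mem_signed_pairs by blast
    qed
    show "W x + W y > 0" if "{x, y} \<in> to_special \<Theta>" for x y
      using that unfolding mem_to_special special_rel_def
    proof (elim disjE conjE)
      assume "x \<in> {2..int l}" "y \<in> {2..int l}" "{x, y} \<in> \<Theta>"
      then show ?thesis using pos[of x y] W_nonneg[of x] by auto
    qed (use W1 W_nonneg[of x] W_nonneg[of y] W_first[of "- x"] W_first[of "- y"] odd[of x] odd[of y] in auto)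
  next
    fix x y z
    assume xy: "{x, y} \<in> to_special \<Theta>" and z: "z \<in> signed l" "z \<noteq> x" "z \<noteq> - x" "z \<noteq> y" "z \<noteq> - y" "W y \<le> W z"
    have zc: "z = 1 \<or> z = - 1 \<or> z \<in> {2..int l} \<or> - z \<in> {2..int l}" using z(1) by (auto simp: signed_def)
    have top: False if "y = 1"
      using zc
    proof (elim disjE)
      assume "- z \<in> {2..int l}"
      then show False using W_nonneg[of "- z"] odd[of z] z(6) that W1 by auto
    qed (use z that W_first[of z] in auto)
    have zm1: "z \<noteq> - 1" if "- y \<in> {2..int l} \<or> y \<in> {2..int l}"
      using that z(6) W_first[of "- y"] W_nonneg[of y] W1 odd[of y] odd[of 1] by auto
    have "special_rel \<Theta> x y" using xy mem_to_special by simp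
    then have "special_rel \<Theta> x z"
      unfolding special_rel_def[of \<Theta> x y]
    proof (elim disjE conjE)
      assume a: "x \<in> {2..int l}" "y \<in> {2..int l}" "{x, y} \<in> \<Theta>"
      have "\<not> - z \<in> {2..int l}" using pos[OF a(3)] W_nonneg[of "- z"] z(6) odd[of z] by auto
      then have zc: "z = 1 \<or> z \<in> {2..int l}" using zc zm1 a(2) by auto
      then show ?thesis
      proof
        assume z2: "z \<in> {2..int l}"
        then have bz: "b z \<le> b y" using W_le[of y z] a z(6) by auto
        then have "{x, z} \<in> \<Theta>"
          using threshold_setsD[OF \<Theta> a(3), of z] z2 z(2) mem[OF a(3)] by auto
        then show ?thesis using a z2 by (simp add: special_rel_def)
      qed (use a in \<open>simp add: special_rel_def\<close>)
    next
      assume a: "x = 1" "y \<in> {2..int l}"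
      have zc: "z \<in> {2..int l} \<or> - z \<in> {2..int l}" using zc z(2,3) a(1) by auto
      then show ?thesis
      proof
        assume z2: "- z \<in> {2..int l}"
        have "\<not> 0 < W (- z)" using z(6) W_nonneg[of y] a(2) odd[of z] by auto
        then have "{1, - z} \<notin> \<Theta>" using pos[of 1 "- z"] by blast
        then show ?thesis using a z2 by (simp add: special_rel_def)
      qed (use a in \<open>simp add: special_rel_def\<close>)
    next
      assume a: "x = 1" "- y \<in> {2..int l}" "{1, - y} \<notin> \<Theta>"
      have zc: "z \<in> {2..int l} \<or> - z \<in> {2..int l}" using zc z(2,3) a(1) by auto
      then show ?thesis
      proof
        assume z2: "- z \<in> {2..int l}"
        have bz: "b (- y) \<le> b (- z)" using W_le[of "- z" "- y"] z(6) odd[of z] odd[of y] a(2) z2 by auto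
        have "{1, - z} \<notin> \<Theta>"
        proof
          assume n: "{1, - z} \<in> \<Theta>"
          then have "{1, - y} \<in> \<Theta>"
            using threshold_setsD[OF \<Theta> n, of "- y"] bz a(2) mem[OF n] by auto
          then show False using a(3) by simp
        qed
        then show ?thesis using a z2 by (simp add: special_rel_def)
      qed (use a in \<open>simp add: special_rel_def\<close>)
    qed (use top in auto)
    then show "{x, z} \<in> to_special \<Theta>" using mem_to_special by simp
  next
    fix x y z assume "{x, y} \<in> to_special \<Theta>" "{- y, z} \<in> to_special \<Theta>"
    then have r: "special_rel \<Theta> x y" "special_rel \<Theta> (- y) z" using mem_to_special by auto
    have *: "x = 1 \<and> z = 1"
      if r: "special_rel \<Theta> x y" "special_rel \<Theta> (- y) z" "y \<in> {2..int l}" for x y z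
    proof -
      have z: "z = 1" "{1, y} \<notin> \<Theta>" using r(2,3) by (auto simp: special_rel_def)
      have "x = 1" using r(1,3) z(2) to1[of x y] by (auto simp: special_rel_def)
      then show ?thesis using z(1) by simp
    qed
    consider "y \<in> {2..int l}" | "- y \<in> {2..int l}" | "y = 1"
      using r(1) l4 unfolding special_rel_def by (elim disjE conjE) auto
    then show "z = x \<or> z = - x"
    proof cases
      case 1
      then show ?thesis using *[OF r] by simp
    next
      case 2
      then show ?thesis using *[of z "- y" x] special_rel_sym[OF r(1)] special_rel_sym[OF r(2)] by simp
    next
      case 3
      then show ?thesis using r(2) by (auto simp: special_rel_def)
    qed
  qed
  moreover have "{1, int l} \<in> to_special \<Theta>" using l4 by (simp add: mem_to_special special_rel_def)
  moreover have "{1, int l} \<notin> \<Theta>" using mem[of 1 "int l"] b_l by auto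
  then have "{1, - int l} \<in> to_special \<Theta>" using l4 by (simp add: mem_to_special special_rel_def)
  ultimately show ?thesis by (simp add: special_def)
qed

lemma to_inner_to_special:
  assumes \<Theta>: "\<Theta> \<in> inner"
  shows "to_inner (to_special \<Theta>) = \<Theta>"
proof -
  have mem: "x \<in> V \<and> y \<in> V \<and> x \<noteq> y" if "{x, y} \<in> \<Theta>" for x y
    using threshold_sets_subset[OF \<Theta> that] by auto
  have rel: "inner_rel (to_special \<Theta>) x y \<longleftrightarrow> {x, y} \<in> \<Theta>" for x y
  proof -
    have V: "v \<in> V \<longleftrightarrow> v = 1 \<or> v \<in> {2..int l}" for v using l4 by auto
    consider "x \<in> {2..int l}" "y \<in> {2..int l}" | "x = 1" "y \<in> {2..int l}" | "y = 1" "x \<in> {2..int l}"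
      | "x = 1" "y = 1" | "\<not> (x \<in> V \<and> y \<in> V)" unfolding V by blast
    then show ?thesis
    proof cases
      case 3
      then show ?thesis by (auto simp: inner_rel_def mem_to_special special_rel_def insert_commute)
    next
      case 5
      then show ?thesis using mem[of x y] l4 by (auto simp: inner_rel_def)
    qed (use mem[of x y] in \<open>auto simp: inner_rel_def mem_to_special special_rel_def\<close>)
  qed
  show ?thesis
  proof (rule set_eqI)
    fix S
    have "\<exists>x y. S = {x, y}" if "S \<in> \<Theta> \<or> S \<in> to_inner (to_special \<Theta>)"
      using that
    proof
      assume "S \<in> \<Theta>"
      then have "S \<in> pairs {v \<in> V. b v < M}" using \<Theta> unfolding threshold_sets_def by blast
      then show ?thesis by (elim pairsE) blast
    qed (auto simp: to_inner_def)
    then show "S \<in> to_inner (to_special \<Theta>) \<longleftrightarrow> S \<in> \<Theta>" using mem_to_inner rel by metis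
  qed
qed

lemma to_special_to_inner:
  assumes \<Psi>: "\<Psi> \<in> special"
  shows "to_special (to_inner \<Psi>) = \<Psi>"
proof -
  have \<Psi>i: "\<Psi> \<in> ideals" and l1: "{1, int l} \<in> \<Psi>" using \<Psi> by (auto simp: special_def)
  note D = abelian_pair_idealsD[OF \<Psi>i]
  have first: "{1, y} \<in> \<Psi>" if "y \<in> {2..int l}" for y
    using that W_le[of "int l" y] b_range[of y] b_l l4 by (intro D(3)[OF l1]) (auto simp: signed_def)
  have in1: "inner_rel \<Psi> 1 y \<longleftrightarrow> {1, - y} \<notin> \<Psi>" if "y \<in> {2..int l}" for y
    using that by (auto simp: inner_rel_def)
  have in2: "inner_rel \<Psi> x y \<longleftrightarrow> {x, y} \<in> \<Psi>" if "x \<in> {2..int l}" "y \<in> {2..int l}" for x y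
    using that by (auto simp: inner_rel_def)
  have "special_rel (to_inner \<Psi>) x y" if xy: "{x, y} \<in> \<Psi>" for x y
    using \<Psi>i xy
  proof (cases rule: ideal_cases)
    case (positive u v)
    have 1: "w = 1 \<or> w \<in> {2..int l}" if "w \<in> V" for w using that by auto
    have "x \<in> V" "y \<in> V" "x \<noteq> y" using positive by (auto simp: doubleton_eq_iff)
    then show ?thesis using 1[of x] 1[of y] in2[of x y] xy
      by (auto simp: special_rel_def mem_to_inner)
  next
    case (negative u v)
    have u: "u = 1" using special_negative_first[OF \<Psi>] xy negative by auto
    then have v: "v \<in> {2..int l}" using negative by auto
    have nv: "{1, v} \<notin> to_inner \<Psi>"
      using in1[OF v] xy negative(1) u by (simp add: mem_to_inner)
    have "x = 1 \<and> y = - v \<or> x = - v \<and> y = 1" using negative(1) u by (simp add: doubleton_eq_iff)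
    then show ?thesis
    proof
      assume "x = 1 \<and> y = - v"
      then show ?thesis unfolding special_rel_def using v nv by simp
    next
      assume "x = - v \<and> y = 1"
      then show ?thesis unfolding special_rel_def using v nv by simp
    qed
  qed
  moreover have "{x, y} \<in> \<Psi>" if "special_rel (to_inner \<Psi>) x y" for x y
    using that unfolding special_rel_def mem_to_inner
  proof (elim disjE conjE)
    assume a: "y = 1" "x \<in> {2..int l}"
    then show ?thesis using first[of x] by (simp add: insert_commute)
  next
    assume a: "y = 1" "- x \<in> {2..int l}" "\<not> inner_rel \<Psi> 1 (- x)"
    then show ?thesis using in1[of "- x"] by (simp add: insert_commute)
  next
    assume a: "x = 1" "- y \<in> {2..int l}" "\<not> inner_rel \<Psi> 1 (- y)"
    then show ?thesis using in1[of "- y"] by simp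
  qed (use first in2 in auto)
  ultimately have rel: "special_rel (to_inner \<Psi>) x y \<longleftrightarrow> {x, y} \<in> \<Psi>" for x y by blast
  show ?thesis
  proof (rule set_eqI)
    fix S
    have "\<exists>x y. S = {x, y}" if "S \<in> \<Psi> \<or> S \<in> to_special (to_inner \<Psi>)"
      using that
    proof
      assume "S \<in> \<Psi>"
      then have "S \<in> signed_pairs l" using \<Psi>i unfolding abelian_pair_ideals_def by blast
      then show ?thesis by (elim signed_pairsE) blast
    qed (auto simp: to_special_def)
    then show "S \<in> to_special (to_inner \<Psi>) \<longleftrightarrow> S \<in> \<Psi>" using mem_to_special rel by metis
  qed
qed

lemma card_special: "card special = card inner"
  by (rule bij_betw_same_card[of to_inner], rule bij_betw_byWitness[of _ to_special])
    (use to_inner to_special to_inner_to_special to_special_to_inner in blast)+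

end

text \<open>If only the last index has weight \<open>0\<close>, then changing its sign is a symmetry, and a set of positive pairs
  remains one under it if and only if it avoids the last block.\<close>

lemma card_ideals:
  "card ideals + (if c = 0 \<and> b (int l - 1) < M then card inner else 0) =
    (if c = 0 \<and> b (int l - 1) < M then 2 * card (threshold_sets b V)
     else if c = 1 then card (threshold_sets b V) else card inner) + (if b 2 = 1 then 0 else card inner)"
proof -
  let ?A = "{\<Psi> \<in> ideals. \<Psi> \<subseteq> pairs V}" and ?A' = "{\<Psi> \<in> ideals. image (flip_last l) ` \<Psi> \<subseteq> pairs V}"
  have fin: "finite ideals" by (rule finite_abelian_pair_ideals)
  have sp: "special \<subseteq> ideals" by (auto simp: special_def)
  have cs: "card special = (if b 2 = 1 then 0 else card inner)"
    using special_empty card_special by simp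
  show ?thesis
  proof (cases "b (int l - 1) < M")
    case True
    then have c: "c = 0" using c1 c01 by auto
    have Wl: "W (int l) = 0" using W_zero[of "int l"] c b_l l4 by simp
    have flipW: "W \<circ> flip_last l = W"
    proof (rule ext)
      fix z
      show "(W \<circ> flip_last l) z = W z"
        using Wl odd[of "int l"] by (cases "z = int l"; cases "z = - int l") (auto simp: flip_last_def abs_if)
    qed
    have flip: "image (flip_last l) ` \<Psi> \<in> ideals" if "\<Psi> \<in> ideals" for \<Psi>
      using flip_abelian_pair_ideals[of \<Psi> W l] that unfolding flipW .
    have A: "?A = threshold_sets b V" using positive_ideals True by simp
    have "?A' = image (image (flip_last l)) ` ?A"
    proof
      show "?A' \<subseteq> image (image (flip_last l)) ` ?A"
      proof
        fix \<Psi> assume "\<Psi> \<in> ?A'"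
        then have "image (flip_last l) ` \<Psi> \<in> ?A" using flip by simp
        moreover have "\<Psi> = image (flip_last l) ` image (flip_last l) ` \<Psi>" by (simp add: image_image)
        ultimately show "\<Psi> \<in> image (image (flip_last l)) ` ?A" by (rule rev_image_eqI)
      qed
      show "image (image (flip_last l)) ` ?A \<subseteq> ?A'"
        using flip by (auto simp: image_image)
    qed
    then have A': "card ?A' = card ?A" by (simp add: card_image inj_on_subset[OF inj_flip])
    have lo: "v \<in> V \<and> b v < M \<longleftrightarrow> v \<in> V \<and> v \<noteq> int l" for v
      using b_mono[of v "int l - 1"] True b_l by force
    have "?A \<inter> ?A' = {\<Psi> \<in> ideals. \<Psi> \<subseteq> pairs {v \<in> V. b v < M}}"
    proof (intro set_eqI iffI)
      fix \<Psi> assume \<Psi>: "\<Psi> \<in> ?A \<inter> ?A'"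
      have "S \<in> pairs {v \<in> V. b v < M}" if S: "S \<in> \<Psi>" for S
      proof -
        have "S \<in> pairs V" using S \<Psi> by auto
        then obtain x y where xy: "S = {x, y}" "x \<in> V" "y \<in> V" "x \<noteq> y" by (rule pairsE)
        have "flip_last l ` S \<in> pairs V" using S \<Psi> by auto
        then have "flip_last l x \<in> V" "flip_last l y \<in> V" using xy(1) by (auto simp: pair_mem_pairs)
        then have "x \<noteq> int l" "y \<noteq> int l" by (auto simp: flip_last_def)
        then show ?thesis using xy lo by (simp add: pair_mem_pairs)
      qed
      then show "\<Psi> \<in> {\<Psi> \<in> ideals. \<Psi> \<subseteq> pairs {v \<in> V. b v < M}}" using \<Psi> by auto
    next
      fix \<Psi> assume \<Psi>: "\<Psi> \<in> {\<Psi> \<in> ideals. \<Psi> \<subseteq> pairs {v \<in> V. b v < M}}"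
      have "S \<in> pairs V \<and> flip_last l ` S \<in> pairs V" if S: "S \<in> \<Psi>" for S
      proof -
        have "S \<in> pairs {v \<in> V. b v < M}" using S \<Psi> by auto
        then obtain x y where xy: "S = {x, y}" "x \<in> {v \<in> V. b v < M}" "y \<in> {v \<in> V. b v < M}" "x \<noteq> y" by (rule pairsE)
        then have "flip_last l x = x" "flip_last l y = y" using lo[of x] lo[of y] by (auto simp: flip_last_def)
        then show ?thesis using xy by (simp add: pair_mem_pairs)
      qed
      then show "\<Psi> \<in> ?A \<inter> ?A'" using \<Psi> by auto
    qed
    also have "\<dots> = inner" by (rule ideals_of_pairs) simp
    finally have "?A \<inter> ?A' = inner" .
    moreover have "finite ?A" "finite ?A'" using fin by simp_all
    ultimately have "card ?A + card ?A' = card (?A \<union> ?A') + card inner"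
      using card_Un_Int[of ?A ?A'] by simp
    then have int: "card (?A \<union> ?A') + card inner = 2 * card (threshold_sets b V)"
      using A A' by simp
    have "ideals = (?A \<union> ?A') \<union> special" using ideal_trichotomy sp by auto
    moreover have "(?A \<union> ?A') \<inter> special = {}" using special_not_positive by auto
    ultimately have "card ideals = card (?A \<union> ?A') + card special"
      using fin by (metis (no_types, lifting) card_Un_disjoint finite_Un)
    then show ?thesis using int cs True c by simp
  next
    case False
    have "ideals = ?A \<union> special" using ideal_trichotomy sp False by auto
    moreover have "?A \<inter> special = {}" using special_not_positive by auto
    ultimately have "card ideals = card ?A + card special"
      using fin by (metis (no_types, lifting) card_Un_disjoint finite_Un)
    then show ?thesis using cs False positive_ideals c01 by auto
  qed
qed

end

section \<open>The count in terms of blocks\<close>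

declare One_nat_def [simp del]

text \<open>If \<open>k \<in> J\<close> means that \<open>k\<close> and \<open>k + 1\<close> are in the same block, then this is the position of the block of \<open>i\<close>.\<close>

definition block :: "nat set \<Rightarrow> nat \<Rightarrow> nat" where
  "block J i = Suc (card ({1..<i} - J))"

text \<open>For \<open>l \<in> J\<close> the last vertex of the diagram takes the place of the vertex \<open>l - 1\<close>, which explains the
  minimum.\<close>

definition block_keys :: "nat \<Rightarrow> nat set \<Rightarrow> nat set" where
  "block_keys l J = (\<lambda>i. block J (min i (l - 1))) ` J"

text \<open>The number of threshold sets on \<open>m + 1\<close> blocks, by \<open>card_threshold_sets\<close>.\<close>

definition block_sum :: "nat \<Rightarrow> nat set \<Rightarrow> nat \<Rightarrow> nat" where
  "block_sum l J m = 2 ^ m + (\<Sum>p\<in>block_keys l J. m choose (p - 1))"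

lemma block_Suc: "1 \<le> i \<Longrightarrow> block J (Suc i) = (if i \<in> J then block J i else Suc (block J i))"
proof -
  assume i: "1 \<le> i"
  then have "{1..<Suc i} = insert i {1..<i}" by auto
  then have "{1..<Suc i} - J = (if i \<in> J then {1..<i} - J else insert i ({1..<i} - J))" by auto
  then show ?thesis by (simp add: block_def)
qed

lemma block_mono: "i \<le> j \<Longrightarrow> block J i \<le> block J j"
  unfolding block_def by (intro Suc_le_mono[THEN iffD2] card_mono) auto

lemma block_eqD:
  assumes "block J i = block J j" "1 \<le> i" "i \<le> k" "k < j"
  shows "k \<in> J"
proof (rule ccontr)
  assume "k \<notin> J"
  then have "block J (Suc k) = Suc (block J k)" using assms by (simp add: block_Suc)
  moreover have "block J i \<le> block J k" using assms(3) by (rule block_mono)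
  moreover have "block J (Suc k) \<le> block J j" using assms(4) by (intro block_mono) simp
  ultimately show False using assms(1) by simp
qed

lemma block_1: "block J 1 = 1"
  by (simp add: block_def)

lemma block_image: "1 \<le> n \<Longrightarrow> block J ` {1..n} = {1..block J n}"
proof (induction n rule: dec_induct)
  case base
  then show ?case by (simp add: block_1)
next
  case (step n)
  have "{1..Suc n} = insert (Suc n) {1..n}" by auto
  then show ?case using step block_Suc[of n J] by auto
qed

lemma block_value: "1 \<le> i \<Longrightarrow> block J i + card (J \<inter> {1..<i}) = i"
  using card_Int_Diff[of "{1..<i}" J] by (simp add: block_def Int_commute)

lemma weight_at:
  assumes W: "is_weight l J W" and i: "1 \<le> i" "i \<le> l"
  shows "W (int i) = 2 * (int (block J l) - int (block J i)) + W (int l)"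
  using i(2,1)
proof (induction i rule: inc_induct)
  case (step i)
  have "W (int i) - W (int i + 1) = (if i \<in> J then 0 else 2)"
    using W step by (simp add: is_weight_def)
  then show ?case using step block_Suc[of i J] by (simp add: add.commute split: if_splits)
qed simp

lemma block_weight_of_weight:
  assumes l: "l \<ge> 4" and J: "J \<subseteq> {1..l}" and W: "is_weight l J W" and norm: "l - 1 \<in> J \<or> l \<notin> J"
  shows "block_weight l W (\<lambda>z. block J (nat z)) (block J l) (if l - 1 \<in> J \<and> l \<notin> J then 1 else 0)"
proof
  have e: "int (l - 1) = int l - 1" using l by (simp add: of_nat_diff)
  have "W (int l - 1) - W (int l) = (if l - 1 \<in> J then 0 else 2)"
    using W l e bspec[of "{1..<l}" "\<lambda>k. W (int k) - W (int k + 1) = (if k \<in> J then 0 else 2)" "l - 1"]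
    by (auto simp: is_weight_def)
  then have Wl: "W (int l) = (if l - 1 \<in> J \<and> l \<notin> J then 1 else 0)"
    using W norm by (auto simp: is_weight_def split: if_splits)
  show "W (- z) = - W z" for z using W by (simp add: is_weight_def)
  show "W j = 2 * (int (block J l) - int (block J (nat j))) + (if l - 1 \<in> J \<and> l \<notin> J then 1 else 0)"
    if "j \<in> {1..int l}" for j
  proof -
    have "1 \<le> nat j" "nat j \<le> l" "int (nat j) = j" using that by auto
    then show ?thesis using weight_at[OF W, of "nat j"] Wl by simp
  qed
  have "nat ` {1..int l} = {1..l}"
    by (auto simp: image_iff intro!: bexI[of _ "int _"])
  then show "(\<lambda>z. block J (nat z)) ` {1..int l} = {1..block J l}"
    using block_image[of l J] l by (simp add: image_image[symmetric, of "block J" nat])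
  show "block J (nat i) \<le> block J (nat j)" if "i \<le> j" for i j
    using that by (intro block_mono) simp
  assume "(if l - 1 \<in> J \<and> l \<notin> J then 1 else 0) = (1::int)"
  then have "l - 1 \<in> J" by (simp split: if_splits)
  moreover have "nat (int l - 1) = l - 1" "Suc (l - 1) = l" "1 \<le> l - 1" using l by auto
  ultimately show "block J (nat (int l - 1)) = block J l"
    using block_Suc[of "l - 1" J] by simp
qed (use l in auto)

text \<open>The blocks with more than one element are those that contain a link \<open>k \<in> J\<close>.\<close>

lemma repeated_block:
  assumes l: "l \<ge> 4" and J: "J \<subseteq> {1..l}" and norm: "l - 1 \<in> J \<or> l \<notin> J"
  shows "repeated (\<lambda>z. block J (nat z)) {1..int l} = block_keys l J"
proof (intro set_eqI iffI)
  fix p assume "p \<in> repeated (\<lambda>z. block J (nat z)) {1..int l}"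
  then obtain x y where xy: "x \<in> {1..int l}" "y \<in> {1..int l}" "x \<noteq> y" "block J (nat x) = p" "block J (nat y) = p"
    by (auto simp: repeated_def)
  define i j where "i = nat (min x y)" and "j = nat (max x y)"
  have ij: "1 \<le> i" "i < j" "j \<le> l" "block J i = p" "block J j = p"
    using xy by (auto simp: i_def j_def min_def max_def)
  then have "i \<in> J" using block_eqD[of J i j i] by simp
  moreover have "min i (l - 1) = i" using ij by simp
  ultimately show "p \<in> block_keys l J" unfolding block_keys_def using ij(4) by force
next
  fix p assume "p \<in> block_keys l J"
  then obtain i where i: "i \<in> J" "p = block J (min i (l - 1))" by (auto simp: block_keys_def)
  define k where "k = min i (l - 1)"
  have il: "1 \<le> i" "i \<le> l" using i(1) J by auto
  have k: "k \<in> J" "1 \<le> k" "k < l" "p = block J k"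
  proof -
    show "k \<in> J"
    proof (cases "i = l")
      case True
      then show ?thesis using i(1) norm by (simp add: k_def)
    next
      case False
      then have "k = i" using il by (simp add: k_def min_def)
      then show ?thesis using i(1) by simp
    qed
  qed (use i il l in \<open>auto simp: k_def\<close>)
  have "int k \<in> {1..int l}" "int (Suc k) \<in> {1..int l}" "int k \<noteq> int (Suc k)"
    using k by auto
  moreover have "block J (nat (int k)) = p" "block J (nat (int (Suc k))) = p"
    unfolding nat_int using k block_Suc[of k J] by simp_all
  ultimately show "p \<in> repeated (\<lambda>z. block J (nat z)) {1..int l}" unfolding repeated_def by blast
qed

lemma card_abelian_pair_ideals_normalized:
  assumes l: "l \<ge> 4" and J: "J \<subseteq> {1..l}" and W: "is_weight l J W" and norm: "l - 1 \<in> J \<or> l \<notin> J"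
  defines "Q \<equiv> (if block J l = 1 then 1 else block_sum l J (block J l - 2))"
  shows "card (abelian_pair_ideals W l) + (if l - 1 \<notin> J then Q else 0) =
    (if l - 1 \<notin> J then 2 * block_sum l J (block J l - 1)
     else if l \<notin> J then block_sum l J (block J l - 1) else Q) + (if 1 \<in> J then 0 else Q)"
proof -
  interpret B: block_weight l W "\<lambda>z. block J (nat z)" "block J l" "if l - 1 \<in> J \<and> l \<notin> J then 1 else 0"
    by (rule block_weight_of_weight[OF l J W norm])
  let ?b = "\<lambda>z. block J (nat z)" and ?M = "block J l"
  let ?V = "{1..int l}"
  have M: "?M \<ge> 1" by (simp add: block_def)
  have "?b ` ?V = {1..1 + (?M - 1)}" using B.b_image M by simp
  then have F: "card (threshold_sets ?b ?V) = block_sum l J (?M - 1)"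
    by (subst card_threshold_sets) (simp_all add: repeated_block[OF l J norm] block_sum_def)
  have keys: "block_keys l J \<subseteq> {1..?M}"
    using B.b_image unfolding repeated_block[OF l J norm, symmetric] by (auto simp: repeated_def)
  have fin: "finite (block_keys l J)" using keys finite_subset by blast
  have Q: "card B.inner = Q"
  proof (cases "?M = 1")
    case True
    have "\<not> block J n < 1" for n by (simp add: block_def)
    then have "{v \<in> ?V. ?b v < ?M} = {}" by (simp add: True)
    then show ?thesis using True threshold_sets_one_block[of "{} :: int set" ?b 0]
      by (simp add: Q_def pairs_def del: Collect_empty_eq)
  next
    case False
    then have M2: "?M \<ge> 2" using M by simp
    have "?b ` {v \<in> ?V. ?b v < ?M} = ?b ` ?V \<inter> {..<?M}" by auto
    then have "?b ` {v \<in> ?V. ?b v < ?M} = {1..1 + (?M - 2)}" using B.b_image M2 by auto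
    moreover have "finite {v \<in> ?V. ?b v < ?M}" by (rule finite_subset[of _ ?V]) auto
    ultimately have "card B.inner = 2 ^ (?M - 2) + (\<Sum>p\<in>repeated ?b {v \<in> ?V. ?b v < ?M}. (?M - 2) choose (p - 1))"
      by (intro card_threshold_sets)
    also have "repeated ?b {v \<in> ?V. ?b v < ?M} = {p \<in> repeated ?b ?V. p < ?M}"
      by (rule repeated_less)
    also have "\<dots> = {p \<in> block_keys l J. p < ?M}" by (simp only: repeated_block[OF l J norm])
    also have "(\<Sum>p\<in>{p \<in> block_keys l J. p < ?M}. (?M - 2) choose (p - 1)) =
        (\<Sum>p\<in>block_keys l J. (?M - 2) choose (p - 1))"
    proof (rule sum.mono_neutral_left)
      show "\<forall>p\<in>block_keys l J - {p \<in> block_keys l J. p < ?M}. (?M - 2) choose (p - 1) = 0"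
        using keys M2 by (auto intro!: binomial_eq_0)
    qed (use fin in auto)
    finally show ?thesis using False by (simp add: Q_def block_sum_def)
  qed
  have "nat (int l - 1) = l - 1" "Suc (l - 1) = l" "1 \<le> l - 1" using l by auto
  then have b1: "?b (int l - 1) < ?M \<longleftrightarrow> l - 1 \<notin> J"
    using block_Suc[of "l - 1" J] by simp
  have "Suc 1 = 2" by simp
  then have b2: "?b 2 = 1 \<longleftrightarrow> 1 \<in> J" using block_Suc[of 1 J] block_1[of J] by (auto split: if_splits)
  have c: "((if l - 1 \<in> J \<and> l \<notin> J then 1 else 0) = (0::int)) = (\<not> (l - 1 \<in> J \<and> l \<notin> J))"
    "((if l - 1 \<in> J \<and> l \<notin> J then 1 else 0) = (1::int)) = (l - 1 \<in> J \<and> l \<notin> J)" by simp_all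
  show ?thesis using B.card_ideals unfolding F Q b1 b2 c
    by (cases "l - 1 \<in> J"; cases "l \<in> J"; cases "1 \<in> J") simp_all
qed

lemma block_last:
  assumes "l \<ge> 4" "J \<subseteq> {1..l}"
  shows "block J l + card (J - {l}) = l"
    and "block J (l - 1) + card (J - {l - 1, l}) = l - 1"
proof -
  have i: "1 \<le> i \<and> i \<le> l" if "i \<in> J" for i using assms(2) that by auto
  have "J \<inter> {1..<l} = J - {l}" "J \<inter> {1..<l - 1} = J - {l - 1, l}" using i by force+
  then show "block J l + card (J - {l}) = l" "block J (l - 1) + card (J - {l - 1, l}) = l - 1"
    using block_value[of l J] block_value[of "l - 1" J] assms(1) by auto
qed

text \<open>The change of the sign of \<open>l\<close> exchanges the last two simple roots.\<close>

lemma weight_flip: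
  assumes l: "l \<ge> 4" and J: "J \<subseteq> {1..l}" and W: "is_weight l J W" and "l - 1 \<notin> J" "l \<in> J"
  shows "is_weight l (insert (l - 1) (J - {l})) (W \<circ> flip_last l)"
proof -
  let ?W = "W \<circ> flip_last l"
  have odd: "W (- z) = - W z" for z using W by (simp add: is_weight_def)
  have e: "int (l - 1) = int l - 1" using l by (simp add: of_nat_diff)
  have W1: "W (int l - 1) - W (int l) = 2" "W (int l - 1) + W (int l) = 0"
    using W l e assms(4,5) bspec[of "{1..<l}" "\<lambda>k. W (int k) - W (int k + 1) = (if k \<in> J then 0 else 2)" "l - 1"]
    by (auto simp: is_weight_def)
  have Wk: "?W (int k) = W (int k)" if "k < l" for k using that by (simp add: flip_last_def)
  have "?W (int k) - ?W (int k + 1) = (if k \<in> insert (l - 1) (J - {l}) then 0 else 2)" if k: "k \<in> {1..<l}" for k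
  proof (cases "k = l - 1")
    case True
    then have "?W (int k) - ?W (int k + 1) = W (int l - 1) + W (int l)"
      using Wk[of "l - 1"] l e odd by (simp add: flip_last_def)
    then show ?thesis using True W1 by simp
  next
    case False
    then have "Suc k < l" using k by auto
    moreover have s: "int k + 1 = int (Suc k)" by simp
    ultimately have "?W (int k + 1) = W (int k + 1)" unfolding s by (intro Wk)
    then show ?thesis using Wk[of k] k False W by (simp add: is_weight_def)
  qed
  moreover have "?W (int l - 1) + ?W (int l) = 2"
    using Wk[of "l - 1"] l e odd W1 by (simp add: flip_last_def)
  ultimately show ?thesis using odd l by (auto simp: is_weight_def)
qed

lemma block_keys_flip:
  assumes "l \<ge> 4" "J \<subseteq> {1..l}" "l - 1 \<notin> J" "l \<in> J"
  shows "block_keys l (insert (l - 1) (J - {l})) = block_keys l J"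
proof -
  let ?J = "insert (l - 1) (J - {l})"
  have b: "block ?J (min i (l - 1)) = block J (min i (l - 1))" for i
  proof -
    have "{1..<min i (l - 1)} - ?J = {1..<min i (l - 1)} - J" using assms by auto
    then show ?thesis by (simp add: block_def)
  qed
  have "J = insert l (J - {l})" using assms(4) by auto
  then have "block_keys l J = insert (block J (l - 1)) ((\<lambda>i. block J (min i (l - 1))) ` (J - {l}))"
    unfolding block_keys_def by (metis (no_types, lifting) diff_le_self image_insert min.absorb2)
  moreover have "block_keys l ?J = insert (block J (l - 1)) ((\<lambda>i. block J (min i (l - 1))) ` (J - {l}))"
    unfolding block_keys_def image_insert b by simp
  ultimately show ?thesis by simp
qed

theorem card_abelian_pair_ideals:
  assumes l: "l \<ge> 4" and J: "J \<subseteq> {1..l}" and W: "is_weight l J W"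
  defines "r \<equiv> card J" and "t \<equiv> card (J \<inter> {l - 1, l})"
  shows "t = 0 \<Longrightarrow> card (abelian_pair_ideals W l) + (if 1 \<in> J then block_sum l J (l - r - 2) else 0) =
      2 * block_sum l J (l - r - 1)"
    and "t = 1 \<Longrightarrow> card (abelian_pair_ideals W l) =
      block_sum l J (l - r - 1) + (if 1 \<in> J then 0 else block_sum l J (l - r - 2))"
    and "t = 2 \<Longrightarrow> r < l \<Longrightarrow> card (abelian_pair_ideals W l) =
      (if 1 \<in> J then 1 else 2) * block_sum l J (l - r - 1)"
    and "r = l \<Longrightarrow> card (abelian_pair_ideals W l) = 1"
proof -
  have fin: "finite J" using J finite_subset by blast
  have l1: "l - 1 \<noteq> l" "l - 1 \<in> {1..l}" "l \<in> {1..l}" using l by auto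
  {
    assume "t = 0"
    then have n: "l - 1 \<notin> J" "l \<notin> J" using fin by (auto simp: t_def)
    have M: "block J l = l - r" using block_last(1)[OF l J] n by (simp add: r_def)
    have "card J \<le> card {1..l - 2}"
    proof (rule card_mono)
      show "J \<subseteq> {1..l - 2}"
      proof
        fix i assume "i \<in> J"
        then have "i \<in> {1..l}" "i \<noteq> l" "i \<noteq> l - 1" using J n by auto
        then show "i \<in> {1..l - 2}" by auto
      qed
    qed simp
    then have "l - r \<ge> 2" using l by (simp add: r_def)
    then show "card (abelian_pair_ideals W l) + (if 1 \<in> J then block_sum l J (l - r - 2) else 0) =
      2 * block_sum l J (l - r - 1)"
      using card_abelian_pair_ideals_normalized[OF l J W] n M by (simp split: if_splits)
  next
    assume "t = 1"
    have main: "card (abelian_pair_ideals W l) =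
      block_sum l J (l - r - 1) + (if 1 \<in> J then 0 else block_sum l J (l - r - 2))"
      if J: "J \<subseteq> {1..l}" and W: "is_weight l J W" and n: "l - 1 \<in> J" "l \<notin> J" and r: "r = card J" for J W r
    proof -
      have M: "block J l = l - r" using block_last(1)[OF l J] n by (simp add: r)
      have "l - r \<noteq> 1" if "1 \<notin> J"
      proof -
        have "card J \<le> card {2..l - 1}"
        proof (rule card_mono)
          show "J \<subseteq> {2..l - 1}"
          proof
            fix i assume "i \<in> J"
            then have "i \<in> {1..l}" "i \<noteq> l" "i \<noteq> 1" using J n that by auto
            then show "i \<in> {2..l - 1}" by auto
          qed
        qed simp
        then show ?thesis using l by (simp add: r)
      qed
      then show ?thesis using card_abelian_pair_ideals_normalized[OF l J W] n M by auto
    qed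
    show "card (abelian_pair_ideals W l) =
      block_sum l J (l - r - 1) + (if 1 \<in> J then 0 else block_sum l J (l - r - 2))"
    proof (cases "l - 1 \<in> J")
      case True
      then have "l \<notin> J" using \<open>t = 1\<close> l1(1) by (auto simp: t_def)
      then show ?thesis using main[OF J W True] r_def by simp
    next
      case False
      then have lJ: "l \<in> J" using \<open>t = 1\<close> by (auto simp: t_def Int_insert_right split: if_splits)
      let ?J = "insert (l - 1) (J - {l})"
      have J': "?J \<subseteq> {1..l}" using J l1 by auto
      have "card ?J = Suc (card (J - {l}))" using fin False by (subst card_insert_disjoint) auto
      then have c: "r = card ?J" using card_Suc_Diff1[OF fin lJ] by (simp only: r_def)
      have "1 \<in> ?J \<longleftrightarrow> 1 \<in> J" using l by auto
      moreover have "block_sum l ?J = block_sum l J"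
        using block_keys_flip[OF l J False lJ] by (simp add: block_sum_def fun_eq_iff)
      ultimately show ?thesis
        using main[OF J' weight_flip[OF l J W False lJ] _ _ c] l1(1) by (simp add: card_flip_abelian_pair_ideals)
    qed
  next
    assume t: "t = 2" and r: "r < l"
    have n: "l - 1 \<in> J" "l \<in> J" using t by (auto simp: t_def Int_insert_right split: if_splits)
    then have "0 < card J" using fin by (auto simp: card_gt_0_iff)
    then have M: "block J l = Suc (l - r)"
      using block_last(1)[OF l J] fin r n by (simp add: r_def card_Diff_singleton)
    then show "card (abelian_pair_ideals W l) = (if 1 \<in> J then 1 else 2) * block_sum l J (l - r - 1)"
      using card_abelian_pair_ideals_normalized[OF l J W] n r by simp
  next
    assume "r = l"
    then have JJ: "J = {1..l}" using J by (intro card_subset_eq) (auto simp: r_def)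
    then have "block J l = 1" by (auto simp: block_def)
    moreover have "l - 1 \<in> J" "l \<in> J" "1 \<in> J" using JJ l by auto
    ultimately show "card (abelian_pair_ideals W l) = 1"
      using card_abelian_pair_ideals_normalized[OF l J W] by simp
  }
qed

lemma weight_exists:
  assumes "l \<ge> 4"
  shows "\<exists>W. is_weight l J W"
proof -
  \<comment> \<open>The weight of the index \<open>l\<close>.\<close>
  define d :: int where "d = (if l \<in> J then 0 else 1) - (if l - 1 \<in> J then 0 else 1)"
  define w where "w i = 2 * (int (block J l) - int (block J i)) + d" for i
  define W where "W z = sgn z * w (nat \<bar>z\<bar>)" for z
  have Wp: "W (int k) = w k" if "1 \<le> k" for k using that by (simp add: W_def)
  have wS: "w k - w (Suc k) = (if k \<in> J then 0 else 2)" if "1 \<le> k" for k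
    using block_Suc[OF that, of J] by (simp add: w_def)
  have "W (int k) - W (int k + 1) = (if k \<in> J then 0 else 2)" if "k \<in> {1..<l}" for k
    using Wp[of k] Wp[of "Suc k"] wS[of k] that by (simp add: add.commute)
  moreover have "W (int l - 1) + W (int l) = (if l \<in> J then 0 else 2)"
  proof -
    have "int l - 1 = int (l - 1)" using assms by (simp add: of_nat_diff)
    then have "W (int l - 1) = w (l - 1)" using Wp[of "l - 1"] assms by simp
    moreover have "W (int l) = d" using Wp[of l] assms by (simp add: w_def)
    moreover have "w (l - 1) - d = (if l - 1 \<in> J then 0 else 2)"
      using wS[of "l - 1"] assms by (simp add: w_def)
    ultimately show ?thesis by (simp add: d_def split: if_splits)
  qed
  moreover have "W (- z) = - W z" for z by (simp add: W_def)
  ultimately show ?thesis unfolding is_weight_def by blast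
qed

section \<open>Connected components\<close>

text \<open>The key is made to separate the connected components. It is the position of the block, with \<open>l\<close> in the
  place of \<open>l - 1\<close>; only if \<open>l - 1\<close> and \<open>l\<close> belong to different components, \<open>l\<close> needs another value.\<close>

definition component_key :: "nat \<Rightarrow> nat set \<Rightarrow> nat \<Rightarrow> nat" where
  "component_key l J i = (if i = l \<and> l - 1 \<in> J \<and> l - 2 \<notin> J then 0 else block J (min i (l - 1)))"

lemma block_nonzero: "block J i \<noteq> 0"
  by (simp add: block_def)

lemma component_key_edge:
  assumes "l \<ge> 4" "i \<in> J" "1 \<le> i" "D_edge l i j"
  shows "component_key l J i = component_key l J j"
  using assms(4) unfolding D_edge_def
proof (elim disjE conjE)
  assume "j = i + 1" "j \<le> l - 2"
  then have "i \<noteq> l" "j \<noteq> l" "min i (l - 1) = i" "min j (l - 1) = Suc i" using assms(1) by auto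
  then show ?thesis using assms(2,3) block_Suc[of i J] by (simp add: component_key_def)
next
  assume i: "i = l - 2" and j: "j = l - 1"
  then have "Suc i = l - 1" "i \<noteq> l" "j \<noteq> l" "min i (l - 1) = i" "min j (l - 1) = Suc i" using assms(1) by auto
  then show ?thesis using assms(2,3) block_Suc[of i J] by (simp add: component_key_def)
next
  assume i: "i = l - 2" and j: "j = l"
  then have "Suc i = l - 1" "i \<noteq> l" "min i (l - 1) = i" "min j (l - 1) = Suc i" "l - 2 \<in> J" using assms(1,2) by auto
  then show ?thesis using assms(2,3) block_Suc[of i J] by (simp add: component_key_def)
qed

context type_D
begin

abbreviation key :: "nat set \<Rightarrow> nat \<Rightarrow> nat" where "key \<equiv> component_key l"

definition bond_rel :: "nat set \<Rightarrow> (('g \<Rightarrow> complex) \<times> ('g \<Rightarrow> complex)) set" where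
  "bond_rel J = {(\<beta>, \<gamma>). \<beta> \<in> \<alpha> ` J \<and> \<gamma> \<in> \<alpha> ` J \<and> \<beta> \<noteq> \<gamma> \<and> dynkin_bonds H \<beta> \<gamma> \<noteq> 0}"

lemma \<alpha>_eq: "i \<in> {1..l} \<Longrightarrow> j \<in> {1..l} \<Longrightarrow> \<alpha> i = \<alpha> j \<longleftrightarrow> i = j"
  by (rule inj_on_eq_iff[OF inj_\<alpha>])

lemma bond_rel_iff:
  assumes "J \<subseteq> {1..l}" "i \<in> J" "j \<in> J"
  shows "(\<alpha> i, \<alpha> j) \<in> bond_rel J \<longleftrightarrow> i \<noteq> j \<and> (D_edge l i j \<or> D_edge l j i)"
proof -
  have ij: "i \<in> {1..l}" "j \<in> {1..l}" using assms by auto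
  show ?thesis
  proof (cases "i = j")
    case False
    then show ?thesis using bonds[OF ij False] \<alpha>_eq[OF ij] assms(2,3) by (simp add: bond_rel_def)
  qed (simp add: bond_rel_def)
qed

lemma connected_same_key:
  assumes J: "J \<subseteq> {1..l}" and i: "i \<in> J" and con: "(\<alpha> i, \<gamma>) \<in> (bond_rel J)\<^sup>*"
  shows "\<exists>j\<in>J. \<gamma> = \<alpha> j \<and> key J j = key J i"
  using con
proof (induction rule: rtrancl_induct)
  case base
  then show ?case using i by auto
next
  case (step \<gamma> \<delta>)
  then obtain j where j: "j \<in> J" "\<gamma> = \<alpha> j" "key J j = key J i" by auto
  obtain k where k: "k \<in> J" "\<delta> = \<alpha> k" using step(2) by (auto simp: bond_rel_def)
  have "D_edge l j k \<or> D_edge l k j" using step(2) bond_rel_iff[OF J j(1) k(1)] j(2) k(2) by simp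
  then have "key J j = key J k"
    using component_key_edge[OF l4] j(1) k(1) J by (metis atLeastAtMost_iff subsetD)
  then show ?case using j(3) k by auto
qed

lemma sym_bond_rel: "J \<subseteq> {1..l} \<Longrightarrow> sym (bond_rel J)"
proof (rule symI)
  fix \<beta> \<gamma> assume J: "J \<subseteq> {1..l}" and r: "(\<beta>, \<gamma>) \<in> bond_rel J"
  then obtain i j where ij: "i \<in> J" "j \<in> J" "\<beta> = \<alpha> i" "\<gamma> = \<alpha> j" by (auto simp: bond_rel_def)
  then show "(\<gamma>, \<beta>) \<in> bond_rel J"
    using r bond_rel_iff[OF J ij(1,2)] bond_rel_iff[OF J ij(2,1)] by auto
qed

lemma chain_connected:
  assumes J: "J \<subseteq> {1..l}" and ab: "a \<le> b" "b \<le> l - 1" "{a..b} \<subseteq> J"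
  shows "(\<alpha> a, \<alpha> b) \<in> (bond_rel J)\<^sup>*"
  using ab
proof (induction b rule: dec_induct)
  case (step n)
  then have "(\<alpha> a, \<alpha> n) \<in> (bond_rel J)\<^sup>*" by (auto simp: subset_iff)
  moreover have n: "n \<in> J" "Suc n \<in> J" using step by auto
  have "D_edge l n (Suc n)" using step(4) by (auto simp: D_edge_def)
  then have "(\<alpha> n, \<alpha> (Suc n)) \<in> bond_rel J" using bond_rel_iff[OF J n] by simp
  ultimately show ?case by (rule rtrancl_into_rtrancl)
qed simp

text \<open>Indices \<open>i < j < l\<close> in the same block belong to a chain in \<open>J\<close>. The last vertex is reached through
  \<open>l - 2\<close>.\<close>

lemma same_key_connected:
  assumes J: "J \<subseteq> {1..l}" and ij: "i \<in> J" "j \<in> J" and k: "key J i = key J j"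
  shows "(\<alpha> i, \<alpha> j) \<in> (bond_rel J)\<^sup>*"
proof -
  have *: "(\<alpha> i, \<alpha> j) \<in> (bond_rel J)\<^sup>*" if ij: "i \<in> J" "j \<in> J" "i < j" and k: "key J i = key J j" for i j
  proof -
    have r: "1 \<le> i" "j \<le> l" "i \<noteq> l" "min i (l - 1) = i" using ij J by auto
    then have ki: "key J i = block J i" by (simp add: component_key_def)
    show ?thesis
    proof (cases "j = l")
      case False
      then have jl: "j \<le> l - 1" using r(2) by simp
      then have "block J i = block J j" using k ki False by (simp add: component_key_def min_def)
      then have "{i..b} \<subseteq> J" if "b = j" for b
      proof -
        have "n \<in> J" if "i \<le> n" "n \<le> j" for n
          using block_eqD[OF \<open>block J i = block J j\<close> r(1) that(1)] that(2) ij(2) by (cases "n = j") auto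
        then show ?thesis using that by auto
      qed
      then show ?thesis using chain_connected[OF J _ jl, of i] ij(3) by simp
    next
      case True
      have nz: "\<not> (l - 1 \<in> J \<and> l - 2 \<notin> J)"
      proof
        assume "l - 1 \<in> J \<and> l - 2 \<notin> J"
        then have "key J l = 0" by (simp add: component_key_def)
        then show False using k ki True block_nonzero[of J i] by simp
      qed
      then have "key J l = block J (l - 1)" by (auto simp: component_key_def)
      then have b: "block J i = block J (l - 1)" using k ki True by simp
      have l2: "l - 2 \<in> J" "i \<le> l - 1"
      proof -
        show "i \<le> l - 1" using ij(3) r(2) by simp
        show "l - 2 \<in> J"
        proof (cases "i = l - 1")
          case True
          then show ?thesis using nz ij(1) by simp
        next
          case False
          then show ?thesis using block_eqD[OF b r(1), of "l - 2"] ij(3) r(2) l4 by simp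
        qed
      qed
      have lJ: "l \<in> J" using ij(2) True by simp
      have last: "(\<alpha> (l - 2), \<alpha> l) \<in> bond_rel J"
        using bond_rel_iff[OF J l2(1) lJ] l4 by (simp add: D_edge_def)
      have "(\<alpha> i, \<alpha> (l - 2)) \<in> (bond_rel J)\<^sup>*"
      proof (cases "i = l - 1")
        case True
        then have "(\<alpha> i, \<alpha> (l - 2)) \<in> bond_rel J"
          using bond_rel_iff[OF J ij(1) l2(1)] l4 by (simp add: D_edge_def)
        then show ?thesis by simp
      next
        case False
        then have il: "i \<le> l - 2" using l2(2) by simp
        have "n \<in> J" if "i \<le> n" "n \<le> l - 2" for n
          using block_eqD[OF b r(1) that(1)] that(2) l4 by simp
        then show ?thesis using il by (intro chain_connected[OF J]) auto
      qed
      then show ?thesis using last True by (simp add: rtrancl_into_rtrancl)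
    qed
  qed
  consider "i < j" | "i = j" | "j < i" by linarith
  then show ?thesis
  proof cases
    case 3
    then show ?thesis
      using *[OF ij(2,1) 3 k[symmetric]] sym_rtrancl[OF sym_bond_rel[OF J]] by (auto dest: symD)
  qed (use *[OF ij _ k] in auto)
qed

lemma components_eq:
  assumes J: "J \<subseteq> {1..l}"
  shows "dynkin_components H (\<alpha> ` J) = (\<lambda>i. \<alpha> ` {j \<in> J. key J j = key J i}) ` J"
proof -
  have "((bond_rel J)\<^sup>* \<inter> \<alpha> ` J \<times> \<alpha> ` J) `` {\<alpha> i} = \<alpha> ` {j \<in> J. key J j = key J i}" if i: "i \<in> J" for i
  proof (intro set_eqI iffI)
    fix \<gamma> assume "\<gamma> \<in> ((bond_rel J)\<^sup>* \<inter> \<alpha> ` J \<times> \<alpha> ` J) `` {\<alpha> i}"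
    then show "\<gamma> \<in> \<alpha> ` {j \<in> J. key J j = key J i}" using connected_same_key[OF J i, of \<gamma>] by auto
  next
    fix \<gamma> assume "\<gamma> \<in> \<alpha> ` {j \<in> J. key J j = key J i}"
    then obtain j where "j \<in> J" "key J j = key J i" "\<gamma> = \<alpha> j" by auto
    then show "\<gamma> \<in> ((bond_rel J)\<^sup>* \<inter> \<alpha> ` J \<times> \<alpha> ` J) `` {\<alpha> i}"
      using same_key_connected[OF J i, of j] i by auto
  qed
  then show ?thesis
    unfolding dynkin_components_def quotient_def bond_rel_def[symmetric] by auto
qed

end

locale ordered_components = type_D H l \<alpha> for H :: "'g::complex_lie_algebra set" and l \<alpha> +
  fixes J :: "nat set" and C :: "nat \<Rightarrow> ('g \<Rightarrow> complex) set" and s :: nat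
  assumes J: "J \<subseteq> {1..l}" and C: "bij_betw C {1..s} (dynkin_components H (\<alpha> ` J))"
    and ordered: "\<And>j k. 1 \<le> j \<Longrightarrow> j < k \<Longrightarrow> k \<le> s \<Longrightarrow> min_index l \<alpha> (C j) < min_index l \<alpha> (C k)"
begin

abbreviation "m j \<equiv> min_index l \<alpha> (C j)"
abbreviation "L j \<equiv> shifted_index l \<alpha> C s j"

lemma finite_J: "finite J"
  using J finite_subset by blast

lemma \<alpha>_eq_J: "i \<in> J \<Longrightarrow> k \<in> J \<Longrightarrow> \<alpha> i = \<alpha> k \<longleftrightarrow> i = k"
  by (rule inj_on_eq_iff[OF inj_on_subset[OF inj_\<alpha> J]])

lemma component:
  assumes j: "j \<in> {1..s}"
  shows "m j \<in> J" "C j = \<alpha> ` {i \<in> J. key J i = key J (m j)}"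
    "\<And>i. i \<in> J \<Longrightarrow> key J i = key J (m j) \<Longrightarrow> m j \<le> i"
proof -
  have "C j \<in> dynkin_components H (\<alpha> ` J)" using C j by (auto simp: bij_betw_def)
  then obtain i where i: "i \<in> J" "C j = \<alpha> ` {i' \<in> J. key J i' = key J i}"
    unfolding components_eq[OF J] by auto
  let ?K = "{i' \<in> J. key J i' = key J i}"
  have "{i' \<in> {1..l}. \<alpha> i' \<in> C j} = ?K"
    using J \<alpha>_eq unfolding i(2) by (auto simp: subset_iff)
  then have mK: "m j = Min ?K" by (simp add: min_index_def)
  have fin: "finite ?K" "?K \<noteq> {}" using finite_J i(1) by auto
  have "m j \<in> ?K" unfolding mK using fin by (rule Min_in)
  then show "m j \<in> J" and "C j = \<alpha> ` {i \<in> J. key J i = key J (m j)}" using i(2) by auto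
  show "m j \<le> i'" if "i' \<in> J" "key J i' = key J (m j)" for i'
    unfolding mK using fin that \<open>m j \<in> ?K\<close> by (intro Min_le) auto
qed

lemma mem_component: "j \<in> {1..s} \<Longrightarrow> \<gamma> \<in> C j \<longleftrightarrow> (\<exists>i\<in>J. \<gamma> = \<alpha> i \<and> key J i = key J (m j))"
  by (subst component(2), assumption) blast

lemma key_inj:
  assumes "j \<in> {1..s}" "k \<in> {1..s}" "key J (m j) = key J (m k)"
  shows "j = k"
proof -
  have "C j = C k"
    using mem_component[OF assms(1)] mem_component[OF assms(2)] assms(3) by (intro set_eqI) simp
  then show ?thesis using C assms(1,2) unfolding bij_betw_def by (elim conjE inj_onD)
qed

lemma key_surj:
  assumes "i \<in> J"
  obtains j where "j \<in> {1..s}" "key J i = key J (m j)"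
proof -
  have "\<alpha> ` {i' \<in> J. key J i' = key J i} \<in> dynkin_components H (\<alpha> ` J)"
    unfolding components_eq[OF J] using assms by auto
  then have "\<alpha> ` {i' \<in> J. key J i' = key J i} \<in> C ` {1..s}"
    using bij_betw_imp_surj_on[OF C] by (simp only:)
  then obtain j where j: "\<alpha> ` {i' \<in> J. key J i' = key J i} = C j" "j \<in> {1..s}"
    by (rule imageE)
  have "\<alpha> i \<in> C j" unfolding j(1)[symmetric] using assms by auto
  then obtain k where k: "k \<in> J" "key J k = key J (m j)" "\<alpha> i = \<alpha> k" using mem_component[OF j(2)] by auto
  then have "i = k" using \<alpha>_eq_J assms by auto
  then show ?thesis using that j(2) k(2) by auto
qed

lemma min_index_mono: "j \<in> {1..s} \<Longrightarrow> k \<in> {1..s} \<Longrightarrow> m j < m k \<longleftrightarrow> j < k"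
  using ordered[of j k] ordered[of k j] by (cases j k rule: linorder_cases) auto

lemma key_nonzero: "key J i \<noteq> 0 \<Longrightarrow> key J i = block J (min i (l - 1))"
  by (auto simp: component_key_def split: if_splits)

text \<open>A component is an interval of the chain, apart from the last vertex; so the components that begin
  earlier consist of smaller indices.\<close>

lemma earlier_components:
  assumes j: "j \<in> {1..s}"
  shows "(\<Sum>k=1..<j. card (C k)) = card (J \<inter> {1..<m j})"
proof -
  have sub: "{1..<j} \<subseteq> {1..s}" using j by auto
  have fin: "finite (C k)" if "k \<in> {1..s}" for k
    by (subst component(2)[OF that]) (simp add: finite_J)
  have "C k \<inter> C k' = {}" if k: "k \<in> {1..s}" "k' \<in> {1..s}" "k \<noteq> k'" for k k'
  proof (rule ccontr)
    assume "C k \<inter> C k' \<noteq> {}"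
    then obtain i i' where i: "i \<in> J" "i' \<in> J" "key J i = key J (m k)" "key J i' = key J (m k')" "\<alpha> i = \<alpha> i'"
      using mem_component[OF k(1)] mem_component[OF k(2)] by auto
    then have "i = i'" using \<alpha>_eq_J by auto
    then show False using i key_inj[OF k(1,2)] k(3) by auto
  qed
  then have "(\<Sum>k=1..<j. card (C k)) = card (\<Union>k\<in>{1..<j}. C k)"
    using sub fin by (subst card_UN_disjoint) (auto simp: subset_iff)
  also have "(\<Union>k\<in>{1..<j}. C k) = \<alpha> ` (J \<inter> {1..<m j})"
  proof
    show "(\<Union>k\<in>{1..<j}. C k) \<subseteq> \<alpha> ` (J \<inter> {1..<m j})"
    proof
      fix \<gamma> assume "\<gamma> \<in> (\<Union>k\<in>{1..<j}. C k)"
      then obtain k where k: "k \<in> {1..<j}" "\<gamma> \<in> C k" by auto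
      then have ks: "k \<in> {1..s}" using sub by auto
      obtain i where i: "i \<in> J" "key J i = key J (m k)" "\<gamma> = \<alpha> i" using k(2) mem_component[OF ks] by auto
      have mk: "m k < m j" using min_index_mono[OF ks j] k(1) by simp
      have "key J (m k) \<noteq> key J (m j)" using key_inj[OF ks j] k(1) by auto
      have ml: "m j \<le> l" "m k \<noteq> l" using component(1)[OF j] J mk by auto
      have "i < m j"
      proof (rule ccontr)
        assume "\<not> i < m j"
        then have le: "m j \<le> i" by simp
        have kk: "key J (m k) \<noteq> 0" using ml block_nonzero by (auto simp: component_key_def)
        have "i \<noteq> m j" using i(2) \<open>key J (m k) \<noteq> key J (m j)\<close> by auto
        then have "m j \<noteq> l" using le i(1) J by auto
        then have kj: "key J (m j) = block J (min (m j) (l - 1))" by (simp add: component_key_def)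
        have "block J (min (m k) (l - 1)) \<le> block J (min (m j) (l - 1))"
          "block J (min (m j) (l - 1)) \<le> block J (min i (l - 1))"
          using mk le by (auto intro!: block_mono)
        then have "key J (m j) = key J (m k)"
          using kj key_nonzero[OF kk] key_nonzero[of i] i(2) kk by simp
        then show False using \<open>key J (m k) \<noteq> key J (m j)\<close> by simp
      qed
      then show "\<gamma> \<in> \<alpha> ` (J \<inter> {1..<m j})" using i J by auto
    qed
    show "\<alpha> ` (J \<inter> {1..<m j}) \<subseteq> (\<Union>k\<in>{1..<j}. C k)"
    proof clarify
      fix i assume i: "i \<in> J" "i \<in> {1..<m j}"
      obtain k where k: "k \<in> {1..s}" "key J i = key J (m k)" using key_surj[OF i(1)] .
      have "m k < m j" using component(3)[OF k(1) i(1) k(2)] i(2) by simp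
      then have "k \<in> {1..<j}" using min_index_mono[OF k(1) j] k(1) by simp
      moreover have "\<alpha> i \<in> C k" using mem_component[OF k(1)] i(1) k(2) by auto
      ultimately show "\<alpha> i \<in> (\<Union>k\<in>{1..<j}. C k)" by blast
    qed
  qed
  also have "card (\<alpha> ` (J \<inter> {1..<m j})) = card (J \<inter> {1..<m j})"
    using inj_on_subset[OF inj_\<alpha>, of "J \<inter> {1..<m j}"] J by (intro card_image) auto
  finally show ?thesis .
qed

text \<open>The indices below \<open>m j\<close> that are not in \<open>J\<close> are the ends of the earlier blocks, and their number is
  \<open>m j\<close> minus \<open>1\<close> minus the size of the earlier components. If \<open>m j = l\<close>, then \<open>l\<close> takes the place of \<open>l - 1\<close>, and
  the additional \<open>1\<close> in the definition corrects this.\<close>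

lemma shifted_index_eq:
  assumes j: "j \<in> {1..s}" and nz: "key J (m j) \<noteq> 0"
  shows "L j = key J (m j)"
proof -
  have mJ: "m j \<in> J" "1 \<le> m j" "m j \<le> l" using component(1)[OF j] J by auto
  have L: "L j = m j - card (J \<inter> {1..<m j}) - (if j = s \<and> C s = {\<alpha> l} then 1 else 0)"
    unfolding shifted_index_def earlier_components[OF j] ..
  have v: "block J (m j) + card (J \<inter> {1..<m j}) = m j" by (rule block_value[OF mJ(2)])
  show ?thesis
  proof (cases "m j = l")
    case False
    have "\<alpha> (m j) \<in> C j" using component(1)[OF j] mem_component[OF j] by auto
    moreover have "\<alpha> (m j) \<noteq> \<alpha> l" using \<alpha>_eq[of "m j" l] mJ False l4 by auto
    ultimately have "C j \<noteq> {\<alpha> l}" by auto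
    then have "L j = block J (m j)" using L v by auto
    moreover have "min (m j) (l - 1) = m j" using False mJ by arith
    then have "key J (m j) = block J (m j)" using False by (simp add: component_key_def)
    ultimately show ?thesis by simp
  next
    case True
    have l1: "l - 1 \<notin> J"
    proof
      assume l1: "l - 1 \<in> J"
      then have "key J (l - 1) = key J (m j)" using nz True l4 by (auto simp: component_key_def)
      then show False using component(3)[OF j l1] True l4 by simp
    qed
    have "i = l" if "i \<in> J" "key J i = key J (m j)" for i
      using component(3)[OF j that] True J that(1) by auto
    then have Cj: "C j = {\<alpha> l}" using mJ(1) True mem_component[OF j] by (intro set_eqI) auto
    have "j = s"
    proof (rule ccontr)
      assume "j \<noteq> s"
      then have js: "j < s" "s \<in> {1..s}" using j by auto
      then have "l < m s" using ordered[of j s] j True by auto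
      then show False using component(1)[OF js(2)] J by auto
    qed
    moreover have "J \<inter> {1..<l} = J - {l}" "J - {l - 1, l} = J - {l}" using J l1 by force+
    then have "block J (l - 1) + card (J \<inter> {1..<l}) = l - 1" using block_last(2)[OF l4 J] by simp
    ultimately have "L j = block J (l - 1)" using L Cj True by simp
    then show ?thesis using key_nonzero[OF nz] True by simp
  qed
qed

lemma zero_key_last:
  assumes j: "j \<in> {1..s}" and z: "key J (m j) = 0"
  shows "j = s" "m j = l" "l - 1 \<in> J" "l - 2 \<notin> J"
proof -
  have "m j = l \<and> l - 1 \<in> J \<and> l - 2 \<notin> J"
  proof (rule ccontr)
    assume "\<not> ?thesis"
    then have "key J (m j) = block J (min (m j) (l - 1))" by (simp only: component_key_def if_False)
    then show False using z block_nonzero by simp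
  qed
  then show ml: "m j = l" "l - 1 \<in> J" "l - 2 \<notin> J" by auto
  show "j = s"
  proof (rule ccontr)
    assume "j \<noteq> s"
    then have js: "j < s" "s \<in> {1..s}" using j by auto
    then have "l < m s" using ordered[of j s] j ml by auto
    then show False using component(1)[OF js(2)] J by auto
  qed
qed

lemma key_bij: "bij_betw (\<lambda>j. key J (m j)) {1..s} (key J ` J)"
proof (rule bij_betw_imageI)
  show "inj_on (\<lambda>j. key J (m j)) {1..s}" by (rule inj_onI) (rule key_inj)
  show "(\<lambda>j. key J (m j)) ` {1..s} = key J ` J"
  proof
    show "(\<lambda>j. key J (m j)) ` {1..s} \<subseteq> key J ` J" using component(1) by auto
    show "key J ` J \<subseteq> (\<lambda>j. key J (m j)) ` {1..s}"
    proof clarify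
      fix i assume "i \<in> J"
      then obtain j where "j \<in> {1..s}" "key J i = key J (m j)" by (rule key_surj)
      then show "key J i \<in> (\<lambda>j. key J (m j)) ` {1..s}" by (rule rev_image_eqI)
    qed
  qed
qed

lemma sum_shifted_index:
  fixes g :: "nat \<Rightarrow> nat"
  assumes "\<not> (l - 1 \<in> J \<and> l \<in> J \<and> l - 2 \<notin> J)"
  shows "(\<Sum>j=1..s. g (L j)) = (\<Sum>p\<in>block_keys l J. g p)"
proof -
  have k: "key J i = block J (min i (l - 1))" if "i \<in> J" for i
    using assms that by (auto simp: component_key_def)
  then have "block_keys l J = key J ` J" by (simp add: block_keys_def)
  moreover have "key J (m j) \<noteq> 0" if "j \<in> {1..s}" for j
    using k[OF component(1)[OF that]] block_nonzero by simp
  then have "(\<Sum>j=1..s. g (L j)) = (\<Sum>j=1..s. g (key J (m j)))"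
    by (intro sum.cong) (auto simp: shifted_index_eq)
  ultimately show ?thesis using sum.reindex_bij_betw[OF key_bij, of g] by simp
qed

text \<open>The component at the end of the chain has the largest key, for which the summand is zero. If
  \<open>l - 1\<close> and \<open>l\<close> are both isolated, then \<open>l\<close> is the component that is left out, and \<open>l - 1\<close> has that key.\<close>

lemma sum_shifted_index_butlast:
  fixes g :: "nat \<Rightarrow> nat"
  assumes last: "l - 1 \<in> J \<or> l \<in> J" and g: "g (block J (l - 1)) = 0"
  shows "(\<Sum>j=1..s - 1. g (L j)) = (\<Sum>p\<in>block_keys l J. g p)"
proof (cases "l - 1 \<in> J \<and> l \<in> J \<and> l - 2 \<notin> J")
  case True
  obtain j0 where j0: "j0 \<in> {1..s}" "key J l = key J (m j0)" using key_surj[of l] True by auto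
  have "key J l = 0" using True by (simp add: component_key_def)
  then have s: "key J (m s) = 0" "s \<in> {1..s}" using zero_key_last(1)[OF j0(1)] j0 by auto
  have kz: "key J (m j) \<noteq> 0" if "j \<in> {1..s - 1}" for j
  proof -
    have "j \<in> {1..s}" "j \<noteq> s" using that s(2) by auto
    then show ?thesis using zero_key_last(1)[of j] by blast
  qed
  then have "(\<Sum>j=1..s - 1. g (L j)) = (\<Sum>j=1..s - 1. g (key J (m j)))"
    by (intro sum.cong) (auto simp: shifted_index_eq)
  also have "\<dots> = (\<Sum>p\<in>block_keys l J. g p)"
  proof (rule sum.reindex_bij_betw)
    have "{1..s - 1} = {1..s} - {s}" using s(2) by auto
    moreover have "bij_betw (\<lambda>j. key J (m j)) ({1..s} - {s}) (key J ` J - {0})"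
    proof (rule bij_betw_subset[OF key_bij])
      show "(\<lambda>j. key J (m j)) ` ({1..s} - {s}) = key J ` J - {0}"
        using inj_on_image_set_diff[OF bij_betw_imp_inj_on[OF key_bij], of "{1..s}" "{s}"] s
          bij_betw_imp_surj_on[OF key_bij] by simp
    qed auto
    moreover have "key J ` J - {0} = block_keys l J"
    proof
      show "key J ` J - {0} \<subseteq> block_keys l J" using key_nonzero by (auto simp: block_keys_def)
      show "block_keys l J \<subseteq> key J ` J - {0}"
      proof
        fix p assume "p \<in> block_keys l J"
        then obtain i where i: "i \<in> J" "p = block J (min i (l - 1))" by (auto simp: block_keys_def)
        \<comment> \<open>Both \<open>l - 1\<close> and \<open>l\<close> belong to \<open>J\<close> here, and \<open>l - 1\<close> has the key of the last block.\<close>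
        define i' where "i' = min i (l - 1)"
        have "i' \<in> J" using i(1) True by (simp add: i'_def min_def)
        moreover have "key J i' = p" using i(2) l4 by (auto simp: i'_def component_key_def min_def)
        moreover have "p \<noteq> 0" using i(2) block_nonzero by simp
        ultimately show "p \<in> key J ` J - {0}" by blast
      qed
    qed
    ultimately show "bij_betw (\<lambda>j. key J (m j)) {1..s - 1} (block_keys l J)" by simp
  qed
  finally show ?thesis .
next
  case False
  have k: "key J i = block J (min i (l - 1))" if "i \<in> J" for i
    using False that by (auto simp: component_key_def)
  obtain i where i: "i \<in> J" "key J i = block J (l - 1)"
    using last k[of l] k[of "l - 1"] by fastforce
  obtain j0 where j0: "j0 \<in> {1..s}" "key J i = key J (m j0)" using key_surj[OF i(1)] .
  have "j0 = s"
  proof (rule ccontr)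
    assume "j0 \<noteq> s"
    then have s: "j0 < s" "s \<in> {1..s}" using j0(1) by auto
    then have "m j0 < m s" using min_index_mono[OF j0(1) s(2)] by simp
    then have "block J (min (m j0) (l - 1)) \<le> block J (min (m s) (l - 1))"
      "block J (min (m s) (l - 1)) \<le> block J (l - 1)" by (auto intro!: block_mono)
    then have "key J (m j0) = key J (m s)"
      using k[OF component(1)[OF j0(1)]] k[OF component(1)[OF s(2)]] i(2) j0(2) by simp
    then show False using key_inj[OF j0(1) s(2)] s(1) by simp
  qed
  then have "L s = block J (l - 1)" using shifted_index_eq[OF j0(1)] i(2) j0(2) block_nonzero by simp
  moreover have "{1..s} = insert s {1..s - 1}" using j0(1) \<open>j0 = s\<close> by auto
  moreover have "s \<notin> {1..s - 1}" using j0(1) \<open>j0 = s\<close> by auto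
  ultimately have "(\<Sum>j=1..s. g (L j)) = (\<Sum>j=1..s - 1. g (L j))" using g by simp
  then show ?thesis using sum_shifted_index[OF False] by simp
qed

lemma one_component:
  assumes "J = {1..l}"
  shows "s = 1"
proof -
  have "key J i = 1" if "i \<in> J" for i
  proof -
    have "{1..<min i (l - 1)} - J = {}" using assms by auto
    moreover have "l - 2 \<in> J" using assms l4 by auto
    ultimately show ?thesis by (simp add: component_key_def block_def One_nat_def)
  qed
  then have "key J ` J = {1}" using assms l4 by force
  then show ?thesis using bij_betw_same_card[OF key_bij] by simp
qed

end

theorem proposition5p20:
  fixes H :: "'g::complex_lie_algebra set"
    and \<alpha> :: "nat \<Rightarrow> 'g \<Rightarrow> complex"
    and I \<Pi> :: "('g \<Rightarrow> complex) set"
    and C :: "nat \<Rightarrow> ('g \<Rightarrow> complex) set"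
    and L :: "nat \<Rightarrow> nat"
    and l r s t :: nat
  assumes "simple_lie_algebra TYPE('g)"
    and "cartan_subalgebra H"
    and "l \<ge> 4"
    and "simple_roots_type_D H l \<alpha>"
    and "\<Pi> = \<alpha> ` {1..l}"
    and "I \<subseteq> \<Pi>"
    and "r = card I"
    and "t = card ({\<alpha> (l - 1), \<alpha> l} \<inter> I)"
    and "bij_betw C {1..s} (dynkin_components H I)"
    and "\<And>j k. 1 \<le> j \<Longrightarrow> j < k \<Longrightarrow> k \<le> s \<Longrightarrow> min_index l \<alpha> (C j) < min_index l \<alpha> (C k)"
    and "\<And>j. L j = shifted_index l \<alpha> C s j"
  shows "(\<alpha> 1 \<in> I \<and> t = 0 \<longrightarrow>
           int (card (abelian_ideal_sets H \<Pi> I)) =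
             2 ^ (l - r) - 2 ^ (l - r - 2) +
             (\<Sum>j=1..s. 2 * int ((l - r - 1) choose (L j - 1)) - int ((l - r - 2) choose (L j - 1)))) \<and>
         (\<alpha> 1 \<in> I \<and> t = 1 \<longrightarrow>
           card (abelian_ideal_sets H \<Pi> I) =
             2 ^ (l - r - 1) + (\<Sum>j=1..s. (l - r - 1) choose (L j - 1))) \<and>
         (\<alpha> 1 \<in> I \<and> t = 2 \<longrightarrow>
           card (abelian_ideal_sets H \<Pi> I) =
             2 ^ (l - r - 1) + (\<Sum>j=1..s - 1. (l - r - 1) choose (L j - 1))) \<and>
         (\<alpha> 1 \<notin> I \<and> t = 0 \<longrightarrow>
           card (abelian_ideal_sets H \<Pi> I) =
             2 ^ (l - r) + (\<Sum>j=1..s. 2 * ((l - r - 1) choose (L j - 1)))) \<and>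
         (\<alpha> 1 \<notin> I \<and> t = 1 \<longrightarrow>
           card (abelian_ideal_sets H \<Pi> I) =
             2 ^ (l - r - 1) + 2 ^ (l - r - 2) +
             (\<Sum>j=1..s. (l - r - 1) choose (L j - 1)) +
             (\<Sum>j=1..s - 1. (l - r - 2) choose (L j - 1))) \<and>
         (\<alpha> 1 \<notin> I \<and> t = 2 \<longrightarrow>
           card (abelian_ideal_sets H \<Pi> I) =
             2 ^ (l - r) + 2 * (\<Sum>j=1..s - 1. (l - r - 1) choose (L j - 1)))"
proof -
  obtain J where IJ: "J \<subseteq> {1..l}" "I = \<alpha> ` J"
    using assms(5,6) by (auto simp: subset_image_iff)
  interpret ordered_components H l \<alpha> J C s
    by unfold_locales (use assms IJ in auto)
  define N where "N = card (abelian_ideal_sets H \<Pi> I)"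
  define S where "S n = (\<Sum>p\<in>block_keys l J. n choose (p - 1))" for n
  obtain W where W: "is_weight l J W" using weight_exists[OF l4, of J] by auto
  have N: "N = card (abelian_pair_ideals W l)"
    unfolding N_def assms(5) IJ(2) by (rule card_abelian_ideal_sets[OF IJ(1) W])
  have mem: "\<alpha> i \<in> I \<longleftrightarrow> i \<in> J" if "i \<in> {1..l}" for i
    using IJ \<alpha>_eq[OF that] by (auto simp: subset_iff)
  have l1: "1 \<in> {1..l}" "l - 1 \<in> {1..l}" "l \<in> {1..l}" "l - 1 \<noteq> l" using l4 by auto
  have r: "r = card J"
    unfolding assms(7) IJ(2) using inj_on_subset[OF inj_\<alpha> IJ(1)] by (rule card_image)
  have t: "t = card (J \<inter> {l - 1, l})"
  proof -
    have "{\<alpha> (l - 1), \<alpha> l} \<inter> I = \<alpha> ` (J \<inter> {l - 1, l})"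
      unfolding IJ(2) using inj_on_image_Int[OF inj_\<alpha> IJ(1), of "{l - 1, l}"] l1 by auto
    moreover have "inj_on \<alpha> (J \<inter> {l - 1, l})" using IJ(1) by (intro inj_on_subset[OF inj_\<alpha>]) auto
    ultimately show ?thesis using assms(8) by (simp add: card_image)
  qed
  have t1: "t = 0 \<longleftrightarrow> l - 1 \<notin> J \<and> l \<notin> J" "t = 2 \<longleftrightarrow> l - 1 \<in> J \<and> l \<in> J"
    using l1(4) by (auto simp: t Int_insert_right)
  have rl: "r \<le> l" using card_mono[OF _ IJ(1)] r by simp
  have r0: "r \<le> l - 2" if "t = 0"
  proof -
    have "J \<subseteq> {1..l} - {l - 1, l}" using IJ(1) that t1(1) by auto
    then have "card J \<le> card ({1..l} - {l - 1, l})" by (intro card_mono) auto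
    also have "\<dots> = l - 2" using l1 by (subst card_Diff_subset) auto
    finally show ?thesis using r by simp
  qed
  have r1: "r < l" if "1 \<notin> J \<or> t \<noteq> 2"
  proof -
    have "J \<noteq> {1..l}" using that t1(2) l1 by auto
    then show ?thesis using psubset_card_mono[of "{1..l}" J] IJ(1) r by auto
  qed
  have r2: "r < l - 1" if "1 \<notin> J" "t = 1"
  proof -
    have "\<not> (l - 1 \<in> J \<and> l \<in> J)" using that(2) t1(2) by simp
    then obtain x where x: "x \<in> {l - 1, l}" "x \<notin> J" by auto
    have "J \<subseteq> {1..l} - {1, x}" using IJ(1) that(1) x by auto
    then have "card J \<le> card ({1..l} - {1, x})" by (intro card_mono) auto
    also have "\<dots> = l - 2" using l1 x l4 by (subst card_Diff_subset) auto
    finally show ?thesis using r l4 by simp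
  qed
  have all: "(\<Sum>j=1..s. n choose (L j - 1)) = S n" if "t < 2" for n
    unfolding S_def assms(11) using sum_shifted_index[of "\<lambda>p. n choose (p - 1)"] that t1(2) by auto
  have butlast: "(\<Sum>j=1..s - 1. n choose (L j - 1)) = S n" if "t > 0" "r < l" "n < l - 1 - r + t - 1" for n
  proof -
    have "block J (l - 1) + card (J - {l - 1, l}) = l - 1" by (rule block_last(2)[OF l4 IJ(1)])
    moreover have "card (J - {l - 1, l}) + t = r"
      unfolding r t using card_Int_Diff[OF finite_J, of "{l - 1, l}"] by simp
    ultimately have "n choose (block J (l - 1) - 1) = 0" using that by (intro binomial_eq_0) arith
    moreover have "l - 1 \<in> J \<or> l \<in> J" using that(1) t1(1) by auto
    ultimately show ?thesis
      unfolding S_def assms(11) using sum_shifted_index_butlast[of "\<lambda>p. n choose (p - 1)"] by blast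
  qed
  note count = card_abelian_pair_ideals[OF l4 IJ(1) W, folded r t N, unfolded block_sum_def, folded S_def]
  have pow: "2 ^ (l - r) = 2 * (2 :: nat) ^ (l - r - 1)" if "r < l"
    using that by (metis Suc_diff_Suc diff_Suc_eq_diff_pred diff_commute power_Suc)
  have "t \<le> 2" unfolding t using card_mono[of "{l - 1, l}" "J \<inter> {l - 1, l}"] l1(4) by simp
  show ?thesis
    unfolding mem[OF l1(1)] N_def[symmetric]
  proof (intro conjI impI; elim conjE)
    assume a: "1 \<in> J" "t = 0"
    have "N + (2 ^ (l - r - 2) + S (l - r - 2)) = 2 ^ (l - r) + 2 * S (l - r - 1)"
      using count(1) a r1 pow by simp
    then have "int N = int (2 ^ (l - r)) - int (2 ^ (l - r - 2)) + (2 * int (S (l - r - 1)) - int (S (l - r - 2)))"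
      by linarith
    then show "int N = 2 ^ (l - r) - 2 ^ (l - r - 2) +
        (\<Sum>j=1..s. 2 * int ((l - r - 1) choose (L j - 1)) - int ((l - r - 2) choose (L j - 1)))"
      using a by (simp add: all[symmetric] sum_subtractf sum_distrib_left)
  next
    assume a: "1 \<in> J" "t = 1"
    then show "N = 2 ^ (l - r - 1) + (\<Sum>j=1..s. (l - r - 1) choose (L j - 1))"
      using count(2) by (simp add: all)
  next
    assume a: "1 \<in> J" "t = 2"
    show "N = 2 ^ (l - r - 1) + (\<Sum>j=1..s - 1. (l - r - 1) choose (L j - 1))"
    proof (cases "r = l")
      case True
      \<comment> \<open>Here \<open>r = l\<close>, and both exponents are the truncated difference \<open>0\<close>.\<close>
      then have "J = {1..l}" using IJ(1) r by (intro card_subset_eq) auto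
      then show ?thesis using one_component count(4) True by simp
    next
      case False
      then have "r < l" using rl by simp
      then show ?thesis using count(3) a butlast[of "l - r - 1"] by simp
    qed
  next
    assume a: "1 \<notin> J" "t = 0"
    then show "N = 2 ^ (l - r) + (\<Sum>j=1..s. 2 * ((l - r - 1) choose (L j - 1)))"
      using count(1) r1 pow by (simp add: all sum_distrib_left[symmetric])
  next
    assume a: "1 \<notin> J" "t = 1"
    then have "(\<Sum>j=1..s - 1. (l - r - 2) choose (L j - 1)) = S (l - r - 2)"
      using r2 by (intro butlast) auto
    then show "N = 2 ^ (l - r - 1) + 2 ^ (l - r - 2) + (\<Sum>j=1..s. (l - r - 1) choose (L j - 1)) +
        (\<Sum>j=1..s - 1. (l - r - 2) choose (L j - 1))"
      using count(2) a by (simp add: all)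
  next
    assume a: "1 \<notin> J" "t = 2"
    then have "(\<Sum>j=1..s - 1. (l - r - 1) choose (L j - 1)) = S (l - r - 1)"
      using r1 by (intro butlast) auto
    then show "N = 2 ^ (l - r) + 2 * (\<Sum>j=1..s - 1. (l - r - 1) choose (L j - 1))"
      using count(3) a r1 pow by simp
  qed
qed

end
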